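(* Let $n$ be a positive integer, $0 < p < \infty$, and $A \in W^{n-1,\infty}(D)$. Then every function $w \in H^{n,p}_{A}(D)$ has the form \[ w(z) = e^{\psi(z)}\sum_{k=0}^{n-1} \bar z^k w_k(z), \] where \[ \psi(z) = -\frac{1}{\pi} \iint_D \frac{A(\zeta)}{\zeta - z}\,d\xi\,d\eta \qquad (\zeta = \xi + i\eta) \] and $w_k \in H^p(D)$ for every $k$, $0 \le k \le n-1$.
   Context: $D$ is the open unit disk in $\mathbb{C}$. $W^{k,q}(D)$ is the Sobolev space of (complex-valued) $L^q(D)$ functions with $k$ weak derivatives which are all in $L^q(D)$ (so $W^{0,q}(D)=L^q(D)$). For $0<p<\infty$, the Hardy space $H^p(D)$ is the set of holomorphic functions $f$ on $D$ with $\sup_{0<r<1}\int_0^{2\pi}|f(re^{i\theta})|^p\,d\theta<\infty$. The meta-Hardy space $H^{n,p}_A(D)$ is the set of functions $f: D \to \mathbb{C}$ that satisfy $\left(\frac{\partial}{\partial\bar z}- A\right)^n f= 0$ (the $n$-fold composition of the operator $f \mapsto \frac{\partial f}{\partial\bar z} - Af$) and \[ \|f\|_{n,p} := \sum_{k=0}^{n-1} \left( \sup_{0 < r < 1} \int_0^{2\pi} \left| \frac{\partial^k f}{\partial\bar z^k}(re^{i\theta}) \right|^p d\theta \right)^{1/p} < \infty. \] *)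

theory Defs
  imports "HOL-Analysis.Analysis"
begin

section \<open>Test functions and weak derivatives on open subsets of the plane\<close>

definition dx :: "(complex \<Rightarrow> complex) \<Rightarrow> complex \<Rightarrow> complex"
  where "dx f = (\<lambda>z. frechet_derivative f (at z) 1)"

definition dy :: "(complex \<Rightarrow> complex) \<Rightarrow> complex \<Rightarrow> complex"
  where "dy f = (\<lambda>z. frechet_derivative f (at z) \<i>)"

definition dbar :: "(complex \<Rightarrow> complex) \<Rightarrow> complex \<Rightarrow> complex"
  where "dbar f = (\<lambda>z. (dx f z + \<i> * dy f z) / 2)"

text \<open>Differentiability is real (Frechet) differentiability; every function that is
  \<open>k + 1\<close> times differentiable in this sense is of class \<open>C\<^sup>k\<close>, so \<open>smooth\<close> means
  \<open>C\<^sup>\<infinity>\<close> on the whole plane.\<close>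

primrec times_differentiable :: "nat \<Rightarrow> (complex \<Rightarrow> complex) \<Rightarrow> bool" where
  "times_differentiable 0 f \<longleftrightarrow> continuous_on UNIV f"
| "times_differentiable (Suc k) f \<longleftrightarrow>
     (\<forall>z. f differentiable (at z)) \<and>
     (\<forall>v. times_differentiable k (\<lambda>z. frechet_derivative f (at z) v))"

definition smooth :: "(complex \<Rightarrow> complex) \<Rightarrow> bool"
  where "smooth f \<longleftrightarrow> (\<forall>k. times_differentiable k f)"

definition test_functions :: "complex set \<Rightarrow> (complex \<Rightarrow> complex) set" where
  "test_functions S =
     {\<phi>. smooth \<phi> \<and> compact (closure {z. \<phi> z \<noteq> 0}) \<and> closure {z. \<phi> z \<noteq> 0} \<subseteq> S}"

definition locally_integrable :: "complex set \<Rightarrow> (complex \<Rightarrow> complex) \<Rightarrow> bool" where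
  "locally_integrable S f \<longleftrightarrow> (\<forall>K. compact K \<and> K \<subseteq> S \<longrightarrow> f absolutely_integrable_on K)"

text \<open>\<open>P\<close> is a differential operator with constant coefficients, homogeneous of order \<open>m\<close>, acting
  on test functions; \<open>g\<close> is a representative of the distribution \<open>P f\<close> on \<open>S\<close>.\<close>

definition has_weak_derivative ::
  "complex set \<Rightarrow> nat \<Rightarrow> ((complex \<Rightarrow> complex) \<Rightarrow> complex \<Rightarrow> complex) \<Rightarrow>
   (complex \<Rightarrow> complex) \<Rightarrow> (complex \<Rightarrow> complex) \<Rightarrow> bool" where
  "has_weak_derivative S m P f g \<longleftrightarrow>
     locally_integrable S f \<and> locally_integrable S g \<and>
     (\<forall>\<phi>\<in>test_functions S.
        (LINT z:S|lebesgue. f z * P \<phi> z) = (-1) ^ m * (LINT z:S|lebesgue. g z * \<phi> z))"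

definition has_weak_partial ::
  "complex set \<Rightarrow> nat \<Rightarrow> nat \<Rightarrow> (complex \<Rightarrow> complex) \<Rightarrow> (complex \<Rightarrow> complex) \<Rightarrow> bool" where
  "has_weak_partial S a b = has_weak_derivative S (a + b) (\<lambda>\<phi>. (dx ^^ a) ((dy ^^ b) \<phi>))"

definition has_weak_dbar ::
  "complex set \<Rightarrow> nat \<Rightarrow> (complex \<Rightarrow> complex) \<Rightarrow> (complex \<Rightarrow> complex) \<Rightarrow> bool" where
  "has_weak_dbar S k = has_weak_derivative S k (dbar ^^ k)"


section \<open>The spaces \<open>W\<^sup>k\<^sup>,\<^sup>\<infinity>\<close>\<close>

definition L_infinity :: "complex set \<Rightarrow> (complex \<Rightarrow> complex) set" where
  "L_infinity S = {f. f \<in> borel_measurable (lebesgue_on S) \<and>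
                      (\<exists>C. AE z in lebesgue_on S. norm (f z) \<le> C)}"

definition W_infinity :: "nat \<Rightarrow> complex set \<Rightarrow> (complex \<Rightarrow> complex) set" where
  "W_infinity k S = {f \<in> L_infinity S.
     \<forall>a b. a + b \<le> k \<longrightarrow> (\<exists>g\<in>L_infinity S. has_weak_partial S a b f g)}"


section \<open>Hardy and meta-Hardy spaces on the unit disk\<close>

abbreviation unit_disk :: "complex set"
  where "unit_disk \<equiv> ball 0 1"

definition hardy_sup :: "real \<Rightarrow> (complex \<Rightarrow> complex) \<Rightarrow> ennreal" where
  "hardy_sup p f = (SUP r\<in>{0<..<1}.
     \<integral>\<^sup>+\<theta>\<in>{0..2 * pi}. ennreal (norm (f (of_real r * cis \<theta>)) powr p) \<partial>lebesgue)"

definition Hardy :: "real \<Rightarrow> (complex \<Rightarrow> complex) set" where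
  "Hardy p = {f. f holomorphic_on unit_disk \<and> hardy_sup p f < \<infinity>}"

definition ennreal_pow :: "ennreal \<Rightarrow> real \<Rightarrow> ennreal" where
  "ennreal_pow x s = (if x = \<infinity> then \<infinity> else ennreal (enn2real x powr s))"

text \<open>One application of \<open>f \<mapsto> dbar f - A f\<close>. It is a relation because the weak derivative \<open>d\<close> is
  only determined almost everywhere; its \<open>n\<close>-fold composition is the relational power.\<close>

definition meta_op ::
  "(complex \<Rightarrow> complex) \<Rightarrow> (complex \<Rightarrow> complex) \<Rightarrow> (complex \<Rightarrow> complex) \<Rightarrow> bool" where
  "meta_op A f g \<longleftrightarrow> (\<exists>d. has_weak_dbar unit_disk 1 f d \<and> g = (\<lambda>z. d z - A z * f z))"

text \<open>\<open>g k\<close> is a representative of the \<open>k\<close>-th weak \<open>dbar\<close>-derivative of \<open>f\<close>; the representative of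
  the zeroth derivative is \<open>f\<close> itself.\<close>

definition meta_Hardy :: "nat \<Rightarrow> real \<Rightarrow> (complex \<Rightarrow> complex) \<Rightarrow> (complex \<Rightarrow> complex) set" where
  "meta_Hardy n p A = {f. (meta_op A ^^ n) f (\<lambda>_. 0) \<and>
     (\<exists>g. g 0 = f \<and> (\<forall>k<n. has_weak_dbar unit_disk k f (g k)) \<and>
          (\<Sum>k<n. ennreal_pow (hardy_sup p (g k)) (1 / p)) < \<infinity>)}"

text \<open>The integrand at \<open>\<zeta> = z\<close> is irrelevant (a null set).\<close>

definition cauchy_potential :: "(complex \<Rightarrow> complex) \<Rightarrow> complex \<Rightarrow> complex" where
  "cauchy_potential A z =
     - (1 / of_real pi) * (LINT \<zeta>:unit_disk|lebesgue. A \<zeta> / (\<zeta> - z))"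

end

theory Submission
  imports Defs "HOL-Complex_Analysis.Cauchy_Integral_Formula" "HOL-Real_Asymp.Real_Asymp"
begin

text \<open>With \<open>dbar \<psi> = A\<close> the substitution \<open>v = exp (- \<psi>) w\<close> turns \<open>(dbar - A)^n w = 0\<close> into
  \<open>dbar^n v = 0\<close>, and Weyl's lemma for \<open>dbar\<close> makes \<open>v\<close> a polynomial in \<open>cnj z\<close> with holomorphic
  coefficients. Up to constants its leading coefficient is \<open>dbar^(n-1) v\<close>, and the others are found
  recursively from the lower derivatives; as \<open>dbar^j v = exp (- \<psi>) (dbar - A)^j w\<close> is a combination of
  \<open>w, \<dots>, dbar^j w\<close> with bounded coefficients, all of them have bounded means over almost all circles,
  hence over all circles by continuity and Fatou's lemma.

  The weak calculus (product rule, exponentials, Weyl's lemma) rests on the fact that an integrable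
  function \<open>F\<close> of compact support with integrable weak derivative \<open>dbar F = H\<close> is the Cauchy transform
  of \<open>H\<close>. The kernel \<open>1 / z\<close> is approximated by \<open>cnj z / (\<bar>z\<bar>^2 + \<epsilon>^2)\<close>, whose \<open>dbar\<close>-derivative
  \<open>\<epsilon>^2 / (\<bar>z\<bar>^2 + \<epsilon>^2)^2\<close> is a positive kernel of mass \<open>\<pi>\<close>.\<close>

section \<open>Classical derivatives\<close>

text \<open>Null sets and the choice of test functions shape the details. Weak derivatives are
  determined only almost everywhere in the disk, and the given functions are only Lebesgue
  measurable, so the work is done with Borel representatives on the whole plane
  (\<open>disk_rep\<close>), where \<open>lborel\<close> gives Fubini and reflection. A circle is a
  null set: an identity almost everywhere carries over to means for almost every radius only, so
  bounds are kept as \<open>AE_mean_bounded\<close> until a holomorphic function is reached. The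
  hypotheses test with smooth functions, whereas the useful tests, a cutoff times a translated
  kernel, are taken to be C^1 here. \<open>weak_dbar\<close> admits them, and mollifying the test
  function, not the function tested, shows that smooth tests suffice for it. The Cauchy transform is
  antisymmetric for the pairing by integration over the plane. This one fact identifies
  \<open>F\<close> with the transform of \<open>H\<close>, shows that \<open>dbar\<close> inverts
  the transform, and yields the product rule for a bounded factor with bounded derivative times a
  merely locally integrable one.\<close>

lemma times_differentiable_SucI:
  assumes "\<And>z. (f has_derivative D z) (at z)"
    and "\<And>v. times_differentiable k (\<lambda>z. D z v)"
  shows "times_differentiable (Suc k) f"
proof -
  have "frechet_derivative f (at z) = D z" for z
    using frechet_derivative_at[OF assms(1)] by simp
  then show ?thesis using assms by (auto simp: differentiable_def)
qed

lemma times_differentiable_SucD: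
  assumes "times_differentiable (Suc k) f"
  shows "(f has_derivative frechet_derivative f (at z)) (at z)"
  using assms frechet_derivative_works by auto

lemma times_differentiable_Suc_imp:
  "times_differentiable (Suc k) f \<Longrightarrow> times_differentiable k f"
proof (induction k arbitrary: f)
  case 0
  then show ?case
    by (auto simp: continuous_on_eq_continuous_within intro!: differentiable_imp_continuous_within)
next
  case (Suc k)
  then show ?case by simp
qed

lemma times_differentiable_continuous:
  "times_differentiable k f \<Longrightarrow> continuous_on S f"
proof (induction k)
  case 0
  then show ?case by (auto intro: continuous_on_subset)
next
  case (Suc k)
  then show ?case using times_differentiable_Suc_imp by blast
qed

lemma times_differentiable_mono:
  assumes "times_differentiable k f" "j \<le> k"
  shows "times_differentiable j f"
  using assms(2,1) by (induction rule: dec_induct) (auto dest: times_differentiable_Suc_imp simp del: times_differentiable.simps)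

lemma times_differentiable_const: "times_differentiable k (\<lambda>_. c)"
proof (induction k arbitrary: c)
  case (Suc k)
  show ?case
    by (rule times_differentiable_SucI[where D = "\<lambda>_ _. 0"]) (use Suc in \<open>auto intro!: derivative_eq_intros\<close>)
qed (auto intro: continuous_intros)

lemma times_differentiable_add:
  assumes "times_differentiable k f" "times_differentiable k g"
  shows "times_differentiable k (\<lambda>z. f z + g z)"
  using assms
proof (induction k arbitrary: f g)
  case (Suc k)
  show ?case
    by (rule times_differentiable_SucI[OF has_derivative_add[OF times_differentiable_SucD[OF Suc.prems(1)] times_differentiable_SucD[OF Suc.prems(2)]]])
       (use Suc in auto)
qed (auto intro: continuous_intros)

lemma times_differentiable_mult:
  assumes "times_differentiable k f" "times_differentiable k g"
  shows "times_differentiable k (\<lambda>z. f z * g z)"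
  using assms
proof (induction k arbitrary: f g)
  case (Suc k)
  note fg = times_differentiable_Suc_imp[OF Suc.prems(1)] times_differentiable_Suc_imp[OF Suc.prems(2)]
  show ?case
    by (rule times_differentiable_SucI[OF has_derivative_mult[OF times_differentiable_SucD[OF Suc.prems(1)] times_differentiable_SucD[OF Suc.prems(2)]]])
       (use Suc fg in \<open>auto intro!: times_differentiable_add\<close>)
qed (auto intro: continuous_intros)

lemma times_differentiable_bounded_linear:
  assumes "bounded_linear f"
  shows "times_differentiable k f"
proof (cases k)
  case (Suc j)
  show ?thesis unfolding Suc
    by (rule times_differentiable_SucI[where D = "\<lambda>_. f"])
       (auto intro: bounded_linear_imp_has_derivative assms times_differentiable_const)
qed (auto intro: linear_continuous_on assms)

lemmas times_differentiable_intros = times_differentiable_add times_differentiable_mult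
  times_differentiable_const

lemma dbar_eq:
  assumes "(f has_derivative D) (at z)"
  shows "dbar f z = (D 1 + \<i> * D \<i>) / 2"
  using frechet_derivative_at[OF assms] by (simp add: dbar_def dx_def dy_def)

lemma dbar_mult:
  assumes "times_differentiable 1 f" "times_differentiable 1 g"
  shows "dbar (\<lambda>z. f z * g z) z = dbar f z * g z + f z * dbar g z"
proof -
  note D = times_differentiable_SucD[OF assms(1)[unfolded One_nat_def], of z]
    times_differentiable_SucD[OF assms(2)[unfolded One_nat_def], of z]
  show ?thesis
    unfolding dbar_eq[OF has_derivative_mult[OF D]] dbar_eq[OF D(1)] dbar_eq[OF D(2)]
    by (simp add: field_simps)
qed

lemma times_differentiable_dx: "times_differentiable (Suc k) f \<Longrightarrow> times_differentiable k (dx f)"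
  and times_differentiable_dy: "times_differentiable (Suc k) f \<Longrightarrow> times_differentiable k (dy f)"
  by (simp_all add: dx_def dy_def)

lemma times_differentiable_dbar:
  assumes "times_differentiable (Suc k) f"
  shows "times_differentiable k (dbar f)"
proof -
  have "times_differentiable k (\<lambda>z. (1/2) * (dx f z + \<i> * dy f z))"
    by (intro times_differentiable_intros times_differentiable_dx times_differentiable_dy assms)
  then show ?thesis by (simp add: dbar_def)
qed

lemma dbar_eq_0:
  assumes "open S" "z \<in> S" "\<And>x. x \<in> S \<Longrightarrow> f x = c"
  shows "dx f z = 0" "dy f z = 0" "dbar f z = 0"
proof -
  have "(f has_derivative (\<lambda>_. 0)) (at z)"
    by (rule has_derivative_transform_within_open[where f = "\<lambda>_. c" and s = S]) (use assms in auto)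
  then have "frechet_derivative f (at z) = (\<lambda>_. 0)" using frechet_derivative_at by metis
  then show "dx f z = 0" "dy f z = 0" "dbar f z = 0" by (auto simp: dx_def dy_def dbar_def)
qed

lemma has_derivative_norm_square_diff:
  fixes a :: "'a :: real_inner"
  shows "((\<lambda>z. (norm (z - a))\<^sup>2) has_derivative (\<lambda>v. 2 * ((z - a) \<bullet> v))) (at z within S)"
  unfolding power2_norm_eq_inner
  by (rule derivative_eq_intros refl)+ (auto simp: inner_commute)

lemma has_derivative_radial:
  fixes z a :: complex
  assumes "(g has_real_derivative g') (at ((norm (z - a))\<^sup>2))"
  shows "((\<lambda>z. complex_of_real (g ((norm (z - a))\<^sup>2))) has_derivative
            (\<lambda>v. complex_of_real (g' * (2 * ((z - a) \<bullet> v))))) (at z)"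
proof -
  have "((\<lambda>z. g ((norm (z - a))\<^sup>2)) has_derivative (\<lambda>v. g' * (2 * ((z - a) \<bullet> v)))) (at z)"
    using has_derivative_compose[OF has_derivative_norm_square_diff assms[unfolded has_field_derivative_def]]
    by simp
  then show ?thesis by (rule has_derivative_of_real)
qed

lemma times_differentiable_inner:
  "times_differentiable k (\<lambda>z. complex_of_real (2 * ((z - a) \<bullet> v)))"
proof -
  have "times_differentiable k (\<lambda>z. complex_of_real (2 * (z \<bullet> v)) + (- complex_of_real (2 * (a \<bullet> v))))"
    by (intro times_differentiable_intros times_differentiable_bounded_linear
          bounded_linear_compose[OF bounded_linear_of_real] bounded_linear_const_mult bounded_linear_inner_left)
  then show ?thesis by (simp add: inner_diff_left algebra_simps)
qed

text \<open>Kernels and cutoffs are written as functions of the squared distance, which is smooth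
  also at the centre. Its \<open>dbar\<close>-derivative is \<open>z - a\<close>, so the chain rule
  gives the second claim.\<close>

lemma times_differentiable_radial:
  fixes a :: complex
  assumes g: "\<And>s. s \<ge> 0 \<Longrightarrow> (g has_real_derivative g' s) (at s)"
    and g': "continuous_on {0..} g'"
  shows "times_differentiable 1 (\<lambda>z. complex_of_real (g ((norm (z - a))\<^sup>2)))"
    and "dbar (\<lambda>z. complex_of_real (g ((norm (z - a))\<^sup>2))) z = of_real (g' ((norm (z - a))\<^sup>2)) * (z - a)"
proof -
  show "times_differentiable 1 (\<lambda>z. complex_of_real (g ((norm (z - a))\<^sup>2)))"
    unfolding One_nat_def
  proof (rule times_differentiable_SucI[OF has_derivative_radial[OF g]])
    show "times_differentiable 0 (\<lambda>z. complex_of_real (g' ((norm (z - a))\<^sup>2) * (2 * ((z - a) \<bullet> v))))" for v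
      by (auto intro!: continuous_intros continuous_on_compose2[OF g'])
  qed simp
  show "dbar (\<lambda>z. complex_of_real (g ((norm (z - a))\<^sup>2))) z = of_real (g' ((norm (z - a))\<^sup>2)) * (z - a)"
    by (subst dbar_eq[OF has_derivative_radial[OF g]]) (auto simp: complex_eq_iff field_simps)
qed

subsection \<open>Bump and cutoff functions\<close>

text \<open>The powers of \<open>t\<close> in the denominator close the family under
  differentiation: the derivative of \<open>flat m\<close> combines \<open>flat (m + 2)\<close> and
  \<open>flat (m + 1)\<close>. Smoothness of \<open>bump\<close> is then a single induction over all
  \<open>m\<close> at once.\<close>

definition flat :: "nat \<Rightarrow> real \<Rightarrow> real" where
  "flat m t = (if t > 0 then exp (- 1 / t) / t ^ m else 0)"

lemma power_div_fact_le_exp: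
  fixes x :: real
  assumes "x \<ge> 0"
  shows "x ^ n / fact n \<le> exp x"
proof -
  have "(\<Sum>i\<in>{n}. x ^ i /\<^sub>R fact i) \<le> (\<Sum>i. x ^ i /\<^sub>R fact i)"
    by (rule sum_le_suminf) (use assms summable_exp_generic[of x] in auto)
  then show ?thesis by (simp add: exp_def field_simps)
qed

text \<open>The term of degree \<open>m + 2\<close> of the exponential series at
  \<open>1 / t\<close> leaves a factor \<open>t^2\<close> after division by \<open>t ^ m\<close>.
  This makes the difference quotient at 0 tend to 0.\<close>

lemma flat_le: "\<bar>flat m t\<bar> \<le> fact (m + 2) * t\<^sup>2"
proof (cases "t > 0")
  case True
  have "(1 / t) ^ (m + 2) / fact (m + 2) \<le> exp (1 / t)"
    by (rule power_div_fact_le_exp) (use True in auto)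
  then have "exp (- (1 / t)) \<le> fact (m + 2) * t ^ (m + 2)"
    using True by (simp add: exp_minus field_simps power_divide del: fact_Suc)
  then show ?thesis
    using True by (simp add: flat_def field_simps power_add power2_eq_square del: fact_Suc)
qed (auto simp: flat_def)

lemma flat_has_derivative:
  "(flat m has_real_derivative flat (m + 2) t - of_nat m * flat (m + 1) t) (at t)"
proof -
  consider "t > 0" | "t < 0" | "t = 0" by linarith
  then show ?thesis
  proof cases
    case 1
    have "((\<lambda>t. exp (- 1 / t) / t ^ m) has_real_derivative flat (m + 2) t - of_nat m * flat (m + 1) t) (at t)"
    proof (cases m)
      case 0
      then show ?thesis using 1
        by (auto intro!: derivative_eq_intros simp: flat_def field_simps power2_eq_square)
    next
      case (Suc j)
      have "t ^ j = t * t ^ (j - Suc 0)" if "0 < j" using that by (cases j) auto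
      then show ?thesis using 1 Suc
        by (cases "j = 0") (auto intro!: derivative_eq_intros simp: flat_def field_simps power2_eq_square)
    qed
    then show ?thesis
      by (rule has_field_derivative_transform_within_open[where S = "{0<..}"]) (use 1 in \<open>auto simp: flat_def\<close>)
  next
    case 2
    have "((\<lambda>t. 0) has_real_derivative 0) (at t)" by simp
    then have "(flat m has_real_derivative 0) (at t)"
      by (rule has_field_derivative_transform_within_open[where S = "{..<0}"]) (use 2 in \<open>auto simp: flat_def\<close>)
    then show ?thesis using 2 by (simp add: flat_def)
  next
    case 3
    have "((\<lambda>h. (flat m h - flat m 0) / h) \<longlongrightarrow> 0) (at 0)"
    proof (rule Lim_null_comparison)
      show "\<forall>\<^sub>F h in at 0. norm ((flat m h - flat m 0) / h) \<le> fact (m + 2) * \<bar>h\<bar>"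
      proof (rule eventually_at_filter[THEN iffD2], intro always_eventually allI impI)
        fix h :: real assume "h \<noteq> 0"
        then show "norm ((flat m h - flat m 0) / h) \<le> fact (m + 2) * \<bar>h\<bar>"
          using flat_le[of m h] by (simp add: flat_def[of m 0] field_simps power2_eq_square abs_mult del: fact_Suc)
      qed
      have "((\<lambda>h::real. fact (m + 2) * \<bar>h\<bar>) \<longlongrightarrow> fact (m + 2) * \<bar>0\<bar>) (at 0)"
        by (intro tendsto_intros)
      then show "((\<lambda>h::real. fact (m + 2) * \<bar>h\<bar>) \<longlongrightarrow> 0) (at 0)" by simp
    qed
    then show ?thesis using 3
      by (simp add: has_field_derivative_iff flat_def)
  qed
qed

definition bump :: "real \<Rightarrow> complex \<Rightarrow> complex" where
  "bump \<epsilon> z = complex_of_real (flat 0 (\<epsilon>\<^sup>2 - (norm z)\<^sup>2))"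

lemma smooth_bump: "smooth (bump \<epsilon>)"
proof -
  \<comment> \<open>\<open>m\<close> is arbitrary because differentiation raises it;
    \<open>z - 0\<close> fits the centre \<open>a\<close> of the radial lemma.\<close>
  have "times_differentiable k (\<lambda>z. complex_of_real (flat m (\<epsilon>\<^sup>2 - (norm (z - 0))\<^sup>2)))" for k m
  proof (induction k arbitrary: m)
    case 0
    have "isCont (flat m) t" for t
      using flat_has_derivative DERIV_isCont by blast
    then have "continuous_on UNIV (flat m)" by (simp add: continuous_on_eq_continuous_at)
    then show ?case
      by (auto intro!: continuous_intros continuous_on_compose2[of UNIV "flat m"])
  next
    case (Suc k)
    have g: "((\<lambda>s. flat m (\<epsilon>\<^sup>2 - s)) has_real_derivative
        - (flat (m + 2) (\<epsilon>\<^sup>2 - s) - of_nat m * flat (m + 1) (\<epsilon>\<^sup>2 - s))) (at s)" for s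
      by (rule DERIV_chain2[where g = "\<lambda>s. \<epsilon>\<^sup>2 - s" and Db = "-1", OF flat_has_derivative, THEN DERIV_cong])
         (auto intro!: derivative_eq_intros)
    show ?case
    proof (rule times_differentiable_SucI[OF has_derivative_radial[OF g]])
      fix v :: complex
      have "times_differentiable k (\<lambda>z. ((- 1) * complex_of_real (flat (m + 2) (\<epsilon>\<^sup>2 - (norm (z - 0))\<^sup>2)) +
          of_nat m * complex_of_real (flat (m + 1) (\<epsilon>\<^sup>2 - (norm (z - 0))\<^sup>2))) * complex_of_real (2 * ((z - 0) \<bullet> v)))"
        by (intro times_differentiable_intros Suc times_differentiable_inner)
      then show "times_differentiable k (\<lambda>z. complex_of_real (- (flat (m + 2) (\<epsilon>\<^sup>2 - (norm (z - 0))\<^sup>2) -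
          real m * flat (m + 1) (\<epsilon>\<^sup>2 - (norm (z - 0))\<^sup>2)) * (2 * ((z - 0) \<bullet> v))))"
        by simp
    qed
  qed
  from this[of _ 0] show ?thesis by (simp add: smooth_def bump_def[abs_def])
qed

lemma bump_eq_0: "\<epsilon> > 0 \<Longrightarrow> norm z \<ge> \<epsilon> \<Longrightarrow> bump \<epsilon> z = 0"
  using power_mono[of \<epsilon> "norm z" 2] by (auto simp: bump_def flat_def not_less)

text \<open>A C^1 spline from 0 to 1: its second derivative is 4 on (0, 1/2), -4 on (1/2, 1) and 0
  outside [0, 1]. One continuous derivative is what \<open>test1\<close> asks for.\<close>

definition step :: "real \<Rightarrow> real" where
  "step u = 2 * (max 0 u)\<^sup>2 - 4 * (max 0 (u - 1/2))\<^sup>2 + 2 * (max 0 (u - 1))\<^sup>2"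

lemma has_derivative_max_square:
  "((\<lambda>u::real. (max 0 u)\<^sup>2) has_real_derivative 2 * max 0 u) (at u)"
proof -
  consider "u > 0" | "u < 0" | "u = 0" by linarith
  then show ?thesis
  proof cases
    case 1
    have "((\<lambda>u. u\<^sup>2) has_real_derivative 2 * u) (at u)" by (auto intro!: derivative_eq_intros)
    then have "((\<lambda>u::real. (max 0 u)\<^sup>2) has_real_derivative 2 * u) (at u)"
      by (rule has_field_derivative_transform_within_open[where S = "{0<..}"]) (use 1 in auto)
    then show ?thesis using 1 by simp
  next
    case 2
    have "((\<lambda>u::real. (max 0 u)\<^sup>2) has_real_derivative 0) (at u)"
      by (rule has_field_derivative_transform_within_open[OF DERIV_const[of 0], where S = "{..<0}"]) (use 2 in auto)
    then show ?thesis using 2 by simp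
  next
    case 3
    have "((\<lambda>h::real. (max 0 h)\<^sup>2 / h) \<longlongrightarrow> 0) (at 0)"
    proof (rule Lim_null_comparison)
      show "\<forall>\<^sub>F h::real in at 0. norm ((max 0 h)\<^sup>2 / h) \<le> \<bar>h\<bar>"
        by (auto simp: eventually_at_filter field_simps power2_eq_square max_def)
      show "((\<lambda>h::real. \<bar>h\<bar>) \<longlongrightarrow> 0) (at 0)" using tendsto_rabs_zero[OF tendsto_ident_at] by simp
    qed
    then show ?thesis using 3 by (simp add: has_field_derivative_iff)
  qed
qed

definition step' :: "real \<Rightarrow> real" where
  "step' u = 4 * max 0 u - 8 * max 0 (u - 1/2) + 4 * max 0 (u - 1)"

lemma step_has_derivative: "(step has_real_derivative step' u) (at u)"
proof -
  have sh: "((\<lambda>u::real. (max 0 (u - c))\<^sup>2) has_real_derivative 2 * max 0 (u - c)) (at u)" for c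
    by (rule DERIV_chain2[where g = "\<lambda>u. u - c" and Db = 1, OF has_derivative_max_square, THEN DERIV_cong])
       (auto intro!: derivative_eq_intros)
  show ?thesis
    unfolding step_def[abs_def] step'_def
    by (rule derivative_eq_intros has_derivative_max_square sh refl)+ simp
qed

lemma continuous_on_step': "continuous_on S step'"
  unfolding step'_def[abs_def] by (intro continuous_intros)

lemma step_eq: "u \<le> 0 \<Longrightarrow> step u = 0" "u \<ge> 1 \<Longrightarrow> step u = 1"
  by (auto simp: step_def max_def power2_eq_square algebra_simps)

text \<open>The argument of \<open>step\<close> is 1 where \<open>norm z = r\<close> and 0 where
  \<open>norm z = R\<close>.\<close>

definition cutoff :: "real \<Rightarrow> real \<Rightarrow> complex \<Rightarrow> complex" where
  "cutoff r R z = complex_of_real (step ((R\<^sup>2 - (norm z)\<^sup>2) / (R\<^sup>2 - r\<^sup>2)))"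

lemma cutoff:
  assumes "0 < r" "r < R"
  shows times_differentiable_cutoff: "times_differentiable 1 (cutoff r R)"
    and cutoff_eq_1: "norm z \<le> r \<Longrightarrow> cutoff r R z = 1"
    and cutoff_eq_0: "norm z \<ge> R \<Longrightarrow> cutoff r R z = 0"
proof -
  have pos: "R\<^sup>2 - r\<^sup>2 > 0" using assms power_strict_mono[of r R 2] by auto
  have "((\<lambda>s. step ((R\<^sup>2 - s) / (R\<^sup>2 - r\<^sup>2))) has_real_derivative
      step' ((R\<^sup>2 - s) / (R\<^sup>2 - r\<^sup>2)) * (- 1 / (R\<^sup>2 - r\<^sup>2))) (at s)" for s
    by (rule DERIV_chain2[OF step_has_derivative]) (use pos in \<open>auto intro!: derivative_eq_intros simp: divide_simps\<close>)
  from times_differentiable_radial(1)[OF this, of 0]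
  have "times_differentiable 1 (\<lambda>z. complex_of_real (step ((R\<^sup>2 - (norm (z - 0))\<^sup>2) / (R\<^sup>2 - r\<^sup>2))))"
    using pos by (fastforce intro!: continuous_intros continuous_on_compose2[OF continuous_on_step'[of UNIV]])
  then show "times_differentiable 1 (cutoff r R)"
    unfolding cutoff_def[abs_def] by simp
  show "norm z \<le> r \<Longrightarrow> cutoff r R z = 1"
    using power_mono[of "norm z" r 2] pos by (auto simp: cutoff_def intro!: step_eq)
  show "norm z \<ge> R \<Longrightarrow> cutoff r R z = 0"
    using power_mono[of R "norm z" 2] pos assms
    by (auto simp: cutoff_def intro!: step_eq divide_nonpos_pos)
qed

section \<open>The regularised Cauchy kernel and its \<open>dbar\<close>-derivative\<close>

definition ckernel :: "real \<Rightarrow> complex \<Rightarrow> complex" where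
  "ckernel \<epsilon> z = cnj z / of_real ((norm z)\<^sup>2 + \<epsilon>\<^sup>2)"

definition pkernel :: "real \<Rightarrow> complex \<Rightarrow> real" where
  "pkernel \<epsilon> z = \<epsilon>\<^sup>2 / ((norm z)\<^sup>2 + \<epsilon>\<^sup>2)\<^sup>2"

lemma times_differentiable_cnj: "times_differentiable k (\<lambda>z. cnj (z - a))"
proof -
  have "times_differentiable k (\<lambda>z. cnj z + cnj (- a))"
    by (intro times_differentiable_intros times_differentiable_bounded_linear bounded_linear_cnj)
  then show ?thesis by simp
qed

lemma dbar_cnj: "dbar (\<lambda>z. cnj (z - a)) z = 1"
proof -
  have "((\<lambda>z. cnj (z - a)) has_derivative cnj) (at z)"
    by (rule derivative_eq_intros refl bounded_linear_imp_has_derivative[OF bounded_linear_cnj] | simp)+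
  from dbar_eq[OF this] show ?thesis by simp
qed

text \<open>Writing \<open>q\<close> for the denominator of \<open>ckernel\<close>, the product rule
  gives \<open>1 / q - (norm (z - a))^2 / q^2\<close>, and the numerator over \<open>q^2\<close>
  collapses to \<open>\<epsilon>^2\<close>.\<close>

lemma ckernel:
  assumes "\<epsilon> \<noteq> 0"
  shows times_differentiable_ckernel: "times_differentiable 1 (\<lambda>z. ckernel \<epsilon> (z - a))"
    and dbar_ckernel: "dbar (\<lambda>z. ckernel \<epsilon> (z - a)) z = of_real (pkernel \<epsilon> (z - a))"
proof -
  have nz: "s + \<epsilon>\<^sup>2 \<noteq> 0" if "s \<ge> 0" for s using assms that by (smt (verit) zero_less_power2)
  have g: "((\<lambda>s. 1 / (s + \<epsilon>\<^sup>2)) has_real_derivative - (1 / (s + \<epsilon>\<^sup>2)\<^sup>2)) (at s)" if "s \<ge> 0" for s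
    using nz[OF that] by (auto intro!: derivative_eq_intros simp: field_simps power2_eq_square)
  have c: "continuous_on {0..} (\<lambda>s. - (1 / (s + \<epsilon>\<^sup>2)\<^sup>2))"
    using nz by (auto intro!: continuous_intros)
  note rad = times_differentiable_radial[OF g c, where a = a]
  have eq: "ckernel \<epsilon> (z - a) = cnj (z - a) * of_real (1 / ((norm (z - a))\<^sup>2 + \<epsilon>\<^sup>2))" for z
    by (simp add: ckernel_def)
  show "times_differentiable 1 (\<lambda>z. ckernel \<epsilon> (z - a))"
    unfolding eq by (intro times_differentiable_mult times_differentiable_cnj rad(1)) auto
  have "dbar (\<lambda>z. ckernel \<epsilon> (z - a)) z = of_real (1 / ((norm (z - a))\<^sup>2 + \<epsilon>\<^sup>2)) +
      cnj (z - a) * (of_real (- (1 / ((norm (z - a))\<^sup>2 + \<epsilon>\<^sup>2)\<^sup>2)) * (z - a))"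
    unfolding eq
    by (subst dbar_mult[OF times_differentiable_cnj rad(1)]) (auto simp only: dbar_cnj rad(2) mult_1)
  also have "\<dots> = of_real (pkernel \<epsilon> (z - a))"
  proof -
    have "cnj (z - a) * (c * (z - a)) = c * of_real ((norm (z - a))\<^sup>2)" for c
      using complex_norm_square[of "z - a"] by (simp add: mult_ac)
    then have iff: "?thesis \<longleftrightarrow> complex_of_real (1 / ((norm (z - a))\<^sup>2 + \<epsilon>\<^sup>2) + (- (1 / ((norm (z - a))\<^sup>2 + \<epsilon>\<^sup>2)\<^sup>2)) * (norm (z - a))\<^sup>2)
        = of_real (pkernel \<epsilon> (z - a))" by (simp only: of_real_add of_real_mult)
    show ?thesis unfolding iff
    proof -
      have "1 / (s + e) + - (1 / (s + e)\<^sup>2) * s = e / (s + e)\<^sup>2" if "s + e \<noteq> 0" for s e :: real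
        using that by (simp add: divide_simps power2_eq_square)
      from this[OF nz[OF zero_le_power2[of "norm (z - a)"]]]
      show "complex_of_real (1 / ((norm (z - a))\<^sup>2 + \<epsilon>\<^sup>2) + - (1 / ((norm (z - a))\<^sup>2 + \<epsilon>\<^sup>2)\<^sup>2) * (norm (z - a))\<^sup>2)
          = of_real (pkernel \<epsilon> (z - a))" by (simp only: pkernel_def)
    qed
  qed
  finally show "dbar (\<lambda>z. ckernel \<epsilon> (z - a)) z = of_real (pkernel \<epsilon> (z - a))" .
qed

section \<open>Integration over the plane\<close>

lemma distr_lborel_reflect:
  fixes a :: "'a::euclidean_space"
  shows "distr lborel borel (\<lambda>x. a - x) = lborel"
  using lborel_affine[of "-1" a] by (simp add: density_1)

lemma
  fixes a :: "'a::euclidean_space" and f :: "'a \<Rightarrow> 'b :: {banach, second_countable_topology}"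
  assumes f: "f \<in> borel_measurable borel"
  shows lborel_integral_reflect: "(\<integral>x. f (a - x) \<partial>lborel) = (\<integral>x. f x \<partial>lborel)"
    and lborel_integrable_reflect: "integrable lborel (\<lambda>x. f (a - x)) \<longleftrightarrow> integrable lborel f"
proof -
  have [measurable]: "(\<lambda>x. a - x) \<in> borel_measurable borel" by simp
  show "(\<integral>x. f (a - x) \<partial>lborel) = (\<integral>x. f x \<partial>lborel)"
    using integral_distr[of "\<lambda>x. a - x" lborel borel f] f by (simp add: distr_lborel_reflect)
  show "integrable lborel (\<lambda>x. f (a - x)) \<longleftrightarrow> integrable lborel f"
    using integrable_distr_eq[of "\<lambda>x. a - x" lborel borel f] f by (simp add: distr_lborel_reflect)
qed

lemma lborel_nn_integral_reflect:
  fixes a :: "'a::euclidean_space"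
  assumes f: "f \<in> borel_measurable borel"
  shows "(\<integral>\<^sup>+x. f (a - x) \<partial>lborel) = (\<integral>\<^sup>+x. f x \<partial>lborel)"
  using nn_integral_distr[of "\<lambda>x. a - x" lborel borel f] f by (simp add: distr_lborel_reflect)

text \<open>Differentiation under the integral uses gauge integrals over boxes, while Fubini and
  dominated convergence use \<open>lborel\<close>. Continuous functions of compact support pass from
  one to the other.\<close>

lemma integral_cbox_eq_lborel:
  fixes h :: "'a::euclidean_space \<Rightarrow> 'b::euclidean_space"
  assumes h: "continuous_on UNIV h" and 0: "\<And>z. z \<notin> cbox a b \<Longrightarrow> h z = 0"
  shows "integrable lborel h" and "integral (cbox a b) h = (\<integral>z. h z \<partial>lborel)"
proof -
  have eq: "(\<lambda>x. indicator (cbox a b) x *\<^sub>R h x) = h" using 0 by (auto simp: indicator_def fun_eq_iff)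
  have "set_integrable lborel (cbox a b) h"
    unfolding set_integrable_def
    by (intro borel_integrable_compact compact_cbox continuous_on_subset[OF h] subset_UNIV)
  from set_borel_integral_eq_integral(2)[OF this] this
  show "integrable lborel h" "integral (cbox a b) h = (\<integral>z. h z \<partial>lborel)"
    by (simp_all add: set_integrable_def set_lebesgue_integral_def eq)
qed

lemma cball_subset_cbox_Complex: "cball 0 M \<subseteq> cbox (Complex (- M) (- M)) (Complex M M)"
proof
  fix z :: complex assume "z \<in> cball 0 M"
  then have "norm z \<le> M" by simp
  then have "\<bar>Re z\<bar> \<le> M" "\<bar>Im z\<bar> \<le> M"
    using abs_Re_le_cmod[of z] abs_Im_le_cmod[of z] by linarith+
  then show "z \<in> cbox (Complex (- M) (- M)) (Complex M M)"
    by (auto simp: in_cbox_complex_iff)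
qed

lemma has_compact_support_integrable:
  fixes h :: "complex \<Rightarrow> complex"
  assumes h: "continuous_on UNIV h" and 0: "\<And>z. norm z > M \<Longrightarrow> h z = 0"
  shows "integrable lborel h"
    and "integral (cbox (Complex (- M) (- M)) (Complex M M)) h = (\<integral>z. h z \<partial>lborel)"
proof -
  have "h z = 0" if "z \<notin> cbox (Complex (- M) (- M)) (Complex M M)" for z
    using that cball_subset_cbox_Complex[of M] by (intro 0) (auto simp: subset_iff not_le[symmetric])
  from integral_cbox_eq_lborel[OF h this]
  show "integrable lborel h"
    "integral (cbox (Complex (- M) (- M)) (Complex M M)) h = (\<integral>z. h z \<partial>lborel)" by auto
qed

section \<open>Differentiation of convolutions\<close>

lemma convolution_has_derivative:
  fixes f g :: "complex \<Rightarrow> complex"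
  assumes f: "continuous_on UNIV f" and g: "times_differentiable 1 g"
  shows "((\<lambda>z. integral (cbox a b) (\<lambda>t. f t * g (z - t))) has_derivative
            (\<lambda>v. integral (cbox a b) (\<lambda>t. f t * frechet_derivative g (at (z - t)) v))) (at z)"
proof -
  \<comment> \<open>\<open>leibniz_rule\<close> takes the derivative as a continuous family of
    bounded linear maps, so it is bundled into a \<open>Blinfun\<close>; continuity is then checked
    in each direction \<open>v\<close>.\<close>
  define G where "G z t = Blinfun (\<lambda>v. f t * frechet_derivative g (at (z - t)) v)" for z t
  note Dg = times_differentiable_SucD[OF g[unfolded One_nat_def]]
  have G: "blinfun_apply (G z t) = (\<lambda>v. f t * frechet_derivative g (at (z - t)) v)" for z t
    unfolding G_def
    by (intro bounded_linear_Blinfun_apply bounded_linear_const_mult has_derivative_bounded_linear[OF Dg])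
  have contD: "continuous_on UNIV (\<lambda>z. frechet_derivative g (at z) v)" for v using g by simp
  have contG: "continuous_on (UNIV \<times> cbox a b) (\<lambda>(z, t). G z t)"
    by (rule continuous_on_blinfun_componentwise)
       (auto simp: G split_beta intro!: continuous_intros continuous_on_compose2[OF f] continuous_on_compose2[OF contD])
  have D: "((\<lambda>z. integral (cbox a b) (\<lambda>t. f t * g (z - t))) has_derivative
      blinfun_apply (integral (cbox a b) (G z))) (at z within UNIV)"
  proof (rule leibniz_rule[OF _ _ contG])
    fix x t
    have "((\<lambda>x. f t * g (x - t)) has_derivative (\<lambda>v. f t * frechet_derivative g (at (x - t)) v)) (at x)"
      by (rule has_derivative_mult_right, rule has_derivative_compose[of "\<lambda>x. x - t" "\<lambda>v. v", OF _ Dg])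
         (auto intro!: derivative_eq_intros)
    then show "((\<lambda>x. f t * g (x - t)) has_derivative blinfun_apply (G x t)) (at x within UNIV)" by (simp add: G)
  next
    fix x
    show "(\<lambda>t. f t * g (x - t)) integrable_on cbox a b"
      by (intro integrable_continuous continuous_intros continuous_on_subset[OF f] subset_UNIV
            continuous_on_compose2[OF times_differentiable_continuous[OF g, of UNIV]])
  qed auto
  have "blinfun_apply (integral (cbox a b) (G z)) =
      (\<lambda>v. integral (cbox a b) (\<lambda>t. f t * frechet_derivative g (at (z - t)) v))"
  proof
    fix v
    have "continuous_on (cbox a b) (G z)"
    proof -
      have "continuous_on (cbox a b) (\<lambda>t. (\<lambda>(z, t). G z t) (z, t))"
        by (rule continuous_on_compose2[OF contG]) (auto intro!: continuous_intros)
      then show ?thesis by simp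
    qed
    then have "G z integrable_on cbox a b" by (rule integrable_continuous)
    then show "blinfun_apply (integral (cbox a b) (G z)) v = integral (cbox a b) (\<lambda>t. f t * frechet_derivative g (at (z - t)) v)"
      by (subst blinfun_apply_integral) (simp_all add: G)
  qed
  then show ?thesis using D by simp
qed

text \<open>The derivative of the convolution is again a convolution, with a directional derivative
  of \<open>g\<close>, so the induction generalises over \<open>g\<close>.\<close>

lemma times_differentiable_convolution:
  assumes f: "continuous_on UNIV f" and g: "times_differentiable k g"
  shows "times_differentiable k (\<lambda>z. integral (cbox a b) (\<lambda>t. f t * g (z - t)))"
  using g
proof (induction k arbitrary: g)
  case 0
  then have "continuous_on UNIV g" by simp
  then have "continuous_on (UNIV \<times> cbox a b) (\<lambda>(z, t). f t * g (z - t))"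
  proof -
    have "continuous_on (UNIV \<times> cbox a b) (\<lambda>p. f (snd p))"
      by (rule continuous_on_compose2[OF f]) (auto intro!: continuous_intros)
    moreover have "continuous_on (UNIV \<times> cbox a b) (\<lambda>p. g (fst p - snd p))"
      by (rule continuous_on_compose2[OF \<open>continuous_on UNIV g\<close>]) (auto intro!: continuous_intros)
    ultimately show ?thesis unfolding split_beta by (rule continuous_on_mult)
  qed
  then show ?case by (auto intro: integral_continuous_on_param)
next
  case (Suc k)
  show ?case
  proof (rule times_differentiable_SucI[OF convolution_has_derivative[OF f]])
    show "times_differentiable 1 g" using Suc.prems by (rule times_differentiable_mono) simp
    show "times_differentiable k (\<lambda>z. integral (cbox a b) (\<lambda>t. f t * frechet_derivative g (at (z - t)) v))" for v
      using Suc.prems by (intro Suc.IH) simp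
  qed
qed

lemma borel_measurable_continuous_UNIV:
  fixes h :: "'a::topological_space \<Rightarrow> 'b::topological_space"
  shows "continuous_on UNIV h \<Longrightarrow> h \<in> borel_measurable borel"
  by (rule borel_measurable_continuous_onI)

lemma frechet_derivative_support:
  assumes "\<And>z. norm z > M \<Longrightarrow> \<phi> z = 0" "norm z > M"
  shows "frechet_derivative \<phi> (at z) = (\<lambda>_. 0)"
proof -
  have "(\<phi> has_derivative (\<lambda>_. 0)) (at z)"
    by (rule has_derivative_transform_within_open[OF has_derivative_const, where s = "- cball 0 M"]) (use assms in auto)
  then show ?thesis using frechet_derivative_at by metis
qed

text \<open>Translation invariance: \<open>\<integral> \<phi> (z - t) dt\<close> does not depend on \<open>z\<close>; differentiate it.\<close>

lemma integral_frechet_derivative_eq_0: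
  assumes \<phi>: "times_differentiable 1 \<phi>" and supp: "\<And>z. norm z > M \<Longrightarrow> \<phi> z = 0"
  shows "(\<integral>z. frechet_derivative \<phi> (at z) v \<partial>lborel) = 0"
proof -
  \<comment> \<open>The margin 1 keeps the support of \<open>t \<mapsto> \<phi> (z - t)\<close>
    inside \<open>B\<close> for all \<open>z\<close> in the unit ball, so one box serves a whole
    neighbourhood of 0.\<close>
  define B where "B = cbox (Complex (- (\<bar>M\<bar> + 1)) (- (\<bar>M\<bar> + 1))) (Complex (\<bar>M\<bar> + 1) (\<bar>M\<bar> + 1))"
  note c = times_differentiable_continuous[OF \<phi>, of UNIV]
  have const: "integral B (\<lambda>t. 1 * \<phi> (z - t)) = (\<integral>t. \<phi> t \<partial>lborel)" if "z \<in> ball 0 1" for z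
  proof -
    have "integral B (\<lambda>t. 1 * \<phi> (z - t)) = (\<integral>t. \<phi> (z - t) \<partial>lborel)"
      unfolding B_def mult_1
    proof (rule has_compact_support_integrable(2))
      show "continuous_on UNIV (\<lambda>t. \<phi> (z - t))"
        by (intro continuous_intros continuous_on_compose2[OF c]) auto
      fix t :: complex assume "norm t > \<bar>M\<bar> + 1"
      then show "\<phi> (z - t) = 0"
        using that norm_triangle_ineq2[of t z] by (intro supp) (auto simp: norm_minus_commute)
    qed
    then show ?thesis using lborel_integral_reflect[OF borel_measurable_continuous_UNIV[OF c]] by simp
  qed
  have "((\<lambda>z. integral B (\<lambda>t. 1 * \<phi> (z - t))) has_derivative
        (\<lambda>v. integral B (\<lambda>t. 1 * frechet_derivative \<phi> (at (0 - t)) v))) (at 0)"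
    unfolding B_def by (rule convolution_has_derivative[OF continuous_on_const \<phi>])
  moreover have "((\<lambda>z. integral B (\<lambda>t. 1 * \<phi> (z - t))) has_derivative (\<lambda>v. 0)) (at 0)"
    by (rule has_derivative_transform_within_open[OF has_derivative_const, where s = "ball 0 1"]) (use const in auto)
  ultimately have "(\<lambda>v. integral B (\<lambda>t. 1 * frechet_derivative \<phi> (at (0 - t)) v)) = (\<lambda>v. 0)"
    by (rule has_derivative_unique)
  from fun_cong[OF this, of v]
  have 0: "integral B (\<lambda>t. frechet_derivative \<phi> (at (0 - t)) v) = 0" by simp
  have cD: "continuous_on UNIV (\<lambda>z. frechet_derivative \<phi> (at z) v)" using \<phi> by simp
  have "integral B (\<lambda>t. frechet_derivative \<phi> (at (0 - t)) v) = (\<integral>t. frechet_derivative \<phi> (at (0 - t)) v \<partial>lborel)"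
    unfolding B_def
  proof (rule has_compact_support_integrable(2))
    show "continuous_on UNIV (\<lambda>t. frechet_derivative \<phi> (at (0 - t)) v)"
      by (intro continuous_intros continuous_on_compose2[OF cD]) auto
    fix t :: complex assume t: "norm t > \<bar>M\<bar> + 1"
    then show "frechet_derivative \<phi> (at (0 - t)) v = 0"
      by (subst frechet_derivative_support[OF supp]) auto
  qed
  with 0 show ?thesis
    using lborel_integral_reflect[OF borel_measurable_continuous_UNIV[OF cD], of 0] by simp
qed

lemma integral_dbar_eq_0:
  assumes \<phi>: "times_differentiable 1 \<phi>" and supp: "\<And>z. norm z > M \<Longrightarrow> \<phi> z = 0"
  shows "integrable lborel (dbar \<phi>)" and "(\<integral>z. dbar \<phi> z \<partial>lborel) = 0"
proof -
  have i: "integrable lborel (\<lambda>z. frechet_derivative \<phi> (at z) v)" for v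
    by (rule has_compact_support_integrable[of _ M])
       (use \<phi> frechet_derivative_support[of M \<phi>, OF supp] in auto)
  show "integrable lborel (dbar \<phi>)" "(\<integral>z. dbar \<phi> z \<partial>lborel) = 0"
    using i integral_frechet_derivative_eq_0[OF assms] by (simp_all add: dbar_def dx_def dy_def)
qed

subsection \<open>The kernels\<close>

lemma emeasure_lborel_complex_cball: "r \<ge> 0 \<Longrightarrow> emeasure lborel (cball 0 r :: complex set) = ennreal (pi * r\<^sup>2)"
  by (simp add: emeasure_cball unit_ball_vol_2)

text \<open>A layer-cake formula that stands in for polar coordinates: when a radial weight is
  written as the integral of \<open>h\<close> from \<open>norm u\<close> to infinity, Tonelli leaves
  only areas of disks to be computed.\<close>

lemma nn_integral_layers:
  fixes h :: "real \<Rightarrow> ennreal"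
  assumes [measurable]: "h \<in> borel_measurable borel" "A \<in> sets borel"
  shows "(\<integral>\<^sup>+u\<in>A. (\<integral>\<^sup>+s. h s * indicator {norm u ..} s \<partial>lborel) \<partial>lborel) =
         (\<integral>\<^sup>+s. h s * emeasure lborel (A \<inter> cball 0 s :: complex set) \<partial>lborel)"
proof -
  have [simp]: "(indicator (A \<inter> cball 0 s) :: _ \<Rightarrow> ennreal) \<in> borel_measurable borel" for s
    by (intro borel_measurable_indicator sets.Int assms borel_closed) auto
  have "(\<integral>\<^sup>+u\<in>A. (\<integral>\<^sup>+s. h s * indicator {norm u ..} s \<partial>lborel) \<partial>lborel) =
      (\<integral>\<^sup>+u. (\<integral>\<^sup>+s. h s * (indicator {p. norm (fst p) \<le> snd p} (u, s) * indicator A u) \<partial>lborel) \<partial>lborel)"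
    by (subst nn_integral_multc[symmetric]) (auto intro!: nn_integral_cong simp: indicator_def)
  also have "\<dots> = (\<integral>\<^sup>+s. (\<integral>\<^sup>+u. h s * (indicator {p. norm (fst p) \<le> snd p} (u, s) * indicator A u) \<partial>lborel) \<partial>lborel)"
    by (rule lborel_pair.Fubini') measurable
  also have "\<dots> = (\<integral>\<^sup>+s. h s * (\<integral>\<^sup>+u. indicator (A \<inter> cball 0 s) u \<partial>lborel) \<partial>lborel)"
    by (intro nn_integral_cong, subst nn_integral_cmult[symmetric])
       (auto intro!: nn_integral_cong simp: indicator_def)
  finally show ?thesis by simp
qed

text \<open>As \<open>1 / norm u\<close> is the integral of \<open>1 / s^2\<close> over
  \<open>s \<ge> norm u\<close>, the layer formula weighs \<open>1 / s^2\<close> with the area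
  \<open>pi * (min 1 s)^2\<close>. Radii below and above 1 contribute \<open>pi\<close> each. At
  \<open>u = 0\<close> the quotient is 0, so the layer representation is an inequality
  there.\<close>

lemma nn_integral_inverse_norm_le: "(\<integral>\<^sup>+u\<in>cball 0 1. ennreal (1 / norm (u::complex)) \<partial>lborel) \<le> ennreal (2 * pi)"
proof -
  have "ennreal (1 / norm u) \<le> (\<integral>\<^sup>+s. ennreal (1 / s\<^sup>2) * indicator {norm u ..} s \<partial>lborel)" for u :: complex
  proof (cases "u = 0")
    case False
    have "(\<integral>\<^sup>+s. ennreal (1 / s\<^sup>2) * indicator {norm u ..} s \<partial>lborel) = ennreal (0 - (- 1 / norm u))"
    proof (rule nn_integral_FTC_atLeast)
      show "((\<lambda>s. - 1 / s) has_real_derivative 1 / s\<^sup>2) (at s)" if "norm u \<le> s" for s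
        using that False by (auto intro!: derivative_eq_intros simp: power2_eq_square)
      show "((\<lambda>s::real. - 1 / s) \<longlongrightarrow> 0) at_top" by real_asymp
    qed auto
    then show ?thesis by simp
  qed auto
  then have "(\<integral>\<^sup>+u\<in>cball 0 1. ennreal (1 / norm (u::complex)) \<partial>lborel)
      \<le> (\<integral>\<^sup>+u\<in>cball 0 1. (\<integral>\<^sup>+s. ennreal (1 / s\<^sup>2) * indicator {norm (u::complex) ..} s \<partial>lborel) \<partial>lborel)"
    by (intro nn_integral_mono mult_right_mono) auto
  also have "\<dots> = (\<integral>\<^sup>+s. ennreal (1 / s\<^sup>2) * emeasure lborel (cball 0 1 \<inter> cball 0 s :: complex set) \<partial>lborel)"
    by (rule nn_integral_layers) auto
  also have "\<dots> \<le> (\<integral>\<^sup>+s. ennreal pi * indicator {0..1} s + ennreal (pi / s\<^sup>2) * indicator {1..} s \<partial>lborel)"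
  proof (intro nn_integral_mono)
    fix s :: real
    consider "s < 0" | "0 \<le> s" "s \<le> 1" | "s > 1" by linarith
    then show "ennreal (1 / s\<^sup>2) * emeasure lborel (cball 0 1 \<inter> cball 0 s :: complex set)
        \<le> ennreal pi * indicator {0..1} s + ennreal (pi / s\<^sup>2) * indicator {1..} s"
    proof cases
      case 1
      then have "cball 0 1 \<inter> cball 0 s = ({} :: complex set)" by (auto simp: not_le intro: less_le_trans)
      then show ?thesis by simp
    next
      case 2
      then have "cball 0 1 \<inter> cball 0 s = (cball 0 s :: complex set)" by auto
      moreover have "ennreal (1 / s\<^sup>2) * ennreal (pi * s\<^sup>2) \<le> ennreal pi"
        using 2 by (cases "s = 0") (auto simp: ennreal_mult'[symmetric])
      ultimately show ?thesis using 2
        by (simp add: emeasure_lborel_complex_cball) (metis add_increasing2 zero_le)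
    next
      case 3
      then have "cball 0 1 \<inter> cball 0 s = (cball 0 1 :: complex set)" by auto
      then show ?thesis using 3 by (simp add: emeasure_lborel_complex_cball ennreal_mult'[symmetric])
    qed
  qed
  also have "\<dots> = ennreal pi + (\<integral>\<^sup>+s. ennreal (pi / s\<^sup>2) * indicator {1..} s \<partial>lborel)"
    by (subst nn_integral_add) (auto simp: nn_integral_cmult)
  also have "(\<integral>\<^sup>+s. ennreal (pi / s\<^sup>2) * indicator {1..} s \<partial>lborel) = ennreal (0 - (- pi / 1))"
  proof (rule nn_integral_FTC_atLeast)
    show "((\<lambda>s. - pi / s) has_real_derivative pi / s\<^sup>2) (at s)" if "1 \<le> s" for s
      using that by (auto intro!: derivative_eq_intros simp: power2_eq_square)
    show "((\<lambda>s::real. - pi / s) \<longlongrightarrow> 0) at_top" by real_asymp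
  qed auto
  finally show ?thesis by (simp add: ennreal_plus[symmetric] del: ennreal_plus)
qed

text \<open>The layer density of \<open>pkernel\<close> is
  \<open>4 * \<epsilon>^2 * s / (s^2 + \<epsilon>^2)^3\<close>. Multiplied by the area
  \<open>pi * s^2\<close> it has the antiderivative
  \<open>pi * (s^2 / (s^2 + \<epsilon>^2))^2\<close>, which rises from 0 to
  \<open>pi\<close>.\<close>

lemma nn_integral_pkernel:
  assumes "\<epsilon> > 0"
  shows "(\<integral>\<^sup>+u. ennreal (pkernel \<epsilon> u) \<partial>lborel) = ennreal pi"
proof -
  have pos: "s\<^sup>2 + \<epsilon>\<^sup>2 \<noteq> 0" for s using assms by (simp add: sum_power2_eq_zero_iff)
  have "ennreal (pkernel \<epsilon> u) = (\<integral>\<^sup>+s. ennreal (4 * \<epsilon>\<^sup>2 * s / (s\<^sup>2 + \<epsilon>\<^sup>2) ^ 3) * indicator {norm u ..} s \<partial>lborel)" for u :: complex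
  proof -
    have "(\<integral>\<^sup>+s. ennreal (4 * \<epsilon>\<^sup>2 * s / (s\<^sup>2 + \<epsilon>\<^sup>2) ^ 3) * indicator {norm u ..} s \<partial>lborel) = ennreal (0 - (- (\<epsilon>\<^sup>2 / ((norm u)\<^sup>2 + \<epsilon>\<^sup>2)\<^sup>2)))"
    proof (rule nn_integral_FTC_atLeast)
      show "((\<lambda>s. - (\<epsilon>\<^sup>2 / (s\<^sup>2 + \<epsilon>\<^sup>2)\<^sup>2)) has_real_derivative 4 * \<epsilon>\<^sup>2 * s / (s\<^sup>2 + \<epsilon>\<^sup>2) ^ 3) (at s)" for s
      proof -
        have "4 * \<epsilon>\<^sup>2 * s / q ^ 3 = \<epsilon>\<^sup>2 * (2 * (q * (2 * s))) / (q\<^sup>2 * q\<^sup>2)" if "q \<noteq> 0" for q :: real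
          using that by (simp add: divide_simps power2_eq_square power3_eq_cube)
        from this[OF pos[of s]] show ?thesis using pos[of s]
          by (auto intro!: derivative_eq_intros simp: power2_eq_square)
      qed
      show "((\<lambda>s. - (\<epsilon>\<^sup>2 / (s\<^sup>2 + \<epsilon>\<^sup>2)\<^sup>2)) \<longlongrightarrow> 0) at_top" by real_asymp
      fix s assume "norm u \<le> s"
      then have "s \<ge> 0" using norm_ge_zero order_trans by blast
      then show "0 \<le> 4 * \<epsilon>\<^sup>2 * s / (s\<^sup>2 + \<epsilon>\<^sup>2) ^ 3" by simp
    qed measurable
    then show ?thesis by (simp add: pkernel_def)
  qed
  then have "(\<integral>\<^sup>+u. ennreal (pkernel \<epsilon> u) \<partial>lborel) = (\<integral>\<^sup>+u\<in>UNIV. (\<integral>\<^sup>+s. ennreal (4 * \<epsilon>\<^sup>2 * s / (s\<^sup>2 + \<epsilon>\<^sup>2) ^ 3) * indicator {norm (u::complex) ..} s \<partial>lborel) \<partial>lborel)"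
    by simp
  also have "\<dots> = (\<integral>\<^sup>+s. ennreal (4 * \<epsilon>\<^sup>2 * s / (s\<^sup>2 + \<epsilon>\<^sup>2) ^ 3) * emeasure lborel (UNIV \<inter> cball 0 s :: complex set) \<partial>lborel)"
    by (rule nn_integral_layers) auto
  also have "\<dots> = (\<integral>\<^sup>+s. ennreal (pi * (4 * \<epsilon>\<^sup>2 * s ^ 3 / (s\<^sup>2 + \<epsilon>\<^sup>2) ^ 3)) * indicator {0..} s \<partial>lborel)"
  proof (intro nn_integral_cong)
    fix s :: real
    show "ennreal (4 * \<epsilon>\<^sup>2 * s / (s\<^sup>2 + \<epsilon>\<^sup>2) ^ 3) * emeasure lborel (UNIV \<inter> cball 0 s :: complex set)
        = ennreal (pi * (4 * \<epsilon>\<^sup>2 * s ^ 3 / (s\<^sup>2 + \<epsilon>\<^sup>2) ^ 3)) * indicator {0..} s"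
    proof (cases "s \<ge> 0")
      case True
      then show ?thesis
        by (simp add: emeasure_lborel_complex_cball ennreal_mult'[symmetric] power3_eq_cube power2_eq_square mult_ac)
    next
      case False
      then have "cball 0 s = ({} :: complex set)" by auto
      then show ?thesis using False by simp
    qed
  qed
  also have "\<dots> = ennreal (pi - pi * (0\<^sup>2 / (0\<^sup>2 + \<epsilon>\<^sup>2))\<^sup>2)"
  proof (rule nn_integral_FTC_atLeast)
    show "((\<lambda>s. pi * (s\<^sup>2 / (s\<^sup>2 + \<epsilon>\<^sup>2))\<^sup>2) has_real_derivative pi * (4 * \<epsilon>\<^sup>2 * s ^ 3 / (s\<^sup>2 + \<epsilon>\<^sup>2) ^ 3)) (at s)" for s
    proof -
      \<comment> \<open>The left side is the raw shape that \<open>DERIV_power\<close> and the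
        quotient rule produce.\<close>
      have eq: "pi * (real 2 * ((2 * s * q - s\<^sup>2 * (2 * s)) / (q * q) * (s\<^sup>2 / q) ^ (2 - Suc 0))) = pi * (4 * \<epsilon>\<^sup>2 * s ^ 3 / q ^ 3)" if "q \<noteq> 0" "q = s\<^sup>2 + \<epsilon>\<^sup>2" for q :: real
        using that(1) by (simp add: divide_simps power2_eq_square power3_eq_cube) (simp add: that(2) algebra_simps power2_eq_square)
      have "((\<lambda>s. s\<^sup>2 / (s\<^sup>2 + \<epsilon>\<^sup>2)) has_real_derivative
          (2 * s * (s\<^sup>2 + \<epsilon>\<^sup>2) - s\<^sup>2 * (2 * s)) / ((s\<^sup>2 + \<epsilon>\<^sup>2) * (s\<^sup>2 + \<epsilon>\<^sup>2))) (at s)"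
        using pos[of s] by (auto intro!: derivative_eq_intros)
      from DERIV_cmult[OF DERIV_power[OF this, of 2], of pi] eq[OF pos refl]
      show ?thesis by (metis DERIV_cong)
    qed
    show "((\<lambda>s. pi * (s\<^sup>2 / (s\<^sup>2 + \<epsilon>\<^sup>2))\<^sup>2) \<longlongrightarrow> pi) at_top" using assms by real_asymp
  qed auto
  finally show ?thesis by simp
qed

text \<open>Boxes generate the Borel sets and are stable under intersection, so the vanishing
  integrals extend to all Borel sets by a Dynkin argument. It is run inside one fixed box, where
  integrability is available, and the space is then exhausted by boxes.\<close>

lemma AE_eq_0_boxes:
  fixes f :: "'a::euclidean_space \<Rightarrow> complex"
  assumes int: "\<And>a b. integrable lborel (\<lambda>z. indicator (box a b) z * f z)"
    and 0: "\<And>a b. (\<integral>z. indicator (box a b) z * f z \<partial>lborel) = 0"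
  shows "AE z in lborel. f z = 0"
proof -
  have box0: "AE z in lborel. indicator (box c d) z * f z = 0" for c d
  proof (rule sigma_finite_measure.density_zero[OF sigma_finite_lborel int])
    fix A :: "'a set" assume A: "A \<in> sets lborel"
    let ?g = "\<lambda>z. indicator (box c d) z * f z"
    have set: "set_integrable lborel B ?g" if "B \<in> sets borel" for B
      unfolding set_integrable_def using int that by (intro integrable_mult_indicator) auto
    have "Int_stable (range (\<lambda>(a, b). box a b :: 'a set))"
      by (auto simp: Int_stable_def box_Int_box)
    moreover have "range (\<lambda>(a, b). box a b :: 'a set) \<subseteq> Pow UNIV" by auto
    moreover have "A \<in> sigma_sets UNIV (range (\<lambda>(a, b). box a b))"
    proof -
      have "A \<in> sets borel" using A by simp
      then show ?thesis unfolding borel_eq_box by simp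
    qed
    ultimately show "(LINT z:A|lborel. ?g z) = 0"
    proof (induction rule: sigma_sets_induct_disjoint)
      case (basic B)
      then obtain a b where B: "B = box a b" by auto
      obtain a' b' where "B \<inter> box c d = box a' b'" unfolding B box_Int_box by blast
      then have "(\<lambda>z. indicator B z *\<^sub>R ?g z) = (\<lambda>z. indicator (box a' b') z * f z)"
        by (auto simp: indicator_def fun_eq_iff)
      then show ?case using 0 by (simp add: set_lebesgue_integral_def)
    next
      case empty then show ?case by (simp add: set_lebesgue_integral_def)
    next
      case (compl B)
      have B: "B \<in> sets borel" using compl(1) unfolding borel_eq_box by simp
      have "(LINT z:(UNIV - B) \<union> B|lborel. ?g z) = (LINT z:UNIV - B|lborel. ?g z) + (LINT z:B|lborel. ?g z)"
        by (rule set_integral_Un) (use B in \<open>auto intro!: set\<close>)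
      moreover have "(UNIV - B) \<union> B = UNIV" by auto
      ultimately show ?case using compl(2) 0[of c d] by (simp add: set_lebesgue_integral_def)
    next
      case (union B)
      have B: "B i \<in> sets borel" for i using union(2) unfolding borel_eq_box by auto
      have "(LINT z:(\<Union>i. B i)|lborel. ?g z) = (\<Sum>i. LINT z:B i|lborel. ?g z)"
        by (rule lebesgue_integral_countable_add)
           (use B union(1) in \<open>auto intro!: set simp: disjoint_family_on_def\<close>)
      then show ?case using union(3) by simp
    qed
  qed
  have "AE z in lborel. \<forall>i::nat. indicator (box (- (real i *\<^sub>R One)) (real i *\<^sub>R One)) z * f z = 0"
    unfolding AE_all_countable using box0 by blast
  then show ?thesis
  proof eventually_elim
    case (elim z)
    have "z \<in> (\<Union>i::nat. box (- (real i *\<^sub>R One)) (real i *\<^sub>R One))" unfolding UN_box_eq_UNIV by simp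
    with elim show ?case by (auto simp: indicator_def split: if_splits)
  qed
qed

section \<open>Fubini and uniform bounds for kernels dominated by \<open>1 / norm u\<close>\<close>

lemma borel_measurable_cball [measurable]: "cball (c :: complex) r \<in> sets borel"
  by simp

text \<open>By Tonelli the norm of the product integrates to at most \<open>C\<close> times that of
  \<open>X\<close>, because the inner bound is uniform in \<open>x\<close>.\<close>

lemma integrable_kernel_product:
  fixes X H k :: "complex \<Rightarrow> complex"
  assumes X: "integrable lborel X" and [measurable]: "H \<in> borel_measurable borel" "k \<in> borel_measurable borel"
    and bound: "\<And>x. (\<integral>\<^sup>+y. ennreal (norm (H y * k (x - y))) \<partial>lborel) \<le> ennreal C"
  shows "integrable (lborel \<Otimes>\<^sub>M lborel) (\<lambda>(x, y). X x * (H y * k (x - y)))"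
proof (rule integrableI_bounded)
  have [measurable]: "X \<in> borel_measurable borel" using X by auto
  show "(\<lambda>(x, y). X x * (H y * k (x - y))) \<in> borel_measurable (lborel \<Otimes>\<^sub>M lborel)" by measurable
  have "(\<integral>\<^sup>+p. ennreal (norm (case p of (x, y) \<Rightarrow> X x * (H y * k (x - y)))) \<partial>(lborel \<Otimes>\<^sub>M lborel))
      = (\<integral>\<^sup>+x. (\<integral>\<^sup>+y. ennreal (norm (X x * (H y * k (x - y)))) \<partial>lborel) \<partial>lborel)"
    by (subst lborel.nn_integral_fst[symmetric]) auto
  also have "\<dots> = (\<integral>\<^sup>+x. ennreal (norm (X x)) * (\<integral>\<^sup>+y. ennreal (norm (H y * k (x - y))) \<partial>lborel) \<partial>lborel)"
    by (simp add: norm_mult[of "X _"] ennreal_mult nn_integral_cmult)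
  also have "\<dots> \<le> (\<integral>\<^sup>+x. ennreal (norm (X x)) * ennreal C \<partial>lborel)"
    by (intro nn_integral_mono mult_left_mono bound) auto
  also have "\<dots> = (\<integral>\<^sup>+x. ennreal (norm (X x)) \<partial>lborel) * ennreal C" by (rule nn_integral_multc) auto
  also have "\<dots> < \<infinity>" using X by (auto simp: integrable_iff_bounded ennreal_mult_less_top)
  finally show "(\<integral>\<^sup>+p. ennreal (norm (case p of (x, y) \<Rightarrow> X x * (H y * k (x - y)))) \<partial>(lborel \<Otimes>\<^sub>M lborel)) < \<infinity>" .
qed

text \<open>Within distance 1 of \<open>x\<close> the kernel is integrated over a full unit disk
  around its pole; farther away it is at most 1. The bound is independent of
  \<open>x\<close>.\<close>

lemma nn_integral_inverse_norm_shift_le: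
  fixes A :: "complex set"
  assumes [measurable]: "A \<in> sets borel"
  shows "(\<integral>\<^sup>+y\<in>A. ennreal (1 / norm (x - y)) \<partial>lborel) \<le> ennreal (2 * pi) + emeasure lborel A"
proof -
  have "(\<integral>\<^sup>+y\<in>A. ennreal (1 / norm (x - y)) \<partial>lborel)
      \<le> (\<integral>\<^sup>+y. ennreal (1 / norm (x - y)) * indicator (cball 0 1) (x - y) + indicator A y \<partial>lborel)"
  proof (intro nn_integral_mono)
    fix y
    have "ennreal (1 / norm (x - y)) \<le> 1" if "norm (x - y) > 1"
      using that by (simp add: divide_simps)
    then show "ennreal (1 / norm (x - y)) * indicator A y
        \<le> ennreal (1 / norm (x - y)) * indicator (cball 0 1) (x - y) + indicator A y"
      by (auto simp: indicator_def)
  qed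
  also have "\<dots> = (\<integral>\<^sup>+y. ennreal (1 / norm (x - y)) * indicator (cball 0 1) (x - y) \<partial>lborel) + emeasure lborel A"
  proof (subst nn_integral_add)
    have m: "(\<lambda>u::complex. ennreal (1 / norm u) * indicator (cball 0 1) u) \<in> borel_measurable borel"
      by (intro borel_measurable_times_ennreal borel_measurable_indicator) auto
    show "(\<lambda>y. ennreal (1 / norm (x - y)) * indicator (cball 0 1) (x - y)) \<in> borel_measurable lborel"
      by (rule measurable_compose[OF _ m, of "\<lambda>y. x - y"]) simp
  qed auto
  also have "(\<integral>\<^sup>+y. ennreal (1 / norm (x - y)) * indicator (cball 0 1) (x - y) \<partial>lborel)
      = (\<integral>\<^sup>+u\<in>cball 0 1. ennreal (1 / norm (u::complex)) \<partial>lborel)"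
    by (rule lborel_nn_integral_reflect) measurable
  finally show ?thesis using nn_integral_inverse_norm_le by (meson add_right_mono order_trans)
qed

lemma emeasure_bounded_eq_ennreal:
  fixes A :: "complex set"
  assumes "bounded A"
  shows "emeasure lborel A = ennreal (measure lborel A)"
  using emeasure_bounded_finite[OF assms] by (intro emeasure_eq_ennreal_measure) auto

text \<open>For bounded \<open>A\<close> this dominates the integral of
  \<open>1 / norm (x - y)\<close> over \<open>y\<close> in \<open>A\<close>, for every pole
  \<open>x\<close>.\<close>

definition cauchy_bound :: "complex set \<Rightarrow> real" where
  "cauchy_bound A = 2 * pi + measure lborel A"

lemma cauchy_bound_nonneg: "0 \<le> cauchy_bound A"
  by (simp add: cauchy_bound_def)

lemma nn_integral_bounded_kernel_le:
  assumes A: "A \<in> sets borel" "bounded A" and k: "\<And>u. norm (k u) \<le> 1 / norm u"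
    and H: "\<And>y. norm (H y) \<le> C" "\<And>y. y \<notin> A \<Longrightarrow> H y = 0"
    and [measurable]: "H \<in> borel_measurable borel" "k \<in> borel_measurable borel"
  shows "(\<integral>\<^sup>+y. ennreal (norm (H y * k (x - y) :: complex)) \<partial>lborel) \<le> ennreal (C * cauchy_bound A)"
proof -
  have C: "C \<ge> 0" using H(1)[of 0] norm_ge_zero order_trans by blast
  have "(\<integral>\<^sup>+y. ennreal (norm (H y * k (x - y))) \<partial>lborel) \<le> (\<integral>\<^sup>+y. ennreal C * (ennreal (1 / norm (x - y)) * indicator A y) \<partial>lborel)"
  proof (intro nn_integral_mono)
    fix y
    have "norm (H y * k (x - y)) \<le> C * (1 / norm (x - y))"
      unfolding norm_mult by (intro mult_mono H k) (auto simp: C)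
    then show "ennreal (norm (H y * k (x - y))) \<le> ennreal C * (ennreal (1 / norm (x - y)) * indicator A y)"
      using H(2)[of y] C by (auto simp: indicator_def ennreal_mult'[symmetric] simp del: times_divide_eq_right intro!: ennreal_leI)
  qed
  also have "\<dots> = ennreal C * (\<integral>\<^sup>+y\<in>A. ennreal (1 / norm (x - y)) \<partial>lborel)"
    using A(1) by (intro nn_integral_cmult borel_measurable_times borel_measurable_indicator) auto
  also have "\<dots> \<le> ennreal C * (ennreal (2 * pi) + emeasure lborel A)"
    by (intro mult_left_mono nn_integral_inverse_norm_shift_le A) auto
  also have "\<dots> = ennreal (C * cauchy_bound A)"
  proof -
    have "ennreal (2 * pi) + ennreal (measure lborel A) = ennreal (2 * pi + measure lborel A)"
      by (rule ennreal_plus[symmetric]) auto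
    then show ?thesis
      by (simp only: emeasure_bounded_eq_ennreal[OF A(2)] cauchy_bound_def ennreal_mult'[OF C])
  qed
  finally show ?thesis .
qed

lemma ckernel_le: "norm (ckernel \<epsilon> u) \<le> 1 / norm u"
proof (cases "u = 0")
  case False
  have "norm (ckernel \<epsilon> u) = norm u / ((norm u)\<^sup>2 + \<epsilon>\<^sup>2)"
    unfolding ckernel_def norm_divide norm_of_real by simp
  also have "\<dots> \<le> norm u / (norm u)\<^sup>2"
    using False by (intro divide_left_mono) (auto intro!: mult_pos_pos add_pos_nonneg)
  finally show ?thesis using False by (simp add: power2_eq_square)
qed (simp add: ckernel_def)

text \<open>By the inequality of arithmetic and geometric means. A bound free of \<open>u\<close> is
  what dominated convergence needs when the pole moves.\<close>

lemma norm_ckernel_le: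
  assumes "\<epsilon> > 0"
  shows "norm (ckernel \<epsilon> u) \<le> 1 / \<epsilon>"
proof -
  have n: "norm (ckernel \<epsilon> u) = norm u / ((norm u)\<^sup>2 + \<epsilon>\<^sup>2)"
    unfolding ckernel_def norm_divide norm_of_real by simp
  have "\<epsilon> * norm u \<le> (norm u)\<^sup>2 + \<epsilon>\<^sup>2"
  proof -
    have "2 * (\<epsilon> * norm u) \<le> \<epsilon>\<^sup>2 + (norm u)\<^sup>2"
      using sum_squares_bound[of \<epsilon> "norm u"] by (simp only: mult.assoc)
    moreover have "0 \<le> \<epsilon> * norm u" using assms by simp
    ultimately show ?thesis by linarith
  qed
  moreover have "(norm u)\<^sup>2 + \<epsilon>\<^sup>2 > 0" using assms by (simp add: add_nonneg_pos)
  ultimately have "norm u / ((norm u)\<^sup>2 + \<epsilon>\<^sup>2) \<le> 1 / \<epsilon>"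
    using assms by (simp add: field_simps)
  then show ?thesis by (simp only: n)
qed

lemma borel_measurable_kernels [measurable]:
  "ckernel \<epsilon> \<in> borel_measurable borel" "pkernel \<epsilon> \<in> borel_measurable borel"
  unfolding ckernel_def[abs_def] pkernel_def[abs_def]
  by (intro borel_measurable_divide; intro borel_measurable_continuous_UNIV continuous_intros)+

lemma pkernel_nonneg: "0 \<le> pkernel \<epsilon> u"
  by (simp add: pkernel_def)

lemma ckernel_tendsto: "(\<lambda>n. ckernel (1 / (real n + 1)) u) \<longlonglongrightarrow> 1 / u"
proof (cases "u = 0")
  case False
  have "(\<lambda>n. cnj u / of_real ((norm u)\<^sup>2 + (1 / (real n + 1))\<^sup>2)) \<longlonglongrightarrow> cnj u / of_real ((norm u)\<^sup>2 + 0\<^sup>2)"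
  proof (intro tendsto_intros)
    show "(\<lambda>n. 1 / (real n + 1)) \<longlonglongrightarrow> 0" by real_asymp
  qed (use False in auto)
  moreover have "cnj u / of_real ((norm u)\<^sup>2 + 0\<^sup>2) = 1 / u"
    using False complex_norm_square[of u] by (simp add: field_simps)
  ultimately show ?thesis by (simp add: ckernel_def)
qed (simp add: ckernel_def)

section \<open>The approximate identity \<open>pkernel\<close>\<close>

lemma integrable_pkernel:
  assumes "\<epsilon> > 0"
  shows "integrable lborel (pkernel \<epsilon>)" and "(\<integral>u. pkernel \<epsilon> u \<partial>lborel) = pi"
proof -
  have m: "pkernel \<epsilon> \<in> borel_measurable lborel" by measurable
  show "integrable lborel (pkernel \<epsilon>)"
    using m nn_integral_pkernel[OF assms] pkernel_nonneg by (intro integrableI_nn_integral_finite[of _ _ pi]) auto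
  show "(\<integral>u. pkernel \<epsilon> u \<partial>lborel) = pi"
    using m nn_integral_pkernel[OF assms] pkernel_nonneg by (subst integral_eq_nn_integral) auto
qed

text \<open>Away from the pole the kernel is of order \<open>\<epsilon>^2\<close>, with one
  integrable majorant for all \<open>\<epsilon>\<close>. The constant comes from
  \<open>s + 1 \<le> (1 + 1 / d^2) * s\<close> for \<open>s \<ge> d^2\<close>.\<close>

lemma pkernel_tail_le:
  assumes "d > 0" "norm u \<ge> d"
  shows "pkernel \<epsilon> u \<le> \<epsilon>\<^sup>2 * (1 + 1 / d\<^sup>2)\<^sup>2 * pkernel 1 u"
proof -
  define s where "s = (norm u)\<^sup>2"
  have s: "s \<ge> d\<^sup>2" "d\<^sup>2 > 0" using assms power_mono[of d "norm u" 2] by (auto simp: s_def)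
  then have s0: "s > 0" by linarith
  have "s + 1 \<le> (1 + 1 / d\<^sup>2) * s" using s by (simp add: field_simps)
  also have "\<dots> \<le> (1 + 1 / d\<^sup>2) * (s + \<epsilon>\<^sup>2)" by (intro mult_left_mono) auto
  finally have "(s + 1)\<^sup>2 \<le> ((1 + 1 / d\<^sup>2) * (s + \<epsilon>\<^sup>2))\<^sup>2" using s0 by (intro power_mono) auto
  then have "1 / (s + \<epsilon>\<^sup>2)\<^sup>2 \<le> (1 + 1 / d\<^sup>2)\<^sup>2 / (s + 1)\<^sup>2"
    using s0 add_pos_nonneg[OF s0, of "\<epsilon>\<^sup>2"] by (simp add: divide_simps power_mult_distrib)
  then have "\<epsilon>\<^sup>2 * (1 / (s + \<epsilon>\<^sup>2)\<^sup>2) \<le> \<epsilon>\<^sup>2 * ((1 + 1 / d\<^sup>2)\<^sup>2 / (s + 1)\<^sup>2)" by (intro mult_left_mono) auto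
  then show ?thesis by (simp add: pkernel_def s_def)
qed

text \<open>Off the frontier the indicator is constant on a disk around \<open>z\<close>. As the
  kernel has mass \<open>pi\<close>, the error is the integral of the kernel against the difference
  of indicators; it vanishes on that disk and is a tail of order \<open>\<epsilon>^2\<close>
  elsewhere.\<close>

lemma pkernel_indicator_tendsto:
  fixes z :: complex
  assumes z: "z \<notin> frontier Q" and [measurable]: "Q \<in> sets borel"
  shows "(\<lambda>n. \<integral>y. indicator Q y * complex_of_real (pkernel (1 / (real n + 1)) (z - y)) \<partial>lborel) \<longlonglongrightarrow> complex_of_real pi * indicator Q z"
proof -
  obtain d where d: "d > 0" and loc: "\<And>y. y \<in> ball z d \<Longrightarrow> indicator Q y = (indicator Q z :: real)"
  proof (cases "z \<in> interior Q")
    case True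
    then obtain d where "d > 0" "ball z d \<subseteq> Q" using mem_interior by metis
    then show ?thesis using that[of d] centre_in_ball[of z d] by (auto simp: indicator_def subset_iff)
  next
    case False
    then have "z \<in> interior (- Q)" using z by (auto simp: frontier_def interior_complement)
    then obtain d where "d > 0" "ball z d \<subseteq> - Q" using mem_interior by metis
    then show ?thesis using that[of d] centre_in_ball[of z d] by (auto simp: indicator_def subset_iff)
  qed
  have eq: "(\<integral>y. indicator Q y * complex_of_real (pkernel \<epsilon> (z - y)) \<partial>lborel) =
      of_real (\<integral>y. indicator Q y * pkernel \<epsilon> (z - y) \<partial>lborel)" for \<epsilon>
    by (subst integral_complex_of_real[symmetric]) (auto intro!: Bochner_Integration.integral_cong simp: indicator_def)
  have i1: "integrable lborel (\<lambda>y. pkernel \<epsilon> (z - y))" "(\<integral>y. pkernel \<epsilon> (z - y) \<partial>lborel) = pi" if "\<epsilon> > 0" for \<epsilon>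
    using integrable_pkernel[OF that] lborel_integrable_reflect[of "pkernel \<epsilon>" z] lborel_integral_reflect[of "pkernel \<epsilon>" z]
    by auto
  have le: "norm ((\<integral>y. indicator Q y * pkernel \<epsilon> (z - y) \<partial>lborel) - pi * indicator Q z) \<le> \<epsilon>\<^sup>2 * ((1 + 1 / d\<^sup>2)\<^sup>2 * pi)" if \<epsilon>: "\<epsilon> > 0" for \<epsilon>
  proof -
    have iQ: "integrable lborel (\<lambda>y. indicator Q y * pkernel \<epsilon> (z - y))"
      using integrable_mult_indicator[OF _ i1(1)[OF \<epsilon>], of Q] by simp
    have "(\<integral>y. indicator Q y * pkernel \<epsilon> (z - y) \<partial>lborel) - pi * indicator Q z =
        (\<integral>y. (indicator Q y - indicator Q z) * pkernel \<epsilon> (z - y) \<partial>lborel)"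
      using i1[OF \<epsilon>] iQ by (simp add: left_diff_distrib)
    also have "norm \<dots> \<le> (\<integral>y. \<epsilon>\<^sup>2 * (1 + 1 / d\<^sup>2)\<^sup>2 * pkernel 1 (z - y) \<partial>lborel)"
    proof (rule Bochner_Integration.integral_norm_bound_integral)
      show "integrable lborel (\<lambda>y. (indicator Q y - indicator Q z) * pkernel \<epsilon> (z - y))"
        using i1[OF \<epsilon>] iQ by (simp add: left_diff_distrib)
      show "integrable lborel (\<lambda>y. \<epsilon>\<^sup>2 * (1 + 1 / d\<^sup>2)\<^sup>2 * pkernel 1 (z - y))" using i1[of 1] by simp
      fix y
      show "norm ((indicator Q y - indicator Q z) * pkernel \<epsilon> (z - y)) \<le> \<epsilon>\<^sup>2 * (1 + 1 / d\<^sup>2)\<^sup>2 * pkernel 1 (z - y)"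
      proof (cases "y \<in> ball z d")
        case True
        then show ?thesis using loc[OF True] pkernel_nonneg by simp
      next
        case False
        then have "pkernel \<epsilon> (z - y) \<le> \<epsilon>\<^sup>2 * (1 + 1 / d\<^sup>2)\<^sup>2 * pkernel 1 (z - y)"
          using d by (intro pkernel_tail_le) (auto simp: dist_norm)
        then show ?thesis using pkernel_nonneg[of \<epsilon> "z - y"] pkernel_nonneg[of 1 "z - y"]
          by (auto simp: indicator_def)
      qed
    qed
    also have "\<dots> = \<epsilon>\<^sup>2 * ((1 + 1 / d\<^sup>2)\<^sup>2 * pi)" using i1[of 1] by simp
    finally show ?thesis .
  qed
  have "(\<lambda>n. (\<integral>y. indicator Q y * pkernel (1 / (real n + 1)) (z - y) \<partial>lborel) - pi * indicator Q z) \<longlonglongrightarrow> 0"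
  proof (rule Lim_null_comparison[OF always_eventually])
    show "\<forall>n. norm ((\<integral>y. indicator Q y * pkernel (1 / (real n + 1)) (z - y) \<partial>lborel) - pi * indicator Q z) \<le> (1 / (real n + 1))\<^sup>2 * ((1 + 1 / d\<^sup>2)\<^sup>2 * pi)"
      by (intro allI le) simp
    have "(\<lambda>n. (1 / (real n + 1))\<^sup>2) \<longlonglongrightarrow> 0" by real_asymp
    then show "(\<lambda>n. (1 / (real n + 1))\<^sup>2 * ((1 + 1 / d\<^sup>2)\<^sup>2 * pi)) \<longlonglongrightarrow> 0" by (rule tendsto_mult_left_zero)
  qed
  then have "(\<lambda>n. \<integral>y. indicator Q y * pkernel (1 / (real n + 1)) (z - y) \<partial>lborel) \<longlonglongrightarrow> pi * indicator Q z"
    by (rule LIM_zero_cancel)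
  from tendsto_of_real[OF this, where 'a = complex] show ?thesis unfolding eq by (cases "z \<in> Q") auto
qed


section \<open>The Cauchy transform\<close>

text \<open>The kernel \<open>1 / (z - \<zeta>)\<close> absorbs the minus sign of
  \<open>cauchy_potential\<close>, and the factor \<open>1 / pi\<close> makes the transform a right
  inverse of \<open>dbar\<close> on bounded data.\<close>

definition cauchy_transform :: "(complex \<Rightarrow> complex) \<Rightarrow> complex \<Rightarrow> complex" where
  "cauchy_transform H z = (1 / of_real pi) * (\<integral>\<zeta>. H \<zeta> * (1 / (z - \<zeta>)) \<partial>lborel)"

lemma borel_measurable_cauchy_transform [measurable]:
  assumes [measurable]: "H \<in> borel_measurable borel"
  shows "cauchy_transform H \<in> borel_measurable borel"
  unfolding cauchy_transform_def[abs_def] by measurable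

lemma borel_measurable_complex_inverse [measurable]: "(\<lambda>u::complex. 1 / u) \<in> borel_measurable borel"
  by measurable

text \<open>For such \<open>H\<close> the kernel integral converges at every point, and the
  transform is bounded and continuous. For data that are merely integrable it is controlled only
  almost everywhere.\<close>

locale bounded_data =
  fixes A :: "complex set" and H :: "complex \<Rightarrow> complex" and C :: real
  assumes A: "A \<in> sets borel" "bounded A"
    and H: "\<And>y. norm (H y) \<le> C" "\<And>y. y \<notin> A \<Longrightarrow> H y = 0"
    and H_meas [measurable]: "H \<in> borel_measurable borel"
begin

lemma C_nonneg: "C \<ge> 0"
  using H(1)[of 0] norm_ge_zero order_trans by blast

lemma kernel_integral_le:
  assumes "\<And>u. norm (k u) \<le> 1 / norm u" "k \<in> borel_measurable borel"
  shows "integrable lborel (\<lambda>y. H y * k (x - y))"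
    and "norm (\<integral>y. H y * k (x - y) \<partial>lborel) \<le> C * cauchy_bound A"
proof -
  have [measurable]: "k \<in> borel_measurable borel" by fact
  note le = nn_integral_bounded_kernel_le[OF A assms(1) H H_meas assms(2), where x = x]
  show i: "integrable lborel (\<lambda>y. H y * k (x - y))"
    by (rule integrableI_bounded) (auto intro: le_less_trans[OF le])
  show "norm (\<integral>y. H y * k (x - y) \<partial>lborel) \<le> C * cauchy_bound A"
    using integral_norm_bound_ennreal[OF i] le C_nonneg cauchy_bound_nonneg[of A]
    by (meson ennreal_le_iff mult_nonneg_nonneg order_trans)
qed

lemma norm_cauchy_transform_le: "norm (cauchy_transform H x) \<le> C * cauchy_bound A / pi"
  using kernel_integral_le(2)[of "\<lambda>u. 1 / u" x]
  by (simp add: cauchy_transform_def norm_divide norm_mult divide_right_mono)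

lemma Fubini_kernel:
  assumes X: "integrable lborel X" and k: "\<And>u. norm (k u) \<le> 1 / norm u" "k \<in> borel_measurable borel"
  shows "integrable (lborel \<Otimes>\<^sub>M lborel) (\<lambda>(x, y). X x * (H y * k (x - y)))"
  by (rule integrable_kernel_product[OF X H_meas k(2) nn_integral_bounded_kernel_le[OF A k(1) H H_meas k(2)]])

text \<open>Fubini for \<open>1 / (x - y)\<close>, which changes sign when \<open>x\<close> and
  \<open>y\<close> are exchanged. Since \<open>X\<close> is only integrable, its kernel integral
  need not converge at every \<open>y\<close>; the second claim records where it does, as far as
  \<open>H y\<close> is nonzero.\<close>

lemma cauchy_transform_pairing:
  assumes X: "integrable lborel X"
  shows "integrable lborel (\<lambda>x. X x * cauchy_transform H x)"
    and "AE y in lborel. integrable lborel (\<lambda>x. X x * (H y * (1 / (y - x))))"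
    and "integrable lborel (\<lambda>y. H y * cauchy_transform X y)"
    and "(\<integral>x. X x * cauchy_transform H x \<partial>lborel) = - (\<integral>y. H y * cauchy_transform X y \<partial>lborel)"
proof -
  have flip: "1 / (y - x) = - (1 / (x - y))" for x y :: complex
    by (metis minus_diff_eq minus_divide_right)
  note P = Fubini_kernel[OF X, of "\<lambda>u. 1 / u"]
  have P': "integrable (lborel \<Otimes>\<^sub>M lborel) (\<lambda>(x, y). X x * (H y * (1 / (x - y))))"
    by (rule P) (auto simp: norm_divide)
  have e1: "X x * cauchy_transform H x = (1 / of_real pi) * (\<integral>y. X x * (H y * (1 / (x - y))) \<partial>lborel)" for x
  proof -
    have "(\<integral>y. X x * (H y * (1 / (x - y))) \<partial>lborel) = X x * (\<integral>y. H y * (1 / (x - y)) \<partial>lborel)"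
      by (rule integral_mult_right_zero)
    then show ?thesis by (simp add: cauchy_transform_def)
  qed
  have e2: "H y * cauchy_transform X y = - (1 / of_real pi) * (\<integral>x. X x * (H y * (1 / (x - y))) \<partial>lborel)" for y
  proof -
    have "(\<integral>x. X x * (H y * (1 / (x - y))) \<partial>lborel) = (\<integral>x. (- H y) * (X x * (1 / (y - x))) \<partial>lborel)"
      by (intro Bochner_Integration.integral_cong) (auto simp: flip[of y])
    also have "\<dots> = (- H y) * (\<integral>x. X x * (1 / (y - x)) \<partial>lborel)" by (rule integral_mult_right_zero)
    finally show ?thesis by (simp add: cauchy_transform_def)
  qed
  show "integrable lborel (\<lambda>x. X x * cauchy_transform H x)"
    unfolding e1 by (intro integrable_mult_right lborel_pair.integrable_fst[OF P'])
  show "AE y in lborel. integrable lborel (\<lambda>x. X x * (H y * (1 / (y - x))))"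
    using lborel_pair.AE_integrable_snd[OF P']
    by eventually_elim (subst flip, simp)
  show "integrable lborel (\<lambda>y. H y * cauchy_transform X y)"
    unfolding e2 by (intro integrable_mult_right lborel_pair.integrable_snd[OF P'])
  show "(\<integral>x. X x * cauchy_transform H x \<partial>lborel) = - (\<integral>y. H y * cauchy_transform X y \<partial>lborel)"
    unfolding e1 e2 integral_mult_right_zero lborel_pair.Fubini_integral[OF P'] by simp
qed

text \<open>With \<open>ckernel\<close> in place of \<open>1 / u\<close> the transforms are
  continuous by dominated convergence. On a disk they converge uniformly: for every \<open>x\<close>
  the error is at most \<open>C\<close> times the integral of
  \<open>norm (ckernel \<epsilon> u - 1 / u)\<close> over one fixed disk.\<close>

lemma continuous_cauchy_transform: "continuous_on UNIV (cauchy_transform H)"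
proof -
  define c where "c n x = (\<integral>y. H y * ckernel (1 / (real n + 1)) (x - y) \<partial>lborel)" for n x
  have cont_c: "continuous_on S (c n)" for n S
    unfolding continuous_on_sequentially comp_def
  proof (intro ballI allI impI, elim conjE)
    fix x :: complex and X assume X: "X \<longlonglongrightarrow> x"
    let ?e = "1 / (real n + 1)"
    show "(\<lambda>k. c n (X k)) \<longlonglongrightarrow> c n x"
      unfolding c_def
    proof (rule integral_dominated_convergence[where w = "\<lambda>y. norm (H y * of_real (1 / ?e))"])
      have "integrable lborel (indicat_real A)"
        using A emeasure_bounded_finite[OF A(2)] by (intro integrable_real_indicator) auto
      then have "integrable lborel (\<lambda>y. complex_of_real (C * indicat_real A y))"
        by (intro integrable_of_real integrable_mult_right)
      then have "integrable lborel H"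
        by (rule Bochner_Integration.integrable_bound) (use H C_nonneg in \<open>auto simp: indicator_def\<close>)
      then show "integrable lborel (\<lambda>y. norm (H y * of_real (1 / ?e)))" by simp
      have cont: "isCont (ckernel ?e) u" for u
      proof -
        have "continuous_on UNIV (\<lambda>z. ckernel ?e (z - 0))"
          by (rule times_differentiable_continuous[OF times_differentiable_ckernel]) auto
        then show ?thesis by (simp add: continuous_on_eq_continuous_at)
      qed
      show "AE y in lborel. (\<lambda>k. H y * ckernel ?e (X k - y)) \<longlonglongrightarrow> H y * ckernel ?e (x - y)"
        by (intro always_eventually allI tendsto_mult tendsto_const isCont_tendsto_compose[OF cont]
              tendsto_diff X)
      fix k
      show "AE y in lborel. norm (H y * ckernel ?e (X k - y)) \<le> norm (H y * of_real (1 / ?e))"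
      proof (intro always_eventually allI)
        fix y
        have "norm (ckernel ?e (X k - y)) \<le> norm (complex_of_real (1 / ?e))"
          unfolding norm_of_real using norm_ckernel_le[of ?e "X k - y"] by simp
        then show "norm (H y * ckernel ?e (X k - y)) \<le> norm (H y * of_real (1 / ?e))"
          unfolding norm_mult by (rule mult_left_mono) simp
      qed
    qed auto
  qed
  have cont_ball: "continuous_on (ball 0 N) (cauchy_transform H)" for N
  proof -
    obtain M where M: "\<And>y. y \<in> A \<Longrightarrow> norm y \<le> M" using A(2) by (auto simp: bounded_iff)
    \<comment> \<open>All differences \<open>x - y\<close> with \<open>x\<close> in
      \<open>ball 0 N\<close> and \<open>y\<close> in \<open>A\<close> lie in the disk of radius
      \<open>L\<close>.\<close>
    define L where "L = N + M"
    define g where "g n u = indicator (cball 0 L) u * norm (ckernel (1 / (real n + 1)) u - 1 / u)" for n u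
    have ind: "bounded_data (cball 0 L) (\<lambda>y. indicator (cball 0 L) y) 1"
      by unfold_locales (auto simp: indicator_def)
    have "integrable lborel (\<lambda>y. indicator (cball 0 L) y * (1 / (0 - y)) :: complex)"
      by (rule bounded_data.kernel_integral_le(1)[OF ind, of "\<lambda>u. 1 / u"]) (auto simp: norm_divide)
    from integrable_norm[OF this]
    have dom: "integrable lborel (\<lambda>u::complex. indicator (cball 0 L) u * (2 * (1 / norm u)))"
      by (rule Bochner_Integration.integrable_bound[OF integrable_mult_right[of 2]])
         (auto simp: norm_mult norm_divide indicator_def)
    have g_le: "norm (g n u) \<le> indicator (cball 0 L) u * (2 * (1 / norm u))" for n u
      using norm_triangle_ineq4[of "ckernel (1 / (real n + 1)) u" "1 / u"] ckernel_le[of "1 / (real n + 1)" u]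
      by (auto simp: g_def norm_mult norm_divide indicator_def)
    have g_meas [measurable]: "g n \<in> borel_measurable borel" for n
      unfolding g_def[abs_def] by measurable
    have g_int: "integrable lborel (g n)" for n
      by (rule Bochner_Integration.integrable_bound[OF dom]) (use g_le in \<open>auto intro: order_trans[OF _ abs_ge_self]\<close>)
    have "(\<lambda>n. \<integral>u. g n u \<partial>lborel) \<longlonglongrightarrow> (\<integral>u. 0 \<partial>(lborel :: complex measure))"
    proof (rule integral_dominated_convergence[OF _ _ dom])
      have "(\<lambda>n. g n u) \<longlonglongrightarrow> indicator (cball 0 L) u * norm (1 / u - 1 / u)" for u
        unfolding g_def by (intro tendsto_intros ckernel_tendsto)
      then show "AE u in lborel. (\<lambda>n. g n u) \<longlonglongrightarrow> 0" by auto
    qed (use g_le in auto)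
    then have g0: "(\<lambda>n. C * (\<integral>u. g n u \<partial>lborel)) \<longlonglongrightarrow> 0"
      using tendsto_mult_right_zero by fastforce
    have est: "norm (c n x - of_real pi * cauchy_transform H x) \<le> C * (\<integral>u. g n u \<partial>lborel)" if x: "x \<in> ball 0 N" for n x
    proof -
      have i1: "integrable lborel (\<lambda>y. H y * ckernel (1 / (real n + 1)) (x - y))"
        by (rule kernel_integral_le) (auto simp: ckernel_le)
      have i2: "integrable lborel (\<lambda>y. H y * (1 / (x - y)))"
        by (rule kernel_integral_le(1)[of "\<lambda>u. 1 / u"]) (auto simp: norm_divide)
      have "c n x - of_real pi * cauchy_transform H x =
          (\<integral>y. H y * ckernel (1 / (real n + 1)) (x - y) - H y * (1 / (x - y)) \<partial>lborel)"
        unfolding c_def Bochner_Integration.integral_diff[OF i1 i2] by (simp add: cauchy_transform_def)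
      also have "norm \<dots> \<le> (\<integral>y. C * g n (x - y) \<partial>lborel)"
      proof (rule Bochner_Integration.integral_norm_bound_integral)
        show "integrable lborel (\<lambda>y. C * g n (x - y))"
          using g_int[of n] lborel_integrable_reflect[OF g_meas, of n x] by simp
        fix y
        show "norm (H y * ckernel (1 / (real n + 1)) (x - y) - H y * (1 / (x - y))) \<le> C * g n (x - y)"
        proof (cases "y \<in> A")
          case True
          then have "norm (x - y) \<le> L"
            using norm_triangle_ineq4[of x y] M[OF True] x by (simp add: L_def)
          then show ?thesis using H(1)[of y]
            by (simp only: right_diff_distrib[symmetric] norm_mult g_def) (simp add: mult_right_mono)
        next
          case False
          then show ?thesis using H(2)[of y] C_nonneg by (simp add: g_def)
        qed
      qed (use i1 i2 in auto)
      also have "\<dots> = C * (\<integral>u. g n u \<partial>lborel)"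
        using lborel_integral_reflect[OF g_meas, of n x] by simp
      finally show ?thesis .
    qed
    have "uniform_limit (ball 0 N) c (\<lambda>x. of_real pi * cauchy_transform H x) sequentially"
    proof (rule uniform_limitI)
      fix e :: real assume "e > 0"
      with g0 have "\<forall>\<^sub>F n in sequentially. C * (\<integral>u. g n u \<partial>lborel) < e" by (auto dest: order_tendstoD)
      then show "\<forall>\<^sub>F n in sequentially. \<forall>x\<in>ball 0 N. dist (c n x) (of_real pi * cauchy_transform H x) < e"
        by eventually_elim (auto simp: dist_norm intro: le_less_trans[OF est])
    qed
    then have "continuous_on (ball 0 N) (\<lambda>x. of_real pi * cauchy_transform H x)"
      by (rule uniform_limit_theorem[rotated]) (simp_all add: cont_c)
    then have "continuous_on (ball 0 N) (\<lambda>x. (1 / of_real pi) * (of_real pi * cauchy_transform H x))"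
      by (rule continuous_on_mult_left)
    moreover have "(\<lambda>x. (1 / of_real pi) * (of_real pi * cauchy_transform H x)) = cauchy_transform H"
      by (simp add: fun_eq_iff)
    ultimately show ?thesis by (simp only:)
  qed
  show ?thesis
    unfolding continuous_on_eq_continuous_at[OF open_UNIV]
  proof
    fix x :: complex
    show "isCont (cauchy_transform H) x"
      using cont_ball[of "norm x + 1"] by (simp add: continuous_on_eq_continuous_at)
  qed
qed

end

text \<open>Testing the weak equation with the translates of \<open>ckernel \<epsilon>\<close> and integrating over a box \<open>Q\<close>
  gives \<open>\<integral>F P\<^sub>\<epsilon> = - \<integral>H C\<^sub>\<epsilon>\<close>, where \<open>P\<^sub>\<epsilon>\<close> and \<open>C\<^sub>\<epsilon>\<close> are the convolutions of the indicator function of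
  \<open>Q\<close> with \<open>pkernel \<epsilon>\<close> and \<open>ckernel \<epsilon>\<close>; let \<open>\<epsilon>\<close> tend to \<open>0\<close>.\<close>

lemma eq_cauchy_transform:
  assumes F: "integrable lborel F" and H: "integrable lborel H"
    and eq: "\<And>\<epsilon> a. \<epsilon> > 0 \<Longrightarrow> (\<integral>z. F z * of_real (pkernel \<epsilon> (z - a)) \<partial>lborel) = - (\<integral>z. H z * ckernel \<epsilon> (z - a) \<partial>lborel)"
  shows "AE z in lborel. F z = cauchy_transform H z"
proof -
  have [measurable]: "F \<in> borel_measurable borel" "H \<in> borel_measurable borel" using F H by auto
  have box: "integrable lborel (\<lambda>z. indicator (box a b) z * (F z - cauchy_transform H z)) \<and>
      (\<integral>z. indicator (box a b) z * (F z - cauchy_transform H z) \<partial>lborel) = 0" for a b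
  proof -
    let ?Q = "box a b :: complex set" and ?I = "indicator (box a b) :: complex \<Rightarrow> complex"
    interpret Q: bounded_data ?Q ?I 1 by unfold_locales (auto simp: indicator_def)
    define P where "P n z = (\<integral>y. ?I y * of_real (pkernel (1 / (real n + 1)) (z - y)) \<partial>lborel)" for n z
    define K where "K n z = (\<integral>y. ?I y * ckernel (1 / (real n + 1)) (z - y) \<partial>lborel)" for n z
    have P_bound: "(\<integral>\<^sup>+y. ennreal (norm (?I y * of_real (pkernel (1 / (real n + 1)) (z - y)))) \<partial>lborel) \<le> ennreal pi" for n z
    proof -
      have "(\<integral>\<^sup>+y. ennreal (norm (?I y * of_real (pkernel (1 / (real n + 1)) (z - y)))) \<partial>lborel)
          \<le> (\<integral>\<^sup>+y. ennreal (pkernel (1 / (real n + 1)) (z - y)) \<partial>lborel)"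
        by (intro nn_integral_mono) (auto simp: indicator_def norm_mult pkernel_nonneg)
      also have "\<dots> = ennreal pi"
        using lborel_nn_integral_reflect[of "\<lambda>u. ennreal (pkernel (1 / (real n + 1)) u)" z] nn_integral_pkernel[of "1 / (real n + 1)"]
        by simp
      finally show ?thesis .
    qed
    have FP: "integrable (lborel \<Otimes>\<^sub>M lborel) (\<lambda>(x, y). F x * (?I y * of_real (pkernel (1 / (real n + 1)) (x - y))))" for n
      by (rule integrable_kernel_product[OF F _ _ P_bound]) auto
    have HK: "integrable (lborel \<Otimes>\<^sub>M lborel) (\<lambda>(x, y). H x * (?I y * ckernel (1 / (real n + 1)) (x - y)))" for n
      by (rule Q.Fubini_kernel[OF H]) (auto simp: ckernel_le)
    have PK: "(\<integral>x. F x * P n x \<partial>lborel) = - (\<integral>x. H x * K n x \<partial>lborel)" for n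
    proof -
      let ?e = "1 / (real n + 1)"
      have "(\<integral>x. F x * P n x \<partial>lborel) = (\<integral>x. (\<integral>y. F x * (?I y * of_real (pkernel ?e (x - y))) \<partial>lborel) \<partial>lborel)"
        by (simp add: P_def)
      also have "\<dots> = (\<integral>y. (\<integral>x. F x * (?I y * of_real (pkernel ?e (x - y))) \<partial>lborel) \<partial>lborel)"
        by (rule lborel_pair.Fubini_integral[OF FP, symmetric])
      also have "\<dots> = (\<integral>y. ?I y * (\<integral>x. F x * of_real (pkernel ?e (x - y)) \<partial>lborel) \<partial>lborel)"
        by (subst integral_mult_right_zero[symmetric]) (simp add: mult_ac)
      also have "\<dots> = - (\<integral>y. ?I y * (\<integral>x. H x * ckernel ?e (x - y) \<partial>lborel) \<partial>lborel)"
        by (subst eq) auto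
      also have "(\<integral>y. ?I y * (\<integral>x. H x * ckernel ?e (x - y) \<partial>lborel) \<partial>lborel)
          = (\<integral>y. (\<integral>x. H x * (?I y * ckernel ?e (x - y)) \<partial>lborel) \<partial>lborel)"
        by (subst integral_mult_right_zero[symmetric]) (simp add: mult_ac)
      also have "\<dots> = (\<integral>x. (\<integral>y. H x * (?I y * ckernel ?e (x - y)) \<partial>lborel) \<partial>lborel)"
        by (rule lborel_pair.Fubini_integral[OF HK])
      also have "\<dots> = (\<integral>x. H x * K n x \<partial>lborel)" by (simp add: K_def)
      finally show ?thesis .
    qed
    have P_meas [measurable]: "P n \<in> borel_measurable borel" and K_meas [measurable]: "K n \<in> borel_measurable borel" for n
      unfolding P_def[abs_def] K_def[abs_def] by measurable
    have limP: "(\<lambda>n. \<integral>x. F x * P n x \<partial>lborel) \<longlonglongrightarrow> (\<integral>x. F x * (of_real pi * ?I x) \<partial>lborel)"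
    proof (rule integral_dominated_convergence[where w = "\<lambda>x. norm (F x * of_real pi)"])
      show "integrable lborel (\<lambda>x. norm (F x * complex_of_real pi))" using F by simp
      \<comment> \<open>The approximate identity converges off the frontier only, which is null
        because a box is convex.\<close>
      have "frontier ?Q \<in> null_sets lebesgue"
        using negligible_convex_frontier[of ?Q] by (simp add: negligible_iff_null_sets)
      then have "AE x in lebesgue. x \<notin> frontier ?Q" by (rule AE_not_in)
      then have "AE x in lborel. x \<notin> frontier ?Q" by (simp add: AE_completion_iff)
      then show "AE x in lborel. (\<lambda>n. F x * P n x) \<longlonglongrightarrow> F x * (of_real pi * ?I x)"
      proof eventually_elim
        case (elim x)
        then show ?case using pkernel_indicator_tendsto[of x ?Q]
          unfolding P_def by (intro tendsto_mult tendsto_const) simp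
      qed
      show "AE x in lborel. norm (F x * P n x) \<le> norm (F x * complex_of_real pi)" for n
      proof (intro always_eventually allI)
        fix x
        have "integrable lborel (\<lambda>y. ?I y * of_real (pkernel (1 / (real n + 1)) (x - y)))"
          by (rule integrableI_bounded) (auto intro: le_less_trans[OF P_bound])
        from integral_norm_bound_ennreal[OF this] P_bound[of n x]
        have "norm (P n x) \<le> pi" unfolding P_def by (meson ennreal_le_iff order_trans pi_ge_zero)
        then show "norm (F x * P n x) \<le> norm (F x * complex_of_real pi)"
          by (auto simp: norm_mult intro!: mult_left_mono)
      qed
    qed auto
    have limK: "(\<lambda>n. \<integral>x. H x * K n x \<partial>lborel) \<longlonglongrightarrow> (\<integral>x. H x * (of_real pi * cauchy_transform ?I x) \<partial>lborel)"
    proof (rule integral_dominated_convergence[where w = "\<lambda>x. norm (H x * of_real (cauchy_bound ?Q))"])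
      show "integrable lborel (\<lambda>x. norm (H x * complex_of_real (cauchy_bound ?Q)))" using H by simp
      have "(\<lambda>n. K n x) \<longlonglongrightarrow> (\<integral>y. ?I y * (1 / (x - y)) \<partial>lborel)" for x
        unfolding K_def
      proof (rule integral_dominated_convergence[where w = "\<lambda>y. norm (?I y * (1 / (x - y)))"])
        show "integrable lborel (\<lambda>y. norm (?I y * (1 / (x - y))))"
          by (intro integrable_norm Q.kernel_integral_le(1)[of "\<lambda>u. 1 / u"]) (auto simp: norm_divide)
      qed (use ckernel_le in \<open>auto intro!: tendsto_mult ckernel_tendsto mult_left_mono simp: norm_mult norm_divide simp del: times_divide_eq_right\<close>)
      then show "AE x in lborel. (\<lambda>n. H x * K n x) \<longlonglongrightarrow> H x * (of_real pi * cauchy_transform ?I x)"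
        by (intro always_eventually allI tendsto_mult tendsto_const) (simp add: cauchy_transform_def)
      show "AE x in lborel. norm (H x * K n x) \<le> norm (H x * complex_of_real (cauchy_bound ?Q))" for n
        using Q.kernel_integral_le(2)[of "ckernel (1 / (real n + 1))"] cauchy_bound_nonneg[of ?Q]
        by (auto simp: norm_mult K_def ckernel_le intro!: mult_left_mono)
    qed auto
    have "(\<integral>x. F x * (of_real pi * ?I x) \<partial>lborel) = - (\<integral>x. H x * (of_real pi * cauchy_transform ?I x) \<partial>lborel)"
      using LIMSEQ_unique[OF limP] tendsto_minus[OF limK] by (simp add: PK)
    moreover have "(\<integral>x. F x * (of_real pi * ?I x) \<partial>lborel) = of_real pi * (\<integral>x. ?I x * F x \<partial>lborel)"
      by (subst integral_mult_right_zero[symmetric]) (simp add: mult_ac)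
    moreover have "(\<integral>x. H x * (of_real pi * cauchy_transform ?I x) \<partial>lborel) = of_real pi * (\<integral>x. H x * cauchy_transform ?I x \<partial>lborel)"
      by (subst integral_mult_right_zero[symmetric]) (simp add: mult_ac)
    \<comment> \<open>Moving the transform from the indicator to \<open>H\<close> produces a second
      minus sign, which cancels the first.\<close>
    ultimately have "(\<integral>x. ?I x * F x \<partial>lborel) = (\<integral>y. ?I y * cauchy_transform H y \<partial>lborel)"
      unfolding Q.cauchy_transform_pairing(4)[OF H] by (simp del: integral_mult_right_zero)
    moreover have "integrable lborel (\<lambda>x. ?I x * F x)"
      by (rule Bochner_Integration.integrable_bound[OF F]) (auto simp: indicator_def)
    moreover note Q.cauchy_transform_pairing(3)[OF H]
    ultimately show ?thesis by (simp add: right_diff_distrib)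
  qed
  have "AE z in lborel. F z - cauchy_transform H z = 0"
    by (rule AE_eq_0_boxes) (use box in auto)
  then show ?thesis by simp
qed

section \<open>Weak derivatives tested against continuously differentiable functions\<close>

text \<open>Compact subsets of the unit disk lie in some \<open>cball 0 r\<close> with
  \<open>r < 1\<close>, so these disks encode local integrability. Outside the disk the values are
  arbitrary, subject to Borel measurability.\<close>

definition loc_int :: "(complex \<Rightarrow> complex) \<Rightarrow> bool" where
  "loc_int f \<longleftrightarrow> f \<in> borel_measurable borel \<and>
     (\<forall>r<1. integrable lborel (\<lambda>z. indicator (cball 0 r) z * f z))"

text \<open>C^1 is enough for integration by parts and contains the products of
  \<open>cutoff\<close> with translated kernels. The radius stays explicit so that a support can be
  enlarged slightly and still lie in the disk.\<close>

definition test1 :: "real \<Rightarrow> (complex \<Rightarrow> complex) \<Rightarrow> bool" where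
  "test1 r \<phi> \<longleftrightarrow> times_differentiable 1 \<phi> \<and> (\<forall>z. norm z > r \<longrightarrow> \<phi> z = 0)"

definition weak_dbar :: "(complex \<Rightarrow> complex) \<Rightarrow> (complex \<Rightarrow> complex) \<Rightarrow> bool" where
  "weak_dbar f g \<longleftrightarrow> loc_int f \<and> loc_int g \<and>
     (\<forall>r<1. \<forall>\<phi>. test1 r \<phi> \<longrightarrow> (\<integral>z. f z * dbar \<phi> z \<partial>lborel) = - (\<integral>z. g z * \<phi> z \<partial>lborel))"

lemma loc_int_measurable [measurable_dest]: "loc_int f \<Longrightarrow> f \<in> borel_measurable borel"
  by (simp add: loc_int_def)

lemma loc_int_add: "loc_int f \<Longrightarrow> loc_int g \<Longrightarrow> loc_int (\<lambda>z. f z + g z)"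
  by (auto simp: loc_int_def distrib_left)

lemma integrable_on_cball_mult:
  fixes f a :: "complex \<Rightarrow> complex"
  assumes f: "integrable lborel (\<lambda>z. indicator (cball 0 r) z * f z)" "f \<in> borel_measurable borel"
    and a: "a \<in> borel_measurable borel" "\<And>z. norm z \<le> r \<Longrightarrow> norm (a z) \<le> M"
  shows "integrable lborel (\<lambda>z. indicator (cball 0 r) z * (a z * f z))"
proof (rule Bochner_Integration.integrable_bound)
  show "integrable lborel (\<lambda>z. of_real M * (indicator (cball 0 r) z * f z))"
    by (rule integrable_mult_right[OF f(1)])
  show "AE z in lborel. norm (indicator (cball 0 r) z * (a z * f z)) \<le> norm (of_real M * (indicator (cball 0 r) z * f z))"
    by (intro always_eventually) (auto simp: indicator_def norm_mult intro!: mult_right_mono order_trans[OF a(2) abs_ge_self])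
  show "(\<lambda>z. indicator (cball 0 r) z * (a z * f z)) \<in> borel_measurable lborel"
  proof -
    note [measurable] = f(2) a(1)
    show ?thesis by measurable
  qed
qed

lemma loc_int_mult_bounded:
  assumes f: "loc_int f" and a: "a \<in> borel_measurable borel" "\<And>z. norm z < 1 \<Longrightarrow> norm (a z) \<le> M"
  shows "loc_int (\<lambda>z. a z * f z)"
  unfolding loc_int_def
proof safe
  show "(\<lambda>z. a z * f z) \<in> borel_measurable borel" using f a(1) by (auto simp: loc_int_def)
  fix r :: real assume "r < 1"
  then show "integrable lborel (\<lambda>z. indicator (cball 0 r) z * (a z * f z))"
    using f a by (intro integrable_on_cball_mult[of _ _ _ M]) (auto simp: loc_int_def)
qed

lemma continuous_bounded_on_cball:
  fixes f :: "complex \<Rightarrow> complex"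
  assumes "continuous_on UNIV f"
  shows "\<exists>B. \<forall>z. norm z \<le> r \<longrightarrow> norm (f z) \<le> B"
proof -
  have "bounded (f ` cball 0 r)"
    by (intro compact_imp_bounded compact_continuous_image continuous_on_subset[OF assms]) auto
  then obtain B where "\<forall>w\<in>f ` cball 0 r. norm w \<le> B" unfolding bounded_iff ..
  then show ?thesis by (intro exI[of _ B]) simp
qed

lemma loc_int_mult_continuous:
  assumes f: "loc_int f" and a: "continuous_on UNIV a"
  shows "loc_int (\<lambda>z. a z * f z)"
  unfolding loc_int_def
proof safe
  have m: "a \<in> borel_measurable borel" by (rule borel_measurable_continuous_UNIV[OF a])
  then show "(\<lambda>z. a z * f z) \<in> borel_measurable borel" using f by (auto simp: loc_int_def)
  fix r :: real assume "r < 1"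
  obtain M where "\<And>z. norm z \<le> r \<Longrightarrow> norm (a z) \<le> M" using continuous_bounded_on_cball[OF a] by blast
  then show "integrable lborel (\<lambda>z. indicator (cball 0 r) z * (a z * f z))"
    using f m \<open>r < 1\<close> by (intro integrable_on_cball_mult[of _ _ _ M]) (auto simp: loc_int_def)
qed

lemma loc_int_cmult: "loc_int f \<Longrightarrow> loc_int (\<lambda>z. c * f z)"
  using loc_int_mult_continuous[of f "\<lambda>_. c"] by simp

lemma loc_int_integrable:
  assumes "loc_int f" "r < 1" "\<And>z. norm z > r \<Longrightarrow> f z = 0"
  shows "integrable lborel f"
proof -
  have "(\<lambda>z. indicator (cball 0 r) z * f z) = f" using assms(3) by (auto simp: indicator_def fun_eq_iff not_le)
  then show ?thesis using assms(1,2) by (auto simp: loc_int_def)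
qed

lemma loc_int_test_integrable:
  assumes "loc_int f" "r < 1" "continuous_on UNIV \<phi>" "\<And>z. norm z > r \<Longrightarrow> \<phi> z = 0"
  shows "integrable lborel (\<lambda>z. f z * \<phi> z)"
  using loc_int_integrable[OF loc_int_mult_continuous[OF assms(1,3)] assms(2)] assms(4) by (simp add: mult.commute)

lemma loc_int_continuous: "continuous_on UNIV f \<Longrightarrow> loc_int f"
  unfolding loc_int_def
proof safe
  assume f: "continuous_on UNIV f"
  show "f \<in> borel_measurable borel" by (rule borel_measurable_continuous_UNIV[OF f])
  fix r :: real
  have "integrable lborel (\<lambda>z. indicator (cball 0 r) z *\<^sub>R f z)"
    by (intro borel_integrable_compact continuous_on_subset[OF f]) auto
  then show "integrable lborel (\<lambda>z. indicator (cball 0 r) z * f z)"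
  proof -
    have "(\<lambda>z. indicator (cball 0 r) z *\<^sub>R f z) = (\<lambda>z. indicator (cball 0 r) z * f z)"
      by (auto simp: fun_eq_iff indicator_def)
    with \<open>integrable lborel (\<lambda>z. indicator (cball 0 r) z *\<^sub>R f z)\<close> show ?thesis by simp
  qed
qed

lemma dbar_support:
  assumes "test1 r \<phi>" "norm z > r"
  shows "dbar \<phi> z = 0"
  using frechet_derivative_support[of r \<phi> z] assms by (simp add: test1_def dbar_def dx_def dy_def)

lemma continuous_dbar: "times_differentiable 1 \<phi> \<Longrightarrow> continuous_on UNIV (dbar \<phi>)"
  using times_differentiable_dbar[of 0 \<phi>] by simp

lemma test1_mult: "test1 r \<phi> \<Longrightarrow> times_differentiable 1 k \<Longrightarrow> test1 r (\<lambda>z. \<phi> z * k z)"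
  by (auto simp: test1_def intro: times_differentiable_mult simp del: times_differentiable.simps)

lemma weak_dbarD:
  assumes "weak_dbar f g"
  shows "loc_int f" "loc_int g"
    and "r < 1 \<Longrightarrow> test1 r \<phi> \<Longrightarrow> (\<integral>z. f z * dbar \<phi> z \<partial>lborel) = - (\<integral>z. g z * \<phi> z \<partial>lborel)"
  using assms by (auto simp: weak_dbar_def)

lemma test1_integrable:
  assumes "loc_int f" "r < 1" "test1 r \<phi>"
  shows "integrable lborel (\<lambda>z. f z * \<phi> z)" "integrable lborel (\<lambda>z. f z * dbar \<phi> z)"
  using assms dbar_support[OF assms(3)] times_differentiable_continuous[of 1 \<phi> UNIV] continuous_dbar[of \<phi>]
  by (auto intro!: loc_int_test_integrable[OF assms(1,2)] simp: test1_def simp del: times_differentiable.simps)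

lemma weak_dbar_add:
  assumes "weak_dbar f f'" "weak_dbar g g'"
  shows "weak_dbar (\<lambda>z. f z + g z) (\<lambda>z. f' z + g' z)"
  unfolding weak_dbar_def
  using weak_dbarD[OF assms(1)] weak_dbarD[OF assms(2)] test1_integrable
  by (simp add: loc_int_add distrib_right)

lemma weak_dbar_cmult:
  assumes "weak_dbar f f'"
  shows "weak_dbar (\<lambda>z. c * f z) (\<lambda>z. c * f' z)"
  unfolding weak_dbar_def
  using weak_dbarD[OF assms] by (simp add: loc_int_cmult mult.assoc)

lemma weak_dbar_diff:
  assumes "weak_dbar f f'" "weak_dbar g g'"
  shows "weak_dbar (\<lambda>z. f z - g z) (\<lambda>z. f' z - g' z)"
  using weak_dbar_add[OF assms(1) weak_dbar_cmult[OF assms(2), of "-1"]] by simp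

lemma AE_disk_indicator:
  assumes "AE z in lborel. z \<in> ball 0 1 \<longrightarrow> f z = g z"
  shows "AE z in lborel. \<forall>r<1. indicator (cball 0 r) z * f z = indicator (cball 0 r) z * (g z :: complex)"
  using assms by eventually_elim (auto simp: indicator_def)

lemma weak_dbar_cong_AE:
  assumes w: "weak_dbar f f'"
    and f: "AE z in lborel. z \<in> ball 0 1 \<longrightarrow> f z = g z" "g \<in> borel_measurable borel"
    and f': "AE z in lborel. z \<in> ball 0 1 \<longrightarrow> f' z = g' z" "g' \<in> borel_measurable borel"
  shows "weak_dbar g g'"
proof -
  note W = weak_dbarD[OF w]
  have loc: "loc_int h" if "loc_int k" "AE z in lborel. z \<in> ball 0 1 \<longrightarrow> k z = h z" "h \<in> borel_measurable borel" for h k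
    unfolding loc_int_def
  proof safe
    fix r :: real assume "r < 1"
    then show "integrable lborel (\<lambda>z. indicator (cball 0 r) z * h z)"
      using that(1) AE_disk_indicator[OF that(2)] that(3)
      by (subst integrable_cong_AE[of _ _ "\<lambda>z. indicator (cball 0 r) z * k z"]) (auto simp: loc_int_def elim: eventually_mono)
  qed fact
  have int: "(\<integral>z. k z * \<phi> z \<partial>lborel) = (\<integral>z. h z * \<phi> z \<partial>lborel)"
    if "AE z in lborel. z \<in> ball 0 1 \<longrightarrow> k z = h z" "h \<in> borel_measurable borel" "k \<in> borel_measurable borel"
      "r < 1" "continuous_on UNIV \<phi>" "\<And>z. norm z > r \<Longrightarrow> \<phi> z = 0" for h k \<phi> :: "complex \<Rightarrow> complex" and r
  proof (rule integral_cong_AE)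
    have m\<phi>: "\<phi> \<in> borel_measurable borel" by (rule borel_measurable_continuous_UNIV[OF that(5)])
    show "(\<lambda>z. k z * \<phi> z) \<in> borel_measurable lborel"
      unfolding measurable_lborel2 by (rule borel_measurable_times[OF that(3) m\<phi>])
    show "(\<lambda>z. h z * \<phi> z) \<in> borel_measurable lborel"
      unfolding measurable_lborel2 by (rule borel_measurable_times[OF that(2) m\<phi>])
    show "AE z in lborel. k z * \<phi> z = h z * \<phi> z"
      using that(1)
    proof eventually_elim
      case (elim z)
      then show ?case using that(4) that(6)[of z] by (cases "norm z < 1") auto
    qed
  qed
  note m = loc_int_measurable[OF W(1)] loc_int_measurable[OF W(2)]
  show ?thesis
    unfolding weak_dbar_def
  proof (intro conjI allI impI)
    show "loc_int g" by (rule loc[OF W(1) f])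
    show "loc_int g'" by (rule loc[OF W(2) f'])
    fix r \<phi> assume r: "r < (1::real)" and t: "test1 r \<phi>"
    then have t1: "times_differentiable 1 \<phi>" by (simp add: test1_def)
    have "(\<integral>z. f z * dbar \<phi> z \<partial>lborel) = (\<integral>z. g z * dbar \<phi> z \<partial>lborel)"
      by (rule int[OF f m(1) r continuous_dbar[OF t1] dbar_support[OF t]])
    moreover have "(\<integral>z. f' z * \<phi> z \<partial>lborel) = (\<integral>z. g' z * \<phi> z \<partial>lborel)"
      by (rule int[OF f' m(2) r times_differentiable_continuous[OF t1]]) (use t in \<open>auto simp: test1_def\<close>)
    ultimately show "(\<integral>z. g z * dbar \<phi> z \<partial>lborel) = - (\<integral>z. g' z * \<phi> z \<partial>lborel)"
      using W(3)[OF r t] by simp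
  qed
qed

text \<open>The localisation step: \<open>\<phi> * f\<close> has compact support and weak derivative
  \<open>\<phi> * f' + f * dbar \<phi>\<close>. The product of \<open>\<phi>\<close> with a
  translated \<open>ckernel\<close> is again a test function, and testing with it yields the
  hypothesis of \<open>eq_cauchy_transform\<close>.\<close>

lemma weak_dbar_test_mult:
  assumes w: "weak_dbar f f'" and r: "r < 1" and \<phi>: "test1 r \<phi>"
  shows "integrable lborel (\<lambda>z. \<phi> z * f z)" "integrable lborel (\<lambda>z. f z * dbar \<phi> z)" "integrable lborel (\<lambda>z. \<phi> z * f' z)"
    and "AE z in lborel. \<phi> z * f z = cauchy_transform (\<lambda>z. \<phi> z * f' z + f z * dbar \<phi> z) z"
proof -
  note W = weak_dbarD[OF w]
  show i: "integrable lborel (\<lambda>z. \<phi> z * f z)" "integrable lborel (\<lambda>z. f z * dbar \<phi> z)" "integrable lborel (\<lambda>z. \<phi> z * f' z)"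
    using test1_integrable[OF W(1) r \<phi>] test1_integrable[OF W(2) r \<phi>] by (simp_all add: mult.commute)
  show "AE z in lborel. \<phi> z * f z = cauchy_transform (\<lambda>z. \<phi> z * f' z + f z * dbar \<phi> z) z"
  proof (rule eq_cauchy_transform)
    fix \<epsilon> :: real and a :: complex assume "\<epsilon> > 0"
    let ?k = "\<lambda>z. ckernel \<epsilon> (z - a)"
    have td: "times_differentiable 1 ?k" using \<open>\<epsilon> > 0\<close> by (intro times_differentiable_ckernel) auto
    note tk = test1_mult[OF \<phi> td]
    have t\<phi>: "times_differentiable 1 \<phi>" using \<phi> by (simp add: test1_def)
    have d: "dbar (\<lambda>z. \<phi> z * ?k z) z = dbar \<phi> z * ?k z + \<phi> z * of_real (pkernel \<epsilon> (z - a))" for z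
      using dbar_mult[OF t\<phi> td] dbar_ckernel[of \<epsilon> a z] \<open>\<epsilon> > 0\<close> by simp
    have i1: "integrable lborel (\<lambda>z. f z * dbar (\<lambda>z. \<phi> z * ?k z) z)" by (rule test1_integrable[OF W(1) r tk])
    have i2: "integrable lborel (\<lambda>z. f z * (dbar \<phi> z * ?k z))"
    proof (rule loc_int_test_integrable[OF W(1) r])
      show "continuous_on UNIV (\<lambda>z. dbar \<phi> z * ?k z)"
        by (intro continuous_on_mult continuous_dbar[OF t\<phi>] times_differentiable_continuous[OF td])
    qed (use dbar_support[OF \<phi>] in auto)
    have i3: "integrable lborel (\<lambda>z. f' z * (\<phi> z * ?k z))" by (rule test1_integrable[OF W(2) r tk])
    have "(\<integral>z. \<phi> z * f z * of_real (pkernel \<epsilon> (z - a)) \<partial>lborel)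
        = (\<integral>z. f z * dbar (\<lambda>z. \<phi> z * ?k z) z - f z * (dbar \<phi> z * ?k z) \<partial>lborel)"
      by (simp add: d algebra_simps)
    also have "\<dots> = - (\<integral>z. f' z * (\<phi> z * ?k z) \<partial>lborel) - (\<integral>z. f z * (dbar \<phi> z * ?k z) \<partial>lborel)"
      using W(3)[OF r tk] i1 i2 by simp
    also have "\<dots> = - (\<integral>z. f' z * (\<phi> z * ?k z) + f z * (dbar \<phi> z * ?k z) \<partial>lborel)"
      using i2 i3 by simp
    finally show "(\<integral>z. \<phi> z * f z * of_real (pkernel \<epsilon> (z - a)) \<partial>lborel)
        = - (\<integral>z. (\<phi> z * f' z + f z * dbar \<phi> z) * ?k z \<partial>lborel)"
      by (simp add: algebra_simps)
  qed (use i in auto)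
qed

text \<open>Integration by parts: \<open>f * \<phi>\<close> has compact support, so its
  \<open>dbar\<close>-derivative has integral 0.\<close>

lemma weak_dbar_classical:
  assumes "times_differentiable 1 f"
  shows "weak_dbar f (dbar f)"
  unfolding weak_dbar_def
proof (intro conjI allI impI)
  show l: "loc_int f" "loc_int (dbar f)"
    by (intro loc_int_continuous times_differentiable_continuous[OF assms] continuous_dbar[OF assms])+
  fix r \<phi> assume r: "r < (1::real)" and t: "test1 r \<phi>"
  then have td: "times_differentiable 1 (\<lambda>z. f z * \<phi> z)" "times_differentiable 1 \<phi>"
    using assms by (auto simp: test1_def intro: times_differentiable_mult simp del: times_differentiable.simps)
  have "(\<integral>z. dbar (\<lambda>z. f z * \<phi> z) z \<partial>lborel) = 0"
    by (rule integral_dbar_eq_0(2)[OF td(1), of r]) (use t in \<open>auto simp: test1_def\<close>)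
  then have "(\<integral>z. dbar f z * \<phi> z + f z * dbar \<phi> z \<partial>lborel) = 0"
    by (simp add: dbar_mult[OF assms td(2)])
  then show "(\<integral>z. f z * dbar \<phi> z \<partial>lborel) = - (\<integral>z. dbar f z * \<phi> z \<partial>lborel)"
    using test1_integrable(1)[OF l(2) r t] test1_integrable(2)[OF l(1) r t]
    by (simp add: add_eq_0_iff)
qed

text \<open>A test function is almost everywhere the transform of its own
  \<open>dbar\<close>-derivative: apply \<open>weak_dbar_test_mult\<close> to the constant 1.
  Antisymmetry then moves the transform from \<open>H\<close> to \<open>dbar \<phi>\<close>.\<close>

lemma weak_dbar_cauchy_transform:
  assumes "bounded_data A H C"
  shows "weak_dbar (cauchy_transform H) H"
proof -
  interpret bounded_data A H C by fact
  have loc: "loc_int (\<lambda>z. g z * 1)" if "g \<in> borel_measurable borel" "\<And>z. norm (g z) \<le> M" for g M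
    by (rule loc_int_mult_bounded[OF loc_int_continuous[OF continuous_on_const]]) (use that in auto)
  show ?thesis
    unfolding weak_dbar_def
  proof (intro conjI allI impI)
    show "loc_int (cauchy_transform H)" "loc_int H"
      using loc[of "cauchy_transform H"] loc[of H] H(1) norm_cauchy_transform_le by auto
    fix r \<phi> assume r: "r < (1::real)" and t: "test1 r \<phi>"
    then have td: "times_differentiable 1 \<phi>" and supp: "\<And>z. norm z > r \<Longrightarrow> \<phi> z = 0" by (auto simp: test1_def simp del: times_differentiable.simps)
    have one: "times_differentiable 1 (\<lambda>_. 1)" by (rule times_differentiable_const)
    have "dbar (\<lambda>_::complex. 1) = (\<lambda>_. 0)" using dbar_eq_0(3)[of UNIV _ "\<lambda>_. 1" 1] by auto
    then have "AE z in lborel. \<phi> z = cauchy_transform (dbar \<phi>) z"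
      using weak_dbar_test_mult(4)[OF weak_dbar_classical[OF one] r t] by simp
    then have "(\<integral>y. H y * cauchy_transform (dbar \<phi>) y \<partial>lborel) = (\<integral>y. H y * \<phi> y \<partial>lborel)"
      using borel_measurable_continuous_UNIV[OF times_differentiable_continuous[OF td]]
        borel_measurable_continuous_UNIV[OF continuous_dbar[OF td]]
      by (intro integral_cong_AE) (auto elim: eventually_mono)
    then show "(\<integral>z. cauchy_transform H z * dbar \<phi> z \<partial>lborel) = - (\<integral>z. H z * \<phi> z \<partial>lborel)"
      using cauchy_transform_pairing(4)[OF integral_dbar_eq_0(1)[OF td supp]] by (simp add: mult.commute)
  qed
qed

subsection \<open>Product rule\<close>

text \<open>Near the support of \<open>\<phi>\<close> the factor \<open>a\<close> is the Cauchy transform \<open>T H\<close> of a bounded function, and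
  \<open>\<phi> f = T (\<phi> f' + f dbar \<phi>)\<close>. As \<open>T\<close> is antisymmetric,
  \<open>\<integral>T H f dbar \<phi> = - \<integral>H T (f dbar \<phi>) = - \<integral>H (\<phi> f - T (\<phi> f')) = - \<integral>H \<phi> f - \<integral>T H \<phi> f'\<close>.\<close>

lemma weak_dbar_mult:
  assumes a: "weak_dbar a a'" "\<And>z. norm z < 1 \<Longrightarrow> norm (a z) \<le> M" "\<And>z. norm z < 1 \<Longrightarrow> norm (a' z) \<le> M'"
    and f: "weak_dbar f f'"
  shows "weak_dbar (\<lambda>z. a z * f z) (\<lambda>z. a' z * f z + a z * f' z)"
proof -
  note Wa = weak_dbarD[OF a(1)] and Wf = weak_dbarD[OF f]
  note ma [measurable] = loc_int_measurable[OF Wa(1)] loc_int_measurable[OF Wa(2)]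
    loc_int_measurable[OF Wf(1)] loc_int_measurable[OF Wf(2)]
  show ?thesis
    unfolding weak_dbar_def
  proof (intro conjI allI impI)
    show l: "loc_int (\<lambda>z. a z * f z)" by (rule loc_int_mult_bounded[OF Wf(1) ma(1) a(2)])
    show l': "loc_int (\<lambda>z. a' z * f z + a z * f' z)"
      by (intro loc_int_add loc_int_mult_bounded[OF Wf(1) ma(2) a(3)] loc_int_mult_bounded[OF Wf(2) ma(1) a(2)])
    fix s \<phi> assume s: "s < (1::real)" and t': "test1 s \<phi>"
    \<comment> \<open>\<open>cutoff\<close> wants a positive inner radius, whereas \<open>s\<close>
      may be negative.\<close>
    define r where "r = max s (1/2)"
    have r: "r < 1" "0 < r" and t: "test1 r \<phi>" using s t' by (auto simp: r_def test1_def)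
    define r1 where "r1 = (r + 1) / 2"
    define r2 where "r2 = (r1 + 1) / 2"
    have r12: "r < r1" "0 < r1" "r1 < r2" "r2 < 1" using r by (auto simp: r1_def r2_def field_simps)
    define \<eta> where "\<eta> = cutoff r1 r2"
    have \<eta>t: "test1 r2 \<eta>" and \<eta>td: "times_differentiable 1 \<eta>"
      using times_differentiable_cutoff[OF r12(2,3)] cutoff_eq_0[OF r12(2,3)]
      by (auto simp: test1_def \<eta>_def simp del: times_differentiable.simps)
    have \<eta>1: "\<eta> z = 1" if "norm z \<le> r1" for z unfolding \<eta>_def by (rule cutoff_eq_1[OF r12(2,3) that])
    have d\<eta>: "dbar \<eta> z = 0" if "norm z < r1" for z
      by (rule dbar_eq_0(3)[of "ball 0 r1" _ _ 1]) (use that \<eta>1 in auto)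
    have \<phi>td: "times_differentiable 1 \<phi>" and supp: "\<And>z. norm z > r \<Longrightarrow> \<phi> z = 0"
      using t by (auto simp: test1_def simp del: times_differentiable.simps)
    define H where "H z = \<eta> z * a' z + a z * dbar \<eta> z" for z
    define X where "X z = f z * dbar \<phi> z" for z
    define Y where "Y z = \<phi> z * f' z" for z
    note [measurable] = borel_measurable_continuous_UNIV[OF times_differentiable_continuous[OF \<eta>td]]
      borel_measurable_continuous_UNIV[OF continuous_dbar[OF \<eta>td]]
      borel_measurable_continuous_UNIV[OF times_differentiable_continuous[OF \<phi>td]]
      borel_measurable_continuous_UNIV[OF continuous_dbar[OF \<phi>td]]
    have [measurable]: "H \<in> borel_measurable borel" "X \<in> borel_measurable borel" "Y \<in> borel_measurable borel"
      unfolding H_def[abs_def] X_def[abs_def] Y_def[abs_def] by measurable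
    have H0: "H z = 0" if "norm z > r2" for z
      using that dbar_support[OF \<eta>t] \<eta>t by (simp add: H_def test1_def)
    have "\<exists>C. \<forall>z. norm (H z) \<le> C"
    proof -
      obtain B where B: "\<And>z. norm z \<le> 1 \<Longrightarrow> norm (\<eta> z) \<le> B"
        using continuous_bounded_on_cball[OF times_differentiable_continuous[OF \<eta>td]] by blast
      obtain B' where B': "\<And>z. norm z \<le> 1 \<Longrightarrow> norm (dbar \<eta> z) \<le> B'"
        using continuous_bounded_on_cball[OF continuous_dbar[OF \<eta>td]] by blast
      have nn: "0 \<le> B" "0 \<le> B'" "0 \<le> M" "0 \<le> M'"
        using order_trans[OF norm_ge_zero B[of 0]] order_trans[OF norm_ge_zero B'[of 0]]
          order_trans[OF norm_ge_zero a(2)[of 0]] order_trans[OF norm_ge_zero a(3)[of 0]] by auto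
      have "norm (H z) \<le> B * M' + M * B'" for z
      proof (cases "norm z < 1")
        case True
        have "norm (\<eta> z * a' z) \<le> B * M'" "norm (a z * dbar \<eta> z) \<le> M * B'"
          unfolding norm_mult using True B[of z] B'[of z] a(2,3)[OF True] nn by (intro mult_mono; simp)+
        then show ?thesis unfolding H_def by (intro norm_triangle_le add_mono)
      next
        case False
        then show ?thesis using H0[of z] r12 nn by simp
      qed
      then show ?thesis by blast
    qed
    then obtain C where C: "\<And>z. norm (H z) \<le> C" by blast
    interpret bounded_data "cball 0 r2" H C
      by unfold_locales (use C H0 in auto)
    have C0: "C \<ge> 0" by (rule C_nonneg)
    have aH: "AE z in lborel. \<eta> z * a z = cauchy_transform H z"
      using weak_dbar_test_mult(4)[OF a(1) r12(4) \<eta>t] by (simp add: H_def[abs_def])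
    have iX: "integrable lborel X" and iY: "integrable lborel Y"
      and fXY: "AE z in lborel. \<phi> z * f z = cauchy_transform (\<lambda>z. Y z + X z) z"
      using weak_dbar_test_mult[OF f r(1) t] by (simp_all add: X_def[abs_def] Y_def[abs_def])
    \<comment> \<open>Taking the indicator as data turns the pairing lemma into convergence of the
      kernel integrals of \<open>X\<close> and \<open>Y\<close> at almost every \<open>y\<close> in
      the disk. Convergence justifies splitting the transform of \<open>Y + X\<close>, since a
      divergent Bochner integral has the default value 0.\<close>
    interpret I: bounded_data "cball 0 r2" "indicator (cball 0 r2)" 1
      by unfold_locales (auto simp: indicator_def)
    have HXY: "AE y in lborel. H y * cauchy_transform X y = H y * (\<phi> y * f y) - H y * cauchy_transform Y y"
      using fXY I.cauchy_transform_pairing(2)[OF iX] I.cauchy_transform_pairing(2)[OF iY]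
    proof eventually_elim
      case (elim y)
      show ?case
      proof (cases "norm y \<le> r2")
        case True
        then have "integrable lborel (\<lambda>x. X x * (1 / (y - x)))" "integrable lborel (\<lambda>x. Y x * (1 / (y - x)))"
          using elim(2,3) by auto
        then have "cauchy_transform (\<lambda>z. Y z + X z) y = cauchy_transform Y y + cauchy_transform X y"
          unfolding cauchy_transform_def distrib_right distrib_left[symmetric]
          by (intro arg_cong2[where f = "(*)"] Bochner_Integration.integral_add refl)
        then show ?thesis using elim(1) by (simp add: algebra_simps)
      qed (use H0 in auto)
    qed
    have iHf: "integrable lborel (\<lambda>z. H z * (\<phi> z * f z))"
    proof (rule Bochner_Integration.integrable_bound)
      show "integrable lborel (\<lambda>z. of_real C * (\<phi> z * f z))"
        by (rule integrable_mult_right[OF weak_dbar_test_mult(1)[OF f r(1) t]])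
      show "AE z in lborel. norm (H z * (\<phi> z * f z)) \<le> norm (of_real C * (\<phi> z * f z))"
        using C C0 by (auto simp: norm_mult intro!: mult_right_mono)
    qed measurable
    \<comment> \<open>On the support of \<open>\<phi>\<close> one has \<open>\<eta> = 1\<close> and
      \<open>dbar \<eta> = 0\<close>, because \<open>r < r1\<close>.\<close>
    have H_inner: "H z * \<phi> z = a' z * \<phi> z" for z
    proof (cases "norm z \<le> r")
      case True
      then show ?thesis using r12 \<eta>1[of z] d\<eta>[of z] by (simp add: H_def)
    qed (use supp in auto)
    have "(\<integral>z. a z * f z * dbar \<phi> z \<partial>lborel) = (\<integral>z. X z * cauchy_transform H z \<partial>lborel)"
    proof (rule integral_cong_AE)
      show "AE z in lborel. a z * f z * dbar \<phi> z = X z * cauchy_transform H z"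
        using aH
      proof eventually_elim
        case (elim z)
        show ?case
        proof (cases "norm z \<le> r")
          case True
          then show ?thesis using elim r12 \<eta>1[of z] by (simp add: X_def)
        next
          case False
          then show ?thesis using dbar_support[OF t, of z] by (simp add: X_def)
        qed
      qed
    qed measurable
    also have "\<dots> = - (\<integral>y. H y * cauchy_transform X y \<partial>lborel)" by (rule cauchy_transform_pairing(4)[OF iX])
    also have "(\<integral>y. H y * cauchy_transform X y \<partial>lborel) = (\<integral>y. H y * (\<phi> y * f y) - H y * cauchy_transform Y y \<partial>lborel)"
      by (rule integral_cong_AE[OF _ _ HXY]) measurable
    also have "\<dots> = (\<integral>y. H y * (\<phi> y * f y) \<partial>lborel) - (\<integral>y. H y * cauchy_transform Y y \<partial>lborel)"
      by (rule Bochner_Integration.integral_diff[OF iHf cauchy_transform_pairing(3)[OF iY]])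
    also have "(\<integral>y. H y * cauchy_transform Y y \<partial>lborel) = - (\<integral>x. Y x * cauchy_transform H x \<partial>lborel)"
      using cauchy_transform_pairing(4)[OF iY] by simp
    also have "(\<integral>x. Y x * cauchy_transform H x \<partial>lborel) = (\<integral>z. a z * f' z * \<phi> z \<partial>lborel)"
    proof (rule integral_cong_AE)
      show "AE z in lborel. Y z * cauchy_transform H z = a z * f' z * \<phi> z"
        using aH
      proof eventually_elim
        case (elim z)
        show ?case
        proof (cases "norm z \<le> r")
          case True
          then show ?thesis using elim r12 \<eta>1[of z] by (simp add: Y_def)
        next
          case False
          then show ?thesis using supp by (simp add: Y_def)
        qed
      qed
    qed measurable
    also have "(\<integral>y. H y * (\<phi> y * f y) \<partial>lborel) = (\<integral>z. a' z * f z * \<phi> z \<partial>lborel)"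
      by (intro Bochner_Integration.integral_cong) (auto simp: mult.assoc[symmetric] H_inner)
    finally show "(\<integral>z. a z * f z * dbar \<phi> z \<partial>lborel) = - (\<integral>z. (a' z * f z + a z * f' z) * \<phi> z \<partial>lborel)"
      using test1_integrable(1)[OF loc_int_mult_bounded[OF Wf(1) ma(2) a(3)] r(1) t]
        test1_integrable(1)[OF loc_int_mult_bounded[OF Wf(2) ma(1) a(2)] r(1) t]
      by (simp add: distrib_right)
  qed
qed

subsection \<open>Uniqueness, exponentials and holomorphy\<close>

lemma AE_disk_exhaust:
  assumes "\<And>r. 0 < r \<Longrightarrow> r < 1 \<Longrightarrow> AE z in lborel. norm (z::complex) < r \<longrightarrow> P z"
  shows "AE z in lborel. z \<in> ball 0 1 \<longrightarrow> P z"
proof -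
  have "AE z in lborel. \<forall>n::nat. norm (z::complex) < 1 - 1 / (real n + 2) \<longrightarrow> P z"
    unfolding AE_all_countable
  proof
    fix n :: nat
    show "AE z in lborel. norm (z::complex) < 1 - 1 / (real n + 2) \<longrightarrow> P z"
      by (rule assms) (auto simp: field_simps)
  qed
  then show ?thesis
  proof eventually_elim
    case (elim z)
    show ?case
    proof
      assume "z \<in> ball 0 1"
      then have "1 - norm z > 0" by simp
      then obtain n where n: "inverse (real (Suc n)) < 1 - norm z" using reals_Archimedean by blast
      have "1 / (real n + 2) \<le> inverse (real (Suc n))" by (simp add: field_simps)
      with n elim show "P z" by (smt (verit))
    qed
  qed
qed

text \<open>A nonempty open set is not negligible; this is applied to the set where the two
  functions differ.\<close>

lemma AE_eq_continuous:
  fixes f g :: "complex \<Rightarrow> complex"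
  assumes ae: "AE z in lborel. z \<in> S \<longrightarrow> f z = g z" and S: "open S"
    and f: "continuous_on S f" and g: "continuous_on S g" and z: "z \<in> S"
  shows "f z = g z"
proof -
  let ?U = "S \<inter> (\<lambda>z. f z - g z) -` (- {0})"
  have U: "open ?U" by (intro continuous_open_preimage continuous_intros f g S)
  have "AE z in lborel. z \<notin> ?U" using ae by eventually_elim auto
  then have "AE z in lebesgue. z \<notin> ?U" by (rule AE_completion)
  moreover have "?U \<in> sets lebesgue" using borel_open[OF U] by simp
  ultimately have "?U \<in> null_sets lebesgue" using AE_iff_null_sets by blast
  then have "?U = {}" using open_not_negligible[OF U] by (auto simp: negligible_iff_null_sets)
  then show ?thesis using z by auto
qed

lemma times_differentiable_pkernel:
  assumes "\<epsilon> > 0"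
  shows "times_differentiable 1 (\<lambda>z. complex_of_real (pkernel \<epsilon> (z - a)))"
proof -
  have pos: "s + \<epsilon>\<^sup>2 \<noteq> 0" if "s \<ge> 0" for s using assms that by (smt (verit) zero_less_power2)
  show ?thesis
    unfolding pkernel_def
  proof (rule times_differentiable_radial(1))
    show "((\<lambda>s. \<epsilon>\<^sup>2 / (s + \<epsilon>\<^sup>2)\<^sup>2) has_real_derivative (0 * (s + \<epsilon>\<^sup>2)\<^sup>2 - \<epsilon>\<^sup>2 * (2 * (s + \<epsilon>\<^sup>2))) / ((s + \<epsilon>\<^sup>2)\<^sup>2 * (s + \<epsilon>\<^sup>2)\<^sup>2)) (at s)"
      if "s \<ge> 0" for s
      using pos[OF that] by (auto intro!: derivative_eq_intros)
    show "continuous_on {0..} (\<lambda>s. (0 * (s + \<epsilon>\<^sup>2)\<^sup>2 - \<epsilon>\<^sup>2 * (2 * (s + \<epsilon>\<^sup>2))) / ((s + \<epsilon>\<^sup>2)\<^sup>2 * (s + \<epsilon>\<^sup>2)\<^sup>2))"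
      using pos by (auto intro!: continuous_intros)
  qed
qed

lemma cutoff_test1:
  assumes "0 < r" "r < 1"
  obtains r2 \<eta> where "r2 < 1" "test1 r2 \<eta>" "\<And>z. norm z \<le> r \<Longrightarrow> \<eta> z = 1" "\<And>z. norm z < r \<Longrightarrow> dbar \<eta> z = 0"
proof
  let ?R = "(r + 1) / 2"
  have R: "r < ?R" "?R < 1" using assms by auto
  show "?R < 1" by fact
  show "test1 ?R (cutoff r ?R)"
    using times_differentiable_cutoff[OF assms(1) R(1)] cutoff_eq_0[OF assms(1) R(1)]
    by (auto simp: test1_def simp del: times_differentiable.simps)
  show 1: "cutoff r ?R z = 1" if "norm z \<le> r" for z by (rule cutoff_eq_1[OF assms(1) R(1) that])
  show "dbar (cutoff r ?R) z = 0" if "norm z < r" for z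
    by (rule dbar_eq_0(3)[of "ball 0 r" _ _ 1]) (use that 1 in auto)
qed

text \<open>The difference \<open>g - h\<close> is a weak derivative of 0, hence orthogonal to every
  translate of \<open>pkernel\<close> times a cutoff. So \<open>eq_cauchy_transform\<close> applies
  with zero data, and the transform of 0 is 0.\<close>

lemma weak_dbar_unique:
  assumes "weak_dbar f g" "weak_dbar f h"
  shows "AE z in lborel. z \<in> ball 0 1 \<longrightarrow> g z = h z"
proof (rule AE_disk_exhaust)
  fix r :: real assume r: "0 < r" "r < 1"
  from cutoff_test1[OF this] obtain r2 \<eta> where \<eta>: "r2 < 1" "test1 r2 \<eta>" "\<And>z. norm z \<le> r \<Longrightarrow> \<eta> z = 1" by metis
  let ?d = "\<lambda>z. g z - h z"
  have w: "weak_dbar (\<lambda>z. 0) ?d" using weak_dbar_diff[OF assms] by simp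
  have "AE z in lborel. \<eta> z * ?d z = cauchy_transform (\<lambda>_. 0) z"
  proof (rule eq_cauchy_transform)
    show "integrable lborel (\<lambda>z. \<eta> z * ?d z)"
      using test1_integrable(1)[OF weak_dbarD(2)[OF w] \<eta>(1,2)] by (simp add: mult.commute)
    fix \<epsilon> :: real and a :: complex assume "\<epsilon> > 0"
    from weak_dbarD(3)[OF w \<eta>(1) test1_mult[OF \<eta>(2) times_differentiable_pkernel[OF this]]]
    have "(\<integral>z. ?d z * (\<eta> z * of_real (pkernel \<epsilon> (z - a))) \<partial>lborel) = 0" by simp
    then show "(\<integral>z. \<eta> z * ?d z * of_real (pkernel \<epsilon> (z - a)) \<partial>lborel) = - (\<integral>z. 0 * ckernel \<epsilon> (z - a) \<partial>lborel)"
      by (simp add: mult_ac)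
  qed auto
  then show "AE z in lborel. norm z < r \<longrightarrow> g z = h z"
    by eventually_elim (use \<eta>(3) in \<open>auto simp: cauchy_transform_def\<close>)
qed

lemma weak_dbar_const: "weak_dbar (\<lambda>_. c) (\<lambda>_. 0)"
proof -
  have "dbar (\<lambda>_::complex. c) = (\<lambda>_. 0)" using dbar_eq_0(3)[of UNIV _ "\<lambda>_. c" c] by auto
  then show ?thesis using weak_dbar_classical[OF times_differentiable_const[of 1 c]] by simp
qed

lemma weak_dbar_power:
  assumes \<psi>: "weak_dbar \<psi> \<psi>'" "\<And>z. norm z < 1 \<Longrightarrow> norm (\<psi> z) \<le> M" "\<And>z. norm z < 1 \<Longrightarrow> norm (\<psi>' z) \<le> M'"
  shows "weak_dbar (\<lambda>z. \<psi> z ^ Suc k) (\<lambda>z. of_nat (Suc k) * \<psi> z ^ k * \<psi>' z)"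
proof (induction k)
  case (Suc k)
  have "weak_dbar (\<lambda>z. \<psi> z * \<psi> z ^ Suc k) (\<lambda>z. \<psi>' z * \<psi> z ^ Suc k + \<psi> z * (of_nat (Suc k) * \<psi> z ^ k * \<psi>' z))"
    by (rule weak_dbar_mult[OF \<psi> Suc])
  then show ?case by (simp add: algebra_simps)
qed (use \<psi>(1) in simp)

text \<open>The partial sums of the exponential series satisfy
  \<open>dbar (S (Suc N)) = \<psi>' * S N\<close> weakly and are bounded by \<open>exp M\<close> on
  the disk, so the weak equation passes to the limit by dominated convergence.\<close>

lemma weak_dbar_exp:
  assumes \<psi>: "weak_dbar \<psi> \<psi>'" "\<And>z. norm z < 1 \<Longrightarrow> norm (\<psi> z) \<le> M" "\<And>z. norm z < 1 \<Longrightarrow> norm (\<psi>' z) \<le> M'"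
  shows "weak_dbar (\<lambda>z. exp (\<psi> z)) (\<lambda>z. \<psi>' z * exp (\<psi> z))"
proof -
  note [measurable] = loc_int_measurable[OF weak_dbarD(1)[OF \<psi>(1)]] loc_int_measurable[OF weak_dbarD(2)[OF \<psi>(1)]]
  note pow = weak_dbar_power[OF \<psi>]
  define S where "S N z = (\<Sum>k<N. \<psi> z ^ k / fact k)" for N z
  have S: "weak_dbar (S (Suc N)) (\<lambda>z. \<psi>' z * S N z)" for N
  proof (induction N)
    case 0
    then show ?case using weak_dbar_const[of 1] by (simp add: S_def[abs_def])
  next
    case (Suc N)
    have "weak_dbar (\<lambda>z. S (Suc N) z + (1 / fact (Suc N)) * \<psi> z ^ Suc N)
        (\<lambda>z. \<psi>' z * S N z + (1 / fact (Suc N)) * (of_nat (Suc N) * \<psi> z ^ N * \<psi>' z))"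
      by (intro weak_dbar_add Suc weak_dbar_cmult pow)
    moreover have "(1 / fact (Suc N)) * (of_nat (Suc N) * x) = x / fact N" for x :: complex
      unfolding fact_Suc by (simp del: of_nat_Suc)
    then have "(1 / fact (Suc N)) * (of_nat (Suc N) * \<psi> z ^ N * \<psi>' z) = \<psi>' z * (\<psi> z ^ N / fact N)" for z
      by (simp only: mult.assoc) (simp add: mult.commute)
    ultimately show ?case
      by (simp add: S_def[abs_def] distrib_left del: fact_Suc of_nat_Suc power_Suc)
  qed
  have S_lim: "(\<lambda>N. S N z) \<longlonglongrightarrow> exp (\<psi> z)" for z
    using exp_converges[of "\<psi> z"] by (simp add: sums_def S_def scaleR_conv_of_real field_simps)
  have S_le: "norm (S N z) \<le> exp M" if "norm z < 1" for N z
  proof -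
    have M: "0 \<le> M" using \<psi>(2)[OF that] norm_ge_zero order_trans by blast
    have "norm (S N z) \<le> (\<Sum>k<N. M ^ k /\<^sub>R fact k)"
      unfolding S_def using \<psi>(2)[OF that]
    proof (intro order_trans[OF norm_sum] sum_mono)
      fix k
      have "norm (\<psi> z ^ k / fact k) = norm (\<psi> z) ^ k / fact k" by (simp add: norm_divide norm_power)
      also have "\<dots> \<le> M ^ k / fact k" using \<psi>(2)[OF that] by (intro divide_right_mono power_mono) auto
      finally show "norm (\<psi> z ^ k / fact k) \<le> M ^ k /\<^sub>R fact k" by (simp add: divide_inverse mult.commute)
    qed
    also have "\<dots> \<le> exp M"
      unfolding exp_def using M summable_exp_generic[of M] by (intro sum_le_suminf) auto
    finally show ?thesis .
  qed
  have S_meas [measurable]: "S N \<in> borel_measurable borel" for N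
    unfolding S_def[abs_def] by measurable
  have loc1: "loc_int (\<lambda>z. exp (\<psi> z))"
  proof -
    have "loc_int (\<lambda>z. exp (\<psi> z) * 1)"
    proof (rule loc_int_mult_bounded[OF loc_int_continuous[OF continuous_on_const]])
      show "norm (exp (\<psi> z)) \<le> exp M" if "norm z < 1" for z
        using \<psi>(2)[OF that] norm_exp[of "\<psi> z"] by (meson exp_le_cancel_iff order_trans)
    qed measurable
    then show ?thesis by simp
  qed
  have loc2: "loc_int (\<lambda>z. \<psi>' z * exp (\<psi> z))"
    by (rule loc_int_mult_bounded[OF loc1 _ \<psi>(3)]) measurable
  show ?thesis
    unfolding weak_dbar_def
  proof (intro conjI loc1 loc2 allI impI)
    fix r \<phi> assume r: "r < (1::real)" and t: "test1 r \<phi>"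
    then have td: "times_differentiable 1 \<phi>" and supp: "\<And>z. norm z > r \<Longrightarrow> \<phi> z = 0" by (auto simp: test1_def simp del: times_differentiable.simps)
    note [measurable] = borel_measurable_continuous_UNIV[OF times_differentiable_continuous[OF td]]
      borel_measurable_continuous_UNIV[OF continuous_dbar[OF td]]
    have one': "loc_int (\<lambda>_. 1)" by (rule loc_int_continuous[OF continuous_on_const])
    have i: "integrable lborel \<phi>" "integrable lborel (dbar \<phi>)" using test1_integrable[OF one' r t] by simp_all
    have l1: "(\<lambda>N. \<integral>z. S (Suc N) z * dbar \<phi> z \<partial>lborel) \<longlonglongrightarrow> (\<integral>z. exp (\<psi> z) * dbar \<phi> z \<partial>lborel)"
    proof (rule integral_dominated_convergence[where w = "\<lambda>z. exp M * norm (dbar \<phi> z)"])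
      show "AE z in lborel. (\<lambda>N. S (Suc N) z * dbar \<phi> z) \<longlonglongrightarrow> exp (\<psi> z) * dbar \<phi> z"
        by (intro always_eventually allI tendsto_mult tendsto_const LIMSEQ_Suc S_lim)
      show "AE z in lborel. norm (S (Suc N) z * dbar \<phi> z) \<le> exp M * norm (dbar \<phi> z)" for N
      proof (intro always_eventually allI)
        fix z show "norm (S (Suc N) z * dbar \<phi> z) \<le> exp M * norm (dbar \<phi> z)"
          using S_le[of z "Suc N"] dbar_support[OF t, of z] r
          by (cases "norm z < 1") (auto simp: norm_mult intro!: mult_right_mono)
      qed
    qed (use i in auto)
    have l2: "(\<lambda>N. \<integral>z. \<psi>' z * S N z * \<phi> z \<partial>lborel) \<longlonglongrightarrow> (\<integral>z. \<psi>' z * exp (\<psi> z) * \<phi> z \<partial>lborel)"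
    proof (rule integral_dominated_convergence[where w = "\<lambda>z. (M' * exp M) * norm (\<phi> z)"])
      show "AE z in lborel. (\<lambda>N. \<psi>' z * S N z * \<phi> z) \<longlonglongrightarrow> \<psi>' z * exp (\<psi> z) * \<phi> z"
        by (intro always_eventually allI tendsto_mult tendsto_const S_lim)
      show "AE z in lborel. norm (\<psi>' z * S N z * \<phi> z) \<le> (M' * exp M) * norm (\<phi> z)" for N
      proof (intro always_eventually allI)
        fix z show "norm (\<psi>' z * S N z * \<phi> z) \<le> (M' * exp M) * norm (\<phi> z)"
        proof (cases "norm z < 1")
          case True
          then have "norm (\<psi>' z * S N z) \<le> M' * exp M"
            unfolding norm_mult using \<psi>(3)[OF True] S_le[OF True, of N] order_trans[OF norm_ge_zero \<psi>(3)[OF True]]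
            by (intro mult_mono) auto
          then show ?thesis unfolding norm_mult[of _ "\<phi> z"] by (intro mult_right_mono) auto
        next
          case False
          then show ?thesis using supp[of z] r by simp
        qed
      qed
    qed (use i in auto)
    show "(\<integral>z. exp (\<psi> z) * dbar \<phi> z \<partial>lborel) = - (\<integral>z. \<psi>' z * exp (\<psi> z) * \<phi> z \<partial>lborel)"
      using LIMSEQ_unique[OF l1] tendsto_minus[OF l2] weak_dbarD(3)[OF S r t] by simp
  qed
qed

text \<open>The kernel is expanded in powers of \<open>w / z\<close>. Where \<open>X z\<close> is
  nonzero, \<open>norm z\<close> is at least \<open>r\<close>, so the terms are dominated by those
  of a geometric series with ratio \<open>norm w / r < 1\<close>, and sum and integral may be
  exchanged.\<close>

lemma holomorphic_cauchy_transform: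
  assumes X: "integrable lborel X" and 0: "\<And>z. norm z < r \<Longrightarrow> X z = 0" and r: "r > 0"
  shows "cauchy_transform X holomorphic_on ball 0 r"
proof (rule power_series_holomorphic)
  have [measurable]: "X \<in> borel_measurable borel" using X by auto
  fix w :: complex assume w: "w \<in> ball 0 r"
  \<comment> \<open>The minus sign comes from
    \<open>1 / (w - z) = - (\<Sum>n. w ^ n / z ^ Suc n)\<close>.\<close>
  define a where "a n = - (1 / of_real pi) * (\<integral>z. X z / z ^ Suc n \<partial>lborel)" for n
  let ?q = "norm w / r"
  have q: "0 \<le> ?q" "?q < 1" using w r by auto
  have le: "norm (X z / z ^ Suc n * w ^ n) \<le> norm (X z) * (?q ^ n / r)" for n z
  proof (cases "norm z < r")
    case False
    then have z: "norm z \<ge> r" by simp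
    then have "norm w ^ n / norm z ^ Suc n \<le> norm w ^ n / r ^ Suc n"
      using r by (intro divide_left_mono power_mono mult_pos_pos zero_less_power) auto
    also have "\<dots> = ?q ^ n / r" by (simp add: power_divide)
    finally show ?thesis
      unfolding norm_mult norm_divide norm_power
      using mult_left_mono[of "norm w ^ n / norm z ^ Suc n" "?q ^ n / r" "norm (X z)"] by simp
  qed (use 0 in auto)
  have i: "integrable lborel (\<lambda>z. X z / z ^ Suc n * w ^ n)" for n
  proof (rule Bochner_Integration.integrable_bound)
    show "integrable lborel (\<lambda>z. norm (X z) * (?q ^ n / r))" using X by simp
    show "AE z in lborel. norm (X z / z ^ Suc n * w ^ n) \<le> norm (norm (X z) * (?q ^ n / r))"
      unfolding real_norm_def by (intro always_eventually allI order_trans[OF le abs_ge_self])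
    have "(\<lambda>z. X z / z ^ Suc n * w ^ n) \<in> borel_measurable borel"
      by (intro borel_measurable_times borel_measurable_divide borel_measurable_power borel_measurable_const) auto
    then show "(\<lambda>z. X z / z ^ Suc n * w ^ n) \<in> borel_measurable lborel" unfolding measurable_lborel2 .
  qed
  have sq: "summable (\<lambda>n. c * (?q ^ n / r))" for c
    using q by (intro summable_mult summable_divide summable_geometric) auto
  have "(\<lambda>n. \<integral>z. X z / z ^ Suc n * w ^ n \<partial>lborel) sums (\<integral>z. (\<Sum>n. X z / z ^ Suc n * w ^ n) \<partial>lborel)"
  proof (rule sums_integral[OF i])
    show "AE z in lborel. summable (\<lambda>n. norm (X z / z ^ Suc n * w ^ n))"
      by (intro always_eventually allI summable_comparison_test'[OF sq]) (use le in auto)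
    show "summable (\<lambda>n. \<integral>z. norm (X z / z ^ Suc n * w ^ n) \<partial>lborel)"
    proof (rule summable_comparison_test'[OF sq])
      fix n
      have "norm (\<integral>z. norm (X z / z ^ Suc n * w ^ n) \<partial>lborel) = (\<integral>z. norm (X z / z ^ Suc n * w ^ n) \<partial>lborel)"
        by (simp add: integral_nonneg_AE)
      also have "\<dots> \<le> (\<integral>z. norm (X z) * (?q ^ n / r) \<partial>lborel)"
        by (rule integral_mono) (use i X le in auto)
      also have "\<dots> = (\<integral>z. norm (X z) \<partial>lborel) * (?q ^ n / r)" by simp
      finally show "norm (\<integral>z. norm (X z / z ^ Suc n * w ^ n) \<partial>lborel) \<le> (\<integral>z. norm (X z) \<partial>lborel) * (?q ^ n / r)" .
    qed
  qed
  also have "(\<integral>z. (\<Sum>n. X z / z ^ Suc n * w ^ n) \<partial>lborel) = (\<integral>z. - (X z * (1 / (w - z))) \<partial>lborel)"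
  proof (intro Bochner_Integration.integral_cong refl)
    fix z
    show "(\<Sum>n. X z / z ^ Suc n * w ^ n) = - (X z * (1 / (w - z)))"
    proof (cases "norm z < r")
      case False
      then have z: "z \<noteq> 0" "norm (w / z) < 1" "w \<noteq> z" using w r by (auto simp: norm_divide divide_simps)
      have sums: "(\<lambda>n. X z / z * (w / z) ^ n) sums (X z / z * (1 / (1 - w / z)))"
        by (intro sums_mult geometric_sums z)
      have terms: "(\<lambda>n. X z / z * (w / z) ^ n) = (\<lambda>n. X z / z ^ Suc n * w ^ n)"
        by (simp add: fun_eq_iff power_divide)
      have "z * (1 - w / z) = z - w" using z by (simp add: right_diff_distrib)
      then have "X z / z * (1 / (1 - w / z)) = X z / (z - w)" by (metis divide_divide_eq_left mult.right_neutral times_divide_eq_right)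
      also have "\<dots> = - (X z * (1 / (w - z)))"
        by (metis minus_diff_eq minus_divide_right times_divide_eq_right mult.right_neutral)
      finally show ?thesis using sums unfolding terms by (metis sums_unique)
    qed (use 0 in auto)
  qed
  finally have "(\<lambda>n. - (1 / of_real pi) * (\<integral>z. X z / z ^ Suc n * w ^ n \<partial>lborel)) sums (- (1 / of_real pi) * (\<integral>z. - (X z * (1 / (w - z))) \<partial>lborel))"
    by (rule sums_mult)
  moreover have "(\<integral>z. X z / z ^ Suc n * w ^ n \<partial>lborel) = (\<integral>z. X z / z ^ Suc n \<partial>lborel) * w ^ n" for n
    by (rule integral_mult_left_zero)
  moreover have "(\<integral>z. - (X z * (1 / (w - z))) \<partial>lborel) = - (\<integral>z. X z * (1 / (w - z)) \<partial>lborel)"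
    by (rule Bochner_Integration.integral_minus)
  ultimately show "(\<lambda>n. a n * (w - 0) ^ n) sums cauchy_transform X w"
    unfolding a_def cauchy_transform_def by (simp only: diff_zero mult.assoc minus_mult_minus minus_mult_left[symmetric] minus_mult_right[symmetric] minus_minus)
qed

text \<open>Weyl's lemma. A cutoff \<open>\<eta>\<close> that is 1 on a disk makes
  \<open>\<eta> * f\<close> the transform of \<open>f * dbar \<eta>\<close>. This density vanishes
  inside the disk, so the transform is holomorphic there. The functions found for different radii
  agree by continuity and are glued.\<close>

lemma weak_dbar_0_holomorphic:
  assumes "weak_dbar f (\<lambda>_. 0)"
  shows "\<exists>h. h holomorphic_on ball 0 1 \<and> (AE z in lborel. z \<in> ball 0 1 \<longrightarrow> f z = h z)"
proof -
  have "\<exists>h. h holomorphic_on ball 0 r \<and> (AE z in lborel. z \<in> ball 0 r \<longrightarrow> f z = h z)" if r: "0 < r" "r < 1" for r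
  proof -
    from cutoff_test1[OF r] obtain r2 \<eta> where \<eta>: "r2 < 1" "test1 r2 \<eta>" "\<And>z. norm z \<le> r \<Longrightarrow> \<eta> z = 1" "\<And>z. norm z < r \<Longrightarrow> dbar \<eta> z = 0"
      by metis
    have "AE z in lborel. \<eta> z * f z = cauchy_transform (\<lambda>z. f z * dbar \<eta> z) z"
      using weak_dbar_test_mult(4)[OF assms \<eta>(1,2)] by simp
    then have "AE z in lborel. z \<in> ball 0 r \<longrightarrow> f z = cauchy_transform (\<lambda>z. f z * dbar \<eta> z) z"
      by eventually_elim (use \<eta>(3) in auto)
    moreover have "cauchy_transform (\<lambda>z. f z * dbar \<eta> z) holomorphic_on ball 0 r"
      by (rule holomorphic_cauchy_transform[OF weak_dbar_test_mult(2)[OF assms \<eta>(1,2)]]) (use \<eta>(4) r in auto)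
    ultimately show ?thesis by blast
  qed
  then obtain H where H: "\<And>r. 0 < r \<Longrightarrow> r < 1 \<Longrightarrow> H r holomorphic_on ball 0 r"
      "\<And>r. 0 < r \<Longrightarrow> r < 1 \<Longrightarrow> AE z in lborel. z \<in> ball 0 r \<longrightarrow> f z = H r z"
    by metis
  have HH: "H r z = H s z" if rs: "0 < r" "r \<le> s" "s < 1" and z: "z \<in> ball 0 r" for r s z
  proof (rule AE_eq_continuous[OF _ open_ball _ _ z])
    have sub: "ball 0 r \<subseteq> (ball 0 s :: complex set)" using rs by auto
    show "AE z in lborel. z \<in> ball 0 r \<longrightarrow> H r z = H s z"
      using H(2)[of r] H(2)[of s] rs sub by (auto elim!: eventually_elim2)
    show "continuous_on (ball 0 r) (H r)" using H(1)[of r] rs by (intro holomorphic_on_imp_continuous_on) auto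
    show "continuous_on (ball 0 r) (H s)"
      using H(1)[of s] rs sub by (intro holomorphic_on_imp_continuous_on holomorphic_on_subset[OF _ sub]) auto
  qed
  \<comment> \<open>This radius lies strictly between \<open>norm z\<close> and 1; the next fact
    shows that every other admissible radius gives the same value.\<close>
  define h where "h z = H ((norm z + 1) / 2) z" for z
  have h: "h z = H r z" if "0 < r" "r < 1" "z \<in> ball 0 r" for r z
  proof (cases "(norm z + 1) / 2 \<le> r")
    case True
    then show ?thesis unfolding h_def using that by (intro HH) (auto intro: add_nonneg_pos)
  next
    case False
    then show ?thesis unfolding h_def using that by (intro HH[symmetric]) auto
  qed
  have "h holomorphic_on ball 0 1"
    unfolding holomorphic_on_def
  proof
    fix z :: complex assume z: "z \<in> ball 0 1"
    let ?r = "(norm z + 1) / 2"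
    have r: "0 < ?r" "?r < 1" "z \<in> ball 0 ?r" using z by (auto intro: add_nonneg_pos)
    have "H ?r field_differentiable at z"
      using H(1)[OF r(1,2)] r(3) by (auto simp: holomorphic_on_def at_within_open[OF _ open_ball])
    then have "h field_differentiable at z"
      unfolding field_differentiable_def
      using has_field_derivative_transform_within_open[OF _ open_ball r(3), of "H ?r" _ h] h[OF r(1,2)] by metis
    then show "h field_differentiable at z within ball 0 1"
      using field_differentiable_at_within by blast
  qed
  moreover have "AE z in lborel. z \<in> ball 0 1 \<longrightarrow> f z = h z"
  proof (rule AE_disk_exhaust)
    fix r :: real assume r: "0 < r" "r < 1"
    from H(2)[OF this] show "AE z in lborel. norm z < r \<longrightarrow> f z = h z"
      by eventually_elim (use h[OF r] in auto)
  qed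
  ultimately show ?thesis by blast
qed

subsection \<open>Mollification\<close>

definition mollify :: "real \<Rightarrow> (complex \<Rightarrow> complex) \<Rightarrow> complex \<Rightarrow> complex" where
  "mollify \<epsilon> f z = (1 / (\<integral>t. bump \<epsilon> t \<partial>lborel)) * (\<integral>t. bump \<epsilon> t * f (z - t) \<partial>lborel)"

definition real_bump :: "real \<Rightarrow> complex \<Rightarrow> real" where
  "real_bump \<epsilon> z = flat 0 (\<epsilon>\<^sup>2 - (norm z)\<^sup>2)"

lemma bump_eq_real_bump: "bump \<epsilon> z = of_real (real_bump \<epsilon> z)" "real_bump \<epsilon> z \<ge> 0" "real_bump \<epsilon> z = Re (bump \<epsilon> z)"
  by (auto simp: bump_def real_bump_def flat_def)

lemma times_differentiable_bump: "times_differentiable k (bump \<epsilon>)"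
  using smooth_bump by (simp add: smooth_def)

lemma continuous_bump: "continuous_on S (bump \<epsilon>)"
  by (rule times_differentiable_continuous[OF times_differentiable_bump])

lemma real_bump_integral:
  assumes "\<epsilon> > 0"
  shows "integrable lborel (real_bump \<epsilon>)" "(\<integral>t. real_bump \<epsilon> t \<partial>lborel) > 0" "(\<integral>t. bump \<epsilon> t \<partial>lborel) = of_real (\<integral>t. real_bump \<epsilon> t \<partial>lborel)"
proof -
  have "integrable lborel (bump \<epsilon>)"
    by (rule has_compact_support_integrable(1)[OF continuous_bump, of \<epsilon>]) (use assms in \<open>auto intro!: bump_eq_0\<close>)
  then have "integrable lborel (\<lambda>z. Re (bump \<epsilon> z))" by (rule integrable_Re)
  moreover have "(\<lambda>z. Re (bump \<epsilon> z)) = real_bump \<epsilon>" by (rule ext) (rule bump_eq_real_bump(3)[symmetric])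
  ultimately show i: "integrable lborel (real_bump \<epsilon>)" by simp
  show "(\<integral>t. bump \<epsilon> t \<partial>lborel) = of_real (\<integral>t. real_bump \<epsilon> t \<partial>lborel)"
    unfolding bump_eq_real_bump(1) by (rule integral_complex_of_real)
  have "(\<integral>t. real_bump \<epsilon> t \<partial>lborel) \<noteq> 0"
  proof
    assume "(\<integral>t. real_bump \<epsilon> t \<partial>lborel) = 0"
    then have "AE t in lborel. real_bump \<epsilon> t = 0"
      using integral_nonneg_eq_0_iff_AE[OF i] bump_eq_real_bump(2) by auto
    then have ae: "AE t in lborel. t \<in> UNIV \<longrightarrow> bump \<epsilon> t = 0" by eventually_elim (simp add: bump_eq_real_bump(1))
    have "bump \<epsilon> 0 = 0"
      by (rule AE_eq_continuous[OF ae]) (auto intro: continuous_bump continuous_on_const)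
    then show False using assms by (simp add: bump_def flat_def)
  qed
  moreover have "(\<integral>t. real_bump \<epsilon> t \<partial>lborel) \<ge> 0" by (rule integral_nonneg_AE) (simp add: bump_eq_real_bump(2))
  ultimately show "(\<integral>t. real_bump \<epsilon> t \<partial>lborel) > 0" by simp
qed

text \<open>\<open>mollify\<close> averages against a nonnegative weight of total mass 1. The case
  \<open>c = 0\<close> gives the uniform bound, the case \<open>c = f z\<close> the
  convergence.\<close>

lemma mollify_diff_le:
  assumes \<epsilon>: "\<epsilon> > 0" and f: "continuous_on UNIV f" and le: "\<And>t. norm t < \<epsilon> \<Longrightarrow> norm (f (z - t) - c) \<le> e"
  shows "norm (mollify \<epsilon> f z - c) \<le> e"
proof -
  let ?I = "\<integral>t. real_bump \<epsilon> t \<partial>lborel"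
  note I = real_bump_integral[OF \<epsilon>]
  have "integrable lborel (\<lambda>t. bump \<epsilon> t * f (z - t))"
    by (rule has_compact_support_integrable(1)[of _ \<epsilon>])
       (use \<epsilon> in \<open>auto intro!: continuous_on_mult continuous_bump continuous_on_compose2[OF f] continuous_intros simp: bump_eq_0\<close>)
  moreover have ib: "integrable lborel (bump \<epsilon>)" unfolding bump_eq_real_bump(1) using I(1) by (rule integrable_of_real)
  ultimately have i: "integrable lborel (\<lambda>t. bump \<epsilon> t * (f (z - t) - c))"
    and eq: "(\<integral>t. bump \<epsilon> t * (f (z - t) - c) \<partial>lborel) = (\<integral>t. bump \<epsilon> t * f (z - t) \<partial>lborel) - (\<integral>t. bump \<epsilon> t \<partial>lborel) * c"
    by (simp_all add: right_diff_distrib)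
  have "mollify \<epsilon> f z - c = (1 / of_real ?I) * (\<integral>t. bump \<epsilon> t * (f (z - t) - c) \<partial>lborel)"
    unfolding mollify_def eq I(3) using I(2) by (simp add: right_diff_distrib diff_divide_distrib)
  also have "norm \<dots> = (1 / ?I) * norm (\<integral>t. bump \<epsilon> t * (f (z - t) - c) \<partial>lborel)"
    using I(2) by (simp add: norm_mult norm_divide)
  also have "\<dots> \<le> (1 / ?I) * (\<integral>t. real_bump \<epsilon> t * e \<partial>lborel)"
  proof (intro mult_left_mono Bochner_Integration.integral_norm_bound_integral)
    show "integrable lborel (\<lambda>t. real_bump \<epsilon> t * e)" using I(1) by simp
    fix t
    show "norm (bump \<epsilon> t * (f (z - t) - c)) \<le> real_bump \<epsilon> t * e"
    proof (cases "norm t < \<epsilon>")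
      case True
      then show ?thesis using le[OF True] bump_eq_real_bump(2)[of \<epsilon> t] by (simp add: norm_mult bump_eq_real_bump(1) mult_left_mono)
    next
      case False
      then have "bump \<epsilon> t = 0" using \<epsilon> by (intro bump_eq_0) auto
      then show ?thesis using bump_eq_real_bump(3)[of \<epsilon> t] by simp
    qed
  qed (use i I(2) in auto)
  also have "\<dots> = e" using I(2) by simp
  finally show ?thesis .
qed

lemma norm_mollify_le:
  assumes "\<epsilon> > 0" "continuous_on UNIV f" "\<And>t. norm (f t) \<le> B"
  shows "norm (mollify \<epsilon> f z) \<le> B"
  using mollify_diff_le[OF assms(1,2), of z 0 B] assms(3) by simp

lemma mollify_tendsto:
  assumes f: "continuous_on UNIV f" and \<epsilon>: "\<And>n. \<epsilon> n > 0" "\<epsilon> \<longlonglongrightarrow> 0"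
  shows "(\<lambda>n. mollify (\<epsilon> n) f z) \<longlonglongrightarrow> f z"
proof (rule LIMSEQ_I)
  fix e :: real assume "e > 0"
  then have "e / 2 > 0" by simp
  moreover have "isCont f z" using f by (simp add: continuous_on_eq_continuous_at)
  ultimately obtain d where d: "d > 0" "\<And>x. norm (x - z) < d \<Longrightarrow> norm (f x - f z) < e / 2"
    unfolding continuous_at_eps_delta dist_norm by metis
  from LIMSEQ_D[OF \<epsilon>(2) d(1)] obtain N where N: "\<And>n. n \<ge> N \<Longrightarrow> \<epsilon> n < d" by fastforce
  show "\<exists>N. \<forall>n\<ge>N. norm (mollify (\<epsilon> n) f z - f z) < e"
  proof (intro exI[of _ N] allI impI)
    fix n assume "n \<ge> N"
    have "norm (mollify (\<epsilon> n) f z - f z) \<le> e / 2"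
    proof (rule mollify_diff_le[OF \<epsilon>(1) f])
      fix t :: complex assume "norm t < \<epsilon> n"
      then show "norm (f (z - t) - f z) \<le> e / 2" using d(2)[of "z - t"] N[OF \<open>n \<ge> N\<close>] by simp
    qed
    then show "norm (mollify (\<epsilon> n) f z - f z) < e" using \<open>e > 0\<close> by simp
  qed
qed

lemma mollify_support:
  assumes "\<epsilon> > 0" "\<And>z. norm z > r \<Longrightarrow> f z = 0" "norm z > r + \<epsilon>"
  shows "mollify \<epsilon> f z = 0"
proof -
  have "bump \<epsilon> t * f (z - t) = 0" for t
  proof (cases "norm t < \<epsilon>")
    case True
    then have "norm (z - t) > r" using assms(3) norm_triangle_ineq2[of z t] by linarith
    then show ?thesis using assms(2) by simp
  qed (use assms(1) in \<open>auto intro: bump_eq_0\<close>)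
  then have "(\<lambda>t. bump \<epsilon> t * f (z - t)) = (\<lambda>_. 0)" by (rule ext)
  then show ?thesis unfolding mollify_def by simp
qed

lemma mollify_smooth:
  assumes \<epsilon>: "\<epsilon> > 0" and f: "continuous_on UNIV f" "\<And>z. norm z > r \<Longrightarrow> f z = 0"
  shows "smooth (mollify \<epsilon> f)"
proof -
  let ?a = "Complex (- r) (- r)" and ?b = "Complex r r"
  have eq: "mollify \<epsilon> f z = (1 / (\<integral>t. bump \<epsilon> t \<partial>lborel)) * integral (cbox ?a ?b) (\<lambda>t. f t * bump \<epsilon> (z - t))" for z
  proof -
    have c: "continuous_on UNIV (\<lambda>t. f t * bump \<epsilon> (z - t))"
      by (intro continuous_on_mult f continuous_on_compose2[OF continuous_bump[of UNIV]] continuous_intros) auto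
    have "integral (cbox ?a ?b) (\<lambda>t. f t * bump \<epsilon> (z - t)) = (\<integral>t. f t * bump \<epsilon> (z - t) \<partial>lborel)"
      by (rule has_compact_support_integrable(2)[OF c]) (use f(2) in simp)
    also have "\<dots> = (\<integral>t. f (z - t) * bump \<epsilon> (z - (z - t)) \<partial>lborel)"
      by (rule lborel_integral_reflect[OF borel_measurable_continuous_UNIV[OF c], symmetric])
    finally show ?thesis by (simp add: mollify_def mult.commute)
  qed
  show ?thesis
    unfolding smooth_def eq[abs_def]
    by (intro allI times_differentiable_mult times_differentiable_const
        times_differentiable_convolution[OF f(1) times_differentiable_bump])
qed

text \<open>In \<open>mollify_smooth\<close> a reflection lets the derivatives fall on
  \<open>bump\<close>; here the convolution is left as it is, and the derivative falls on
  \<open>f\<close>.\<close>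

lemma dbar_mollify:
  assumes \<epsilon>: "\<epsilon> > 0" and f: "times_differentiable 1 f"
  shows "dbar (mollify \<epsilon> f) z = mollify \<epsilon> (dbar f) z"
proof -
  let ?a = "Complex (- \<epsilon>) (- \<epsilon>)" and ?b = "Complex \<epsilon> \<epsilon>"
  have eq: "integral (cbox ?a ?b) (\<lambda>t. bump \<epsilon> t * g (z - t)) = (\<integral>t. bump \<epsilon> t * g (z - t) \<partial>lborel)"
    and int: "(\<lambda>t. bump \<epsilon> t * g (z - t)) integrable_on (cbox ?a ?b)"
    if g: "continuous_on UNIV g" for z and g :: "complex \<Rightarrow> complex"
  proof -
    have c: "continuous_on UNIV (\<lambda>t. bump \<epsilon> t * g (z - t))"
      by (intro continuous_on_mult continuous_bump continuous_on_compose2[OF g] continuous_intros) auto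
    show "integral (cbox ?a ?b) (\<lambda>t. bump \<epsilon> t * g (z - t)) = (\<integral>t. bump \<epsilon> t * g (z - t) \<partial>lborel)"
      by (rule has_compact_support_integrable(2)[OF c]) (use \<epsilon> in \<open>simp add: bump_eq_0\<close>)
    show "(\<lambda>t. bump \<epsilon> t * g (z - t)) integrable_on (cbox ?a ?b)"
      by (intro integrable_continuous continuous_on_subset[OF c]) auto
  qed
  have cf: "continuous_on UNIV f" by (rule times_differentiable_continuous[OF f])
  have cD: "continuous_on UNIV (\<lambda>z. frechet_derivative f (at z) v)" for v using f by simp
  let ?c = "1 / (\<integral>t. bump \<epsilon> t \<partial>lborel)"
  have "(mollify \<epsilon> f has_derivative (\<lambda>v. ?c * integral (cbox ?a ?b) (\<lambda>t. bump \<epsilon> t * frechet_derivative f (at (z - t)) v))) (at z)"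
    unfolding mollify_def[abs_def] eq[OF cf, symmetric]
    by (intro has_derivative_mult_right convolution_has_derivative continuous_bump f)
  from dbar_eq[OF this]
  have "dbar (mollify \<epsilon> f) z = ?c * ((integral (cbox ?a ?b) (\<lambda>t. bump \<epsilon> t * frechet_derivative f (at (z - t)) 1) +
      \<i> * integral (cbox ?a ?b) (\<lambda>t. bump \<epsilon> t * frechet_derivative f (at (z - t)) \<i>)) / 2)"
    by (simp add: algebra_simps add_divide_distrib)
  also have "integral (cbox ?a ?b) (\<lambda>t. bump \<epsilon> t * frechet_derivative f (at (z - t)) 1) +
      \<i> * integral (cbox ?a ?b) (\<lambda>t. bump \<epsilon> t * frechet_derivative f (at (z - t)) \<i>)
      = integral (cbox ?a ?b) (\<lambda>t. 2 * (bump \<epsilon> t * dbar f (z - t)))"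
  proof -
    have "(\<lambda>t. 2 * (bump \<epsilon> t * dbar f (z - t))) = (\<lambda>t. bump \<epsilon> t * frechet_derivative f (at (z - t)) 1 +
        \<i> * (bump \<epsilon> t * frechet_derivative f (at (z - t)) \<i>))"
      by (simp add: fun_eq_iff dbar_def dx_def dy_def algebra_simps)
    then show ?thesis
      by (simp only: Henstock_Kurzweil_Integration.integral_add[OF int[OF cD] integrable_on_mult_right[OF int[OF cD]]]
          integral_mult_right)
  qed
  also have "\<dots> / 2 = (\<integral>t. bump \<epsilon> t * dbar f (z - t) \<partial>lborel)"
    using eq[OF continuous_dbar[OF f], of z] by simp
  finally show ?thesis unfolding mollify_def[of _ "dbar f"] .
qed

text \<open>A C^1 test function is mollified. As mollification commutes with \<open>dbar\<close>,
  both \<open>\<phi>\<close> and \<open>dbar \<phi>\<close> are approximated boundedly with supports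
  in one compact disk, so dominated convergence works for functions that are merely locally
  integrable.\<close>

lemma weak_dbar_smooth_tests:
  assumes loc: "loc_int f" "loc_int g"
    and test: "\<And>r \<phi>. r < 1 \<Longrightarrow> smooth \<phi> \<Longrightarrow> (\<And>z. norm z > r \<Longrightarrow> \<phi> z = 0) \<Longrightarrow>
      (\<integral>z. f z * dbar \<phi> z \<partial>lborel) = - (\<integral>z. g z * \<phi> z \<partial>lborel)"
  shows "weak_dbar f g"
  unfolding weak_dbar_def
proof (intro conjI loc allI impI)
  fix r \<phi> assume r: "r < (1::real)" and t: "test1 r \<phi>"
  then have td: "times_differentiable 1 \<phi>" and supp: "\<And>z. norm z > r \<Longrightarrow> \<phi> z = 0" by (auto simp: test1_def simp del: times_differentiable.simps)
  define R where "R = (r + 1) / 2"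
  have R: "R < 1" "r < R" using r by (auto simp: R_def)
  \<comment> \<open>Being at most \<open>R - r\<close>, it keeps the mollified supports inside
    \<open>cball 0 R\<close>.\<close>
  define \<epsilon> where "\<epsilon> n = (R - r) / (real n + 1)" for n
  have \<epsilon>: "\<epsilon> n > 0" "\<epsilon> n \<le> R - r" for n
    using R divide_left_mono[of 1 "real n + 1" "R - r"] by (auto simp: \<epsilon>_def)
  have \<epsilon>0: "\<epsilon> \<longlonglongrightarrow> 0" unfolding \<epsilon>_def by real_asymp
  have lim: "(\<lambda>n. \<integral>z. k z * mollify (\<epsilon> n) h z \<partial>lborel) \<longlonglongrightarrow> (\<integral>z. k z * h z \<partial>lborel)"
    if k: "loc_int k" and h: "continuous_on UNIV h" "\<And>z. norm z > r \<Longrightarrow> h z = 0" for k h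
  proof -
    obtain B where B: "\<And>z. norm z \<le> r \<Longrightarrow> norm (h z) \<le> B" using continuous_bounded_on_cball[OF h(1)] by blast
    have B': "norm (h z) \<le> max 0 B" for z using B[of z] h(2)[of z] by (cases "norm z \<le> r") auto
    have zero: "mollify (\<epsilon> n) h z = 0" if "norm z > R" for n z
      by (rule mollify_support[OF \<epsilon>(1) h(2)]) (use that \<epsilon>(2)[of n] in auto)
    note [measurable] = loc_int_measurable[OF k] borel_measurable_continuous_UNIV[OF h(1)]
    have mm [measurable]: "mollify (\<epsilon> n) h \<in> borel_measurable borel" for n
      using mollify_smooth[OF \<epsilon>(1) h] times_differentiable_continuous
      by (intro borel_measurable_continuous_UNIV) (auto simp: smooth_def simp del: times_differentiable.simps)
    show ?thesis
    proof (rule integral_dominated_convergence[where w = "\<lambda>z. norm (of_real (max 0 B) * (indicator (cball 0 R) z * k z))"])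
      show "integrable lborel (\<lambda>z. norm (of_real (max 0 B) * (indicator (cball 0 R) z * k z)))"
        using k R by (intro integrable_norm integrable_mult_right) (auto simp: loc_int_def)
      show "AE z in lborel. (\<lambda>n. k z * mollify (\<epsilon> n) h z) \<longlonglongrightarrow> k z * h z"
        by (intro always_eventually allI tendsto_mult tendsto_const mollify_tendsto h \<epsilon> \<epsilon>0)
      show "AE z in lborel. norm (k z * mollify (\<epsilon> n) h z) \<le> norm (of_real (max 0 B) * (indicator (cball 0 R) z * k z))" for n
      proof (intro always_eventually allI)
        fix z
        show "norm (k z * mollify (\<epsilon> n) h z) \<le> norm (of_real (max 0 B) * (indicator (cball 0 R) z * k z))"
        proof (cases "norm z \<le> R")
          case True
          have "norm (k z) * norm (mollify (\<epsilon> n) h z) \<le> norm (k z) * max 0 B"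
            by (intro mult_left_mono norm_mollify_le[OF \<epsilon>(1) h(1) B']) auto
          then show ?thesis using True by (simp add: norm_mult mult.commute)
        next
          case False
          then show ?thesis using zero[of z n] by simp
        qed
      qed
    qed measurable
  qed
  have "(\<integral>z. f z * mollify (\<epsilon> n) (dbar \<phi>) z \<partial>lborel) = - (\<integral>z. g z * mollify (\<epsilon> n) \<phi> z \<partial>lborel)" for n
  proof -
    have "(\<integral>z. f z * dbar (mollify (\<epsilon> n) \<phi>) z \<partial>lborel) = - (\<integral>z. g z * mollify (\<epsilon> n) \<phi> z \<partial>lborel)"
    proof (rule test[OF R(1)])
      show "smooth (mollify (\<epsilon> n) \<phi>)"
        by (rule mollify_smooth[OF \<epsilon>(1) times_differentiable_continuous[OF td] supp])
      show "mollify (\<epsilon> n) \<phi> z = 0" if "norm z > R" for z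
        by (rule mollify_support[OF \<epsilon>(1) supp]) (use that \<epsilon>(2)[of n] in auto)
    qed
    then show ?thesis unfolding dbar_mollify[OF \<epsilon>(1) td] .
  qed
  then show "(\<integral>z. f z * dbar \<phi> z \<partial>lborel) = - (\<integral>z. g z * \<phi> z \<partial>lborel)"
    using LIMSEQ_unique[OF lim[OF loc(1) continuous_dbar[OF td] dbar_support[OF t]]]
      tendsto_minus[OF lim[OF loc(2) times_differentiable_continuous[OF td] supp]] by simp
qed

subsection \<open>Borel representatives\<close>

definition disk_rep :: "(complex \<Rightarrow> complex) \<Rightarrow> (complex \<Rightarrow> complex) \<Rightarrow> bool" where
  "disk_rep f h \<longleftrightarrow> h \<in> borel_measurable borel \<and> (AE z in lborel. z \<in> ball 0 1 \<longrightarrow> f z = h z)"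

lemma locally_integrable_cball:
  assumes "locally_integrable (ball 0 1) f" "r < 1"
  shows "integrable lebesgue (\<lambda>z. indicator (cball 0 r) z *\<^sub>R f z)"
proof -
  have "cball 0 r \<subseteq> (ball 0 1 :: complex set)" using assms(2) by auto
  then show ?thesis
    using assms(1) unfolding locally_integrable_def set_integrable_def by (metis compact_cball)
qed

lemma ex_disk_rep_measurable:
  assumes "(\<lambda>z. indicator (ball 0 1) z *\<^sub>R f z) \<in> borel_measurable lebesgue"
  shows "\<exists>h. disk_rep f h"
proof -
  let ?f = "\<lambda>z. indicator (ball 0 1) z *\<^sub>R f z"
  have "(\<lambda>z. Re (?f z)) \<in> borel_measurable lebesgue" "(\<lambda>z. Im (?f z)) \<in> borel_measurable lebesgue"
    by (rule measurable_compose[OF assms], rule borel_measurable_continuous_UNIV, intro continuous_intros)+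
  from this[THEN completion_ex_borel_measurable_real] obtain u v where
    uv: "u \<in> borel_measurable lborel" "v \<in> borel_measurable lborel"
      "AE z in lborel. Re (?f z) = u z" "AE z in lborel. Im (?f z) = v z" by blast
  have "(\<lambda>z. complex_of_real (u z) + \<i> * complex_of_real (v z)) \<in> borel_measurable borel"
    using uv(1,2) by simp
  moreover have "AE z in lborel. z \<in> ball 0 1 \<longrightarrow> f z = complex_of_real (u z) + \<i> * complex_of_real (v z)"
    using uv(3,4) by eventually_elim (auto simp: complex_eq_iff)
  ultimately show ?thesis unfolding disk_rep_def by blast
qed

lemma ex_disk_rep:
  assumes "locally_integrable (ball 0 1) f"
  shows "\<exists>h. disk_rep f h"
proof (rule ex_disk_rep_measurable)
  show "(\<lambda>z. indicator (ball 0 1) z *\<^sub>R f z) \<in> borel_measurable lebesgue"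
  proof (rule borel_measurable_LIMSEQ_metric)
    fix n :: nat
    have "1 - 1 / (real n + 2) < 1" by simp
    from locally_integrable_cball[OF assms this]
    show "(\<lambda>z. indicator (cball 0 (1 - 1 / (real n + 2))) z *\<^sub>R f z) \<in> borel_measurable lebesgue" by simp
  next
    fix z :: complex
    have "eventually (\<lambda>n. indicator (cball 0 (1 - 1 / (real n + 2))) z *\<^sub>R f z = indicator (ball 0 1) z *\<^sub>R f z) sequentially"
    proof (cases "norm z < 1")
      case True
      have "(\<lambda>n. 1 - 1 / (real n + 2)) \<longlonglongrightarrow> 1" by real_asymp
      from order_tendstoD(1)[OF this True] show ?thesis by eventually_elim (use True in auto)
    next
      case False
      have "\<not> norm z \<le> 1 - 1 / (real n + 2)" for n :: nat
      proof -
        have "1 / (real n + 2) > 0" by simp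
        then show ?thesis using False by linarith
      qed
      then show ?thesis using False by (intro always_eventually) auto
    qed
    then show "(\<lambda>n. indicator (cball 0 (1 - 1 / (real n + 2))) z *\<^sub>R f z) \<longlonglongrightarrow> indicator (ball 0 1) z *\<^sub>R f z"
      by (rule tendsto_eventually)
  qed
qed

lemma disk_rep_loc_int:
  assumes "locally_integrable (ball 0 1) f" "disk_rep f h"
  shows "loc_int h"
  unfolding loc_int_def
proof safe
  show h: "h \<in> borel_measurable borel" using assms(2) by (simp add: disk_rep_def)
  fix r :: real assume r: "r < 1"
  have m: "(\<lambda>z. indicator (cball 0 r) z * h z) \<in> borel_measurable lborel"
    using h by simp
  have "integrable lebesgue (\<lambda>z. indicator (cball 0 r) z * h z)"
  proof (rule integrable_cong_AE_imp[OF locally_integrable_cball[OF assms(1) r]])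
    show "(\<lambda>z. indicator (cball 0 r) z * h z) \<in> borel_measurable lebesgue"
      using m by (rule measurable_completion)
    have "AE z in lebesgue. z \<in> ball 0 1 \<longrightarrow> f z = h z"
      using assms(2) AE_completion unfolding disk_rep_def by blast
    then show "AE z in lebesgue. indicator (cball 0 r) z *\<^sub>R f z = indicator (cball 0 r) z * h z"
      by eventually_elim (use r in \<open>auto simp: indicator_def\<close>)
  qed
  then show "integrable lborel (\<lambda>z. indicator (cball 0 r) z * h z)"
    using integrable_completion[OF m] by simp
qed

lemma disk_rep_integral:
  assumes f: "locally_integrable (ball 0 1) f" "disk_rep f h" and r: "r < 1"
    and \<phi>: "continuous_on UNIV \<phi>" "\<And>z. norm z > r \<Longrightarrow> \<phi> z = 0"
  shows "(LINT z:ball 0 1|lebesgue. f z * \<phi> z) = (\<integral>z. h z * \<phi> z \<partial>lborel)"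
proof -
  have h: "h \<in> borel_measurable borel" using f(2) by (simp add: disk_rep_def)
  have \<phi>m: "\<phi> \<in> borel_measurable borel" by (rule borel_measurable_continuous_UNIV[OF \<phi>(1)])
  have m: "(\<lambda>z. h z * \<phi> z) \<in> borel_measurable lborel" using borel_measurable_times[OF h \<phi>m] by simp
  have "(LINT z:ball 0 1|lebesgue. f z * \<phi> z) = integral\<^sup>L lebesgue (\<lambda>z. h z * \<phi> z)"
    unfolding set_lebesgue_integral_def
  proof (rule integral_cong_AE)
    have "(\<lambda>z. (indicator (cball 0 r) z *\<^sub>R f z) * \<phi> z) \<in> borel_measurable lebesgue"
      using borel_measurable_integrable[OF locally_integrable_cball[OF f(1) r]] \<phi>m
      by (intro borel_measurable_times) (auto intro: measurable_completion)
    moreover have "(\<lambda>z. (indicator (cball 0 r) z *\<^sub>R f z) * \<phi> z) = (\<lambda>z. indicator (ball 0 1) z *\<^sub>R (f z * \<phi> z))"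
      using r \<phi>(2) by (auto simp: fun_eq_iff indicator_def not_le)
    ultimately show "(\<lambda>z. indicator (ball 0 1) z *\<^sub>R (f z * \<phi> z)) \<in> borel_measurable lebesgue" by simp
    show "(\<lambda>z. h z * \<phi> z) \<in> borel_measurable lebesgue" using m by (rule measurable_completion)
    have "AE z in lebesgue. z \<in> ball 0 1 \<longrightarrow> f z = h z"
      using f(2) AE_completion unfolding disk_rep_def by blast
    then show "AE z in lebesgue. indicator (ball 0 1) z *\<^sub>R (f z * \<phi> z) = h z * \<phi> z"
      by eventually_elim (use r \<phi>(2) in \<open>auto simp: indicator_def\<close>)
  qed
  then show ?thesis using integral_completion[OF m] by simp
qed

lemma test_functionsI:
  assumes "smooth \<phi>" "r < 1" "\<And>z. norm z > r \<Longrightarrow> \<phi> z = 0"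
  shows "\<phi> \<in> test_functions (ball 0 1)"
proof -
  have "{z. \<phi> z \<noteq> 0} \<subseteq> cball 0 r" 
  proof
    fix z assume "z \<in> {z. \<phi> z \<noteq> 0}"
    then have "\<not> norm z > r" using assms(3) by blast
    then show "z \<in> cball 0 r" by simp
  qed
  then have c: "closure {z. \<phi> z \<noteq> 0} \<subseteq> cball 0 r" by (rule closure_minimal) simp
  then have "bounded (closure {z. \<phi> z \<noteq> 0})" using bounded_subset bounded_cball by blast
  then have "compact (closure {z. \<phi> z \<noteq> 0})" by (simp add: compact_eq_bounded_closed)
  moreover have "cball 0 r \<subseteq> (ball 0 1 :: complex set)" using assms(2) by auto
  ultimately show ?thesis using order_trans[OF c] assms(1) unfolding test_functions_def by blast
qed

lemma has_weak_dbar_imp_weak_dbar: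
  assumes w: "has_weak_dbar (ball 0 1) 1 f g" and f: "disk_rep f f'" and g: "disk_rep g g'"
  shows "weak_dbar f' g'"
proof -
  have W: "locally_integrable (ball 0 1) f" "locally_integrable (ball 0 1) g"
    "\<And>\<phi>. \<phi> \<in> test_functions (ball 0 1) \<Longrightarrow>
      (LINT z:ball 0 1|lebesgue. f z * dbar \<phi> z) = - (LINT z:ball 0 1|lebesgue. g z * \<phi> z)"
    using w by (auto simp: has_weak_dbar_def has_weak_derivative_def)
  show ?thesis
  proof (rule weak_dbar_smooth_tests)
    show "loc_int f'" by (rule disk_rep_loc_int[OF W(1) f])
    show "loc_int g'" by (rule disk_rep_loc_int[OF W(2) g])
    fix r \<phi> assume r: "r < (1::real)" and s: "smooth \<phi>" and supp: "\<And>z. norm z > r \<Longrightarrow> \<phi> z = 0"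
    have td: "times_differentiable 1 \<phi>" using s by (simp add: smooth_def del: times_differentiable.simps)
    then have t: "test1 r \<phi>" using supp by (simp add: test1_def del: times_differentiable.simps)
    show "(\<integral>z. f' z * dbar \<phi> z \<partial>lborel) = - (\<integral>z. g' z * \<phi> z \<partial>lborel)"
      using W(3)[OF test_functionsI[OF s r supp]]
        disk_rep_integral[OF W(1) f r continuous_dbar[OF td] dbar_support[OF t]]
        disk_rep_integral[OF W(2) g r times_differentiable_continuous[OF td] supp] by simp
  qed
qed

subsection \<open>Derivatives of higher order\<close>

lemma smooth_dx: "smooth f \<Longrightarrow> smooth (dx f)" and smooth_dy: "smooth f \<Longrightarrow> smooth (dy f)"
  and smooth_dbar: "smooth f \<Longrightarrow> smooth (dbar f)"
  unfolding smooth_def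
  by (auto intro: times_differentiable_dx times_differentiable_dy times_differentiable_dbar simp del: times_differentiable.simps)

lemma test_functions_dbar:
  assumes "\<phi> \<in> test_functions S"
  shows "dbar \<phi> \<in> test_functions S"
proof -
  have "{z. dbar \<phi> z \<noteq> 0} \<subseteq> closure {z. \<phi> z \<noteq> 0}"
  proof
    fix z assume z: "z \<in> {z. dbar \<phi> z \<noteq> 0}"
    show "z \<in> closure {z. \<phi> z \<noteq> 0}"
    proof (rule ccontr)
      assume n: "z \<notin> closure {z. \<phi> z \<noteq> 0}"
      have "dbar \<phi> z = 0"
        by (rule dbar_eq_0(3)[of "- closure {z. \<phi> z \<noteq> 0}" _ _ 0]) (use n closure_subset[of "{z. \<phi> z \<noteq> 0}"] in auto)
      then show False using z by simp
    qed
  qed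
  then have c: "closure {z. dbar \<phi> z \<noteq> 0} \<subseteq> closure {z. \<phi> z \<noteq> 0}" by (rule closure_minimal) simp
  have "compact (closure {z. \<phi> z \<noteq> 0})" "closure {z. \<phi> z \<noteq> 0} \<subseteq> S" "smooth \<phi>"
    using assms by (auto simp: test_functions_def)
  then have "compact (closure {z. dbar \<phi> z \<noteq> 0})" using c
    by (meson bounded_subset closed_closure compact_eq_bounded_closed)
  then show ?thesis using c assms smooth_dbar unfolding test_functions_def by blast
qed

text \<open>Testing the equation of order \<open>k\<close> with \<open>dbar \<phi>\<close> and that
  of order \<open>Suc k\<close> with \<open>\<phi>\<close> gives the same left-hand side.\<close>

lemma has_weak_dbar_step:
  assumes "has_weak_dbar S k f g" "has_weak_dbar S (Suc k) f h"
  shows "has_weak_dbar S 1 g h"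
proof -
  have "(LINT z:S|lebesgue. g z * dbar \<phi> z) = - (LINT z:S|lebesgue. h z * \<phi> z)" if \<phi>: "\<phi> \<in> test_functions S" for \<phi>
  proof -
    have "(LINT z:S|lebesgue. f z * (dbar ^^ k) (dbar \<phi>) z) = (-1) ^ k * (LINT z:S|lebesgue. g z * dbar \<phi> z)"
      using assms(1) test_functions_dbar[OF \<phi>] by (auto simp: has_weak_dbar_def has_weak_derivative_def)
    moreover have "(LINT z:S|lebesgue. f z * (dbar ^^ Suc k) \<phi> z) = (-1) ^ Suc k * (LINT z:S|lebesgue. h z * \<phi> z)"
      using assms(2) \<phi> by (auto simp: has_weak_dbar_def has_weak_derivative_def)
    ultimately have "(-1) ^ k * (LINT z:S|lebesgue. g z * dbar \<phi> z) = (-1) ^ k * (- (LINT z:S|lebesgue. h z * \<phi> z))"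
      by (simp add: funpow_swap1)
    then show ?thesis unfolding mult_cancel_left by simp
  qed
  then show ?thesis using assms by (simp add: has_weak_dbar_def has_weak_derivative_def)
qed

text \<open>Differentiate \<open>f (z + x + i y) = f (z + x) + \<integral>\<^sub>0\<^sup>y (dy f) (z + x + i t) dt\<close> with respect to \<open>x\<close>
  under the integral sign, then with respect to \<open>y\<close>.\<close>

lemma dx_dy_commute:
  assumes f: "times_differentiable 2 f"
  shows "dx (dy f) z = dy (dx f) z"
proof -
  have f1: "times_differentiable (Suc 0) f" "times_differentiable (Suc (Suc 0)) f" using f times_differentiable_mono[OF f, of 1]
    by (simp_all add: numeral_2_eq_2 del: times_differentiable.simps)
  have tdy: "times_differentiable (Suc 0) (dy f)" and tdx: "times_differentiable (Suc 0) (dx f)"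
    by (rule times_differentiable_dy[OF f1(2)], rule times_differentiable_dx[OF f1(2)])
  have vx: "((\<lambda>x. h (z + of_real x + c)) has_vector_derivative dx h (z + of_real x + c)) (at x within X)"
    if "times_differentiable (Suc 0) h" for h c x X
    unfolding has_vector_derivative_def
  proof (rule has_derivative_eq_rhs[OF has_derivative_compose[OF _ times_differentiable_SucD[OF that]]])
    show "((\<lambda>x. z + of_real x + c) has_derivative (\<lambda>v. of_real v)) (at x within X)"
      by (auto intro!: derivative_eq_intros)
    show "(\<lambda>v. frechet_derivative h (at (z + of_real x + c)) (of_real v)) = (\<lambda>v. v *\<^sub>R dx h (z + of_real x + c))"
      using linear_frechet_derivative[of h "at (z + of_real x + c)"] that
      by (auto simp: fun_eq_iff dx_def of_real_def linear_cmul)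
  qed
  have vy: "((\<lambda>y. h (c + \<i> * of_real y)) has_vector_derivative dy h (c + \<i> * of_real y)) (at y within X)"
    if "times_differentiable (Suc 0) h" for h c y X
    unfolding has_vector_derivative_def
  proof (rule has_derivative_eq_rhs[OF has_derivative_compose[OF _ times_differentiable_SucD[OF that]]])
    show "((\<lambda>y. c + \<i> * of_real y) has_derivative (\<lambda>v. \<i> * of_real v)) (at y within X)"
      by (auto intro!: derivative_eq_intros)
    have "\<i> * of_real v = v *\<^sub>R \<i>" for v :: real by (simp add: scaleR_conv_of_real)
    then show "(\<lambda>v. frechet_derivative h (at (c + \<i> * of_real y)) (\<i> * of_real v)) = (\<lambda>v. v *\<^sub>R dy h (c + \<i> * of_real y))"
      using linear_frechet_derivative[of h "at (c + \<i> * of_real y)"] that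
      by (simp add: fun_eq_iff dy_def linear_cmul)
  qed
  have cont: "continuous_on UNIV (dy f)" "continuous_on UNIV (dx (dy f))"
    using times_differentiable_continuous[OF tdy] times_differentiable_continuous[OF times_differentiable_dx[OF tdy]] by auto
  have FTC: "f (z + of_real x + \<i> * of_real y) = f (z + of_real x) + integral {0..y} (\<lambda>t. dy f (z + of_real x + \<i> * of_real t))"
    if "0 \<le> y" for x y
    using integral_unique[OF fundamental_theorem_of_calculus[OF that vy[OF f1(1), of "z + of_real x"]]] by simp
  have D: "dx f (z + \<i> * of_real y) = dx f z + integral {0..y} (\<lambda>t. dx (dy f) (z + \<i> * of_real t))" if y: "0 \<le> y" for y
  proof -
    have "((\<lambda>x. integral (cbox 0 y) (\<lambda>t. dy f (z + of_real x + \<i> * of_real t))) has_vector_derivative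
        integral (cbox 0 y) (\<lambda>t. dx (dy f) (z + of_real 0 + \<i> * of_real t))) (at 0 within UNIV)"
    proof (rule leibniz_rule_vector_derivative)
      show "((\<lambda>x. dy f (z + of_real x + \<i> * of_real t)) has_vector_derivative dx (dy f) (z + of_real x + \<i> * of_real t)) (at x within UNIV)" for x t
        by (rule vx[OF tdy])
      show "(\<lambda>t. dy f (z + of_real x + \<i> * of_real t)) integrable_on cbox 0 y" for x
        by (intro integrable_continuous continuous_on_compose2[OF cont(1)] continuous_intros) auto
      show "continuous_on (UNIV \<times> cbox 0 y) (\<lambda>(x, t). dx (dy f) (z + of_real x + \<i> * of_real t))"
        unfolding split_beta by (intro continuous_on_compose2[OF cont(2)] continuous_intros) auto
    qed auto
    from has_vector_derivative_add[OF vx[OF f1(1), of 0 0 UNIV] this]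
    have "((\<lambda>x. f (z + of_real x + \<i> * of_real y)) has_vector_derivative
        dx f z + integral {0..y} (\<lambda>t. dx (dy f) (z + \<i> * of_real t))) (at 0)"
      by (simp add: FTC[OF y])
    moreover have "((\<lambda>x. f (z + of_real x + \<i> * of_real y)) has_vector_derivative dx f (z + \<i> * of_real y)) (at 0)"
      using vx[OF f1(1), of "\<i> * of_real y" 0 UNIV] by simp
    ultimately show ?thesis using vector_derivative_unique_at by blast
  qed
  have "continuous_on {0..1} (\<lambda>t. dx (dy f) (z + \<i> * of_real t))"
    by (intro continuous_on_compose2[OF cont(2)] continuous_intros) auto
  \<comment> \<open>\<open>D\<close> holds for \<open>0 \<le> y\<close> only, so the derivative is
    taken at the left end point of \<open>{0..1}\<close>; a one-sided derivative still determines
    the value.\<close>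
  from integral_has_vector_derivative[OF this, of 0]
  have "((\<lambda>y. dx f z + integral {0..y} (\<lambda>t. dx (dy f) (z + \<i> * of_real t))) has_vector_derivative dx (dy f) z) (at 0 within {0..1})"
    by (auto intro!: derivative_eq_intros)
  then have "((\<lambda>y. dx f (z + \<i> * of_real y)) has_vector_derivative dx (dy f) z) (at 0 within {0..1})"
    by (rule has_vector_derivative_transform[rotated 2]) (auto simp: D)
  moreover have "((\<lambda>y. dx f (z + \<i> * of_real y)) has_vector_derivative dy (dx f) z) (at 0 within {0..1})"
    using vy[OF tdx, of z 0 "{0..1}"] by simp
  ultimately show ?thesis
    using vector_derivative_unique_within_closed_interval[of 0 1 0] by fastforce
qed

lemma smooth_funpow_dx: "smooth f \<Longrightarrow> smooth ((dx ^^ a) f)" and smooth_funpow_dy: "smooth f \<Longrightarrow> smooth ((dy ^^ a) f)"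
  by (induction a) (auto intro: smooth_dx smooth_dy)

lemma dy_funpow_dx:
  assumes "smooth f"
  shows "dy ((dx ^^ a) f) = (dx ^^ a) (dy f)"
proof (induction a)
  case (Suc a)
  have "dy (dx ((dx ^^ a) f)) = dx (dy ((dx ^^ a) f))"
    using dx_dy_commute smooth_funpow_dx[OF assms, of a] unfolding smooth_def fun_eq_iff by metis
  then show ?case using Suc by simp
qed simp

lemma dbar_sum:
  assumes "\<And>a. a \<in> I \<Longrightarrow> smooth (F a)"
  shows "dbar (\<lambda>z. \<Sum>a\<in>I. c a * F a z) z = (\<Sum>a\<in>I. c a * ((dx (F a) z + \<i> * dy (F a) z) / 2))"
proof -
  have "(F a has_derivative frechet_derivative (F a) (at z)) (at z)" if "a \<in> I" for a
  proof (rule times_differentiable_SucD[of 0])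
    show "times_differentiable (Suc 0) (F a)" using assms[OF that] unfolding smooth_def by blast
  qed
  then have "((\<lambda>z. \<Sum>a\<in>I. c a * F a z) has_derivative (\<lambda>v. \<Sum>a\<in>I. c a * frechet_derivative (F a) (at z) v)) (at z)"
    by (intro has_derivative_sum has_derivative_mult_right) auto
  from dbar_eq[OF this] show ?thesis
    by (simp add: dx_def dy_def sum_distrib_left sum.distrib[symmetric] sum_divide_distrib algebra_simps add_divide_distrib)
qed

text \<open>Partial derivatives commute on smooth functions, so the power of
  \<open>(dx + \<i> * dy) / 2\<close> expands binomially. The coefficient of index \<open>a\<close>
  is \<open>\<i> ^ (k - a) * (k choose a) / 2 ^ k\<close>; later only its independence of
  \<open>\<phi>\<close> matters.\<close>

lemma dbar_funpow_eq_sum: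
  "\<exists>c :: nat \<Rightarrow> complex. \<forall>\<phi>. smooth \<phi> \<longrightarrow> (dbar ^^ k) \<phi> = (\<lambda>z. \<Sum>a\<le>k. c a * (dx ^^ a) ((dy ^^ (k - a)) \<phi>) z)"
proof (induction k)
  case 0
  show ?case by (rule exI[of _ "\<lambda>_. 1"]) simp
next
  case (Suc k)
  then obtain c :: "nat \<Rightarrow> complex" where
    c: "\<And>\<phi>. smooth \<phi> \<Longrightarrow> (dbar ^^ k) \<phi> = (\<lambda>z. \<Sum>a\<le>k. c a * (dx ^^ a) ((dy ^^ (k - a)) \<phi>) z)" by blast
  \<comment> \<open>Pascal's rule, with \<open>a\<close> counting the factors \<open>dx\<close>; the
    guards supply 0 for the missing neighbours at both ends.\<close>
  define c' where "c' a = ((if a = 0 then 0 else c (a - 1)) + \<i> * (if a \<le> k then c a else 0)) / 2" for a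
  show ?case
  proof (intro exI[of _ c'] allI impI ext)
    fix \<phi> z assume \<phi>: "smooth \<phi>"
    define T where "T a b = (dx ^^ a) ((dy ^^ b) \<phi>) z" for a b
    have "(dbar ^^ Suc k) \<phi> z = dbar (\<lambda>z. \<Sum>a\<le>k. c a * (dx ^^ a) ((dy ^^ (k - a)) \<phi>) z) z"
      by (simp add: c[OF \<phi>])
    also have "\<dots> = (\<Sum>a\<le>k. c a * ((T (Suc a) (k - a) + \<i> * T a (Suc (k - a))) / 2))"
      unfolding T_def
      by (subst dbar_sum) (auto intro: smooth_funpow_dx smooth_funpow_dy \<phi> simp: dy_funpow_dx[OF smooth_funpow_dy[OF \<phi>]])
    also have "\<dots> = (\<Sum>a\<le>k. c a / 2 * T (Suc a) (k - a)) + (\<Sum>a\<le>k. \<i> * c a / 2 * T a (Suc k - a))"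
      by (simp add: sum.distrib[symmetric] algebra_simps add_divide_distrib Suc_diff_le)
    also have "(\<Sum>a\<le>k. c a / 2 * T (Suc a) (k - a)) = (\<Sum>a\<le>Suc k. (if a = 0 then 0 else c (a - 1)) / 2 * T a (Suc k - a))"
      by (subst sum.atMost_Suc_shift) simp
    also have "(\<Sum>a\<le>k. \<i> * c a / 2 * T a (Suc k - a)) = (\<Sum>a\<le>Suc k. \<i> * (if a \<le> k then c a else 0) / 2 * T a (Suc k - a))"
      by simp
    also have "(\<Sum>a\<le>Suc k. (if a = 0 then 0 else c (a - 1)) / 2 * T a (Suc k - a)) + \<dots> = (\<Sum>a\<le>Suc k. c' a * T a (Suc k - a))"
      unfolding sum.distrib[symmetric] c'_def by (intro sum.cong refl) (simp add: algebra_simps add_divide_distrib)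
    finally show "(dbar ^^ Suc k) \<phi> z = (\<Sum>a\<le>Suc k. c' a * (dx ^^ a) ((dy ^^ (Suc k - a)) \<phi>) z)"
      unfolding T_def .
  qed
qed

section \<open>Bounded coefficients\<close>

definition bounded_on_disk :: "(complex \<Rightarrow> complex) \<Rightarrow> bool" where
  "bounded_on_disk a \<longleftrightarrow> a \<in> borel_measurable borel \<and> (\<exists>M. \<forall>z. norm z < 1 \<longrightarrow> norm (a z) \<le> M)"

text \<open>What the product rule consumes of \<open>W_infinity\<close>: a chain of \<open>m\<close>
  successive weak \<open>dbar\<close>-derivatives, all bounded. Sums and products keep the order,
  one application of \<open>dbar\<close> lowers it by one.\<close>

primrec bounded_dbars :: "nat \<Rightarrow> (complex \<Rightarrow> complex) \<Rightarrow> bool" where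
  "bounded_dbars 0 a \<longleftrightarrow> bounded_on_disk a"
| "bounded_dbars (Suc m) a \<longleftrightarrow> bounded_on_disk a \<and> (\<exists>a'. weak_dbar a a' \<and> bounded_dbars m a')"

lemma bounded_on_disk_add: "bounded_on_disk a \<Longrightarrow> bounded_on_disk b \<Longrightarrow> bounded_on_disk (\<lambda>z. a z + b z)"
proof -
  assume "bounded_on_disk a" "bounded_on_disk b"
  then obtain M M' where m: "a \<in> borel_measurable borel" "b \<in> borel_measurable borel"
    and M: "\<And>z. norm z < 1 \<Longrightarrow> norm (a z) \<le> M" "\<And>z. norm z < 1 \<Longrightarrow> norm (b z) \<le> M'"
    unfolding bounded_on_disk_def by blast
  have "norm (a z + b z) \<le> M + M'" if "norm z < 1" for z
    by (rule norm_triangle_mono[OF M[OF that]])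
  then show ?thesis using borel_measurable_add[OF m] unfolding bounded_on_disk_def by blast
qed

lemma bounded_on_disk_mult: "bounded_on_disk a \<Longrightarrow> bounded_on_disk b \<Longrightarrow> bounded_on_disk (\<lambda>z. a z * b z)"
proof -
  assume "bounded_on_disk a" "bounded_on_disk b"
  then obtain M M' where m: "a \<in> borel_measurable borel" "b \<in> borel_measurable borel"
    and M: "\<And>z. norm z < 1 \<Longrightarrow> norm (a z) \<le> M" "\<And>z. norm z < 1 \<Longrightarrow> norm (b z) \<le> M'"
    unfolding bounded_on_disk_def by blast
  have "norm (a z * b z) \<le> M * M'" if "norm z < 1" for z
    unfolding norm_mult by (rule mult_mono'[OF M[OF that]]) auto
  then show ?thesis using borel_measurable_times[OF m] unfolding bounded_on_disk_def by blast
qed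

lemma bounded_on_disk_const: "bounded_on_disk (\<lambda>_. c)"
  by (auto simp: bounded_on_disk_def)

lemma bounded_dbars_bounded: "bounded_dbars m a \<Longrightarrow> bounded_on_disk a"
  by (cases m) auto

lemma bounded_dbars_Suc_imp: "bounded_dbars (Suc m) a \<Longrightarrow> bounded_dbars m a"
proof (induction m arbitrary: a)
  case (Suc m)
  from Suc.prems obtain a' where "bounded_on_disk a" "weak_dbar a a'" "bounded_dbars (Suc m) a'" by auto
  then show ?case using Suc.IH by auto
qed simp

lemma bounded_dbars_mono:
  assumes "bounded_dbars k a" "m \<le> k"
  shows "bounded_dbars m a"
  using assms(2,1) by (induction rule: dec_induct) (auto dest: bounded_dbars_Suc_imp simp del: bounded_dbars.simps)

lemma bounded_dbars_const: "bounded_dbars m (\<lambda>_. c)"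
proof (induction m arbitrary: c)
  case (Suc m)
  then show ?case using weak_dbar_const bounded_on_disk_const by auto
qed (simp add: bounded_on_disk_const)

lemma bounded_dbars_add: "bounded_dbars m a \<Longrightarrow> bounded_dbars m b \<Longrightarrow> bounded_dbars m (\<lambda>z. a z + b z)"
proof (induction m arbitrary: a b)
  case (Suc m)
  from Suc.prems obtain a' b' where "weak_dbar a a'" "weak_dbar b b'" "bounded_dbars m a'" "bounded_dbars m b'"
    by auto
  then have "weak_dbar (\<lambda>z. a z + b z) (\<lambda>z. a' z + b' z)" "bounded_dbars m (\<lambda>z. a' z + b' z)"
    by (auto intro: weak_dbar_add Suc.IH)
  moreover have "bounded_on_disk (\<lambda>z. a z + b z)"
    using Suc.prems by (intro bounded_on_disk_add) auto
  ultimately show ?case by auto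
qed (simp add: bounded_on_disk_add)

lemma weak_dbar_mult_bounded:
  assumes "weak_dbar a a'" "bounded_on_disk a" "bounded_on_disk a'" "weak_dbar f f'"
  shows "weak_dbar (\<lambda>z. a z * f z) (\<lambda>z. a' z * f z + a z * f' z)"
proof -
  from assms(2,3) obtain M M' where "\<And>z. norm z < 1 \<Longrightarrow> norm (a z) \<le> M" "\<And>z. norm z < 1 \<Longrightarrow> norm (a' z) \<le> M'"
    unfolding bounded_on_disk_def by blast
  then show ?thesis by (rule weak_dbar_mult[OF assms(1) _ _ assms(4)])
qed

lemma bounded_dbars_mult: "bounded_dbars m a \<Longrightarrow> bounded_dbars m b \<Longrightarrow> bounded_dbars m (\<lambda>z. a z * b z)"
proof (induction m arbitrary: a b)
  case (Suc m)
  from Suc.prems obtain a' b' where ab: "weak_dbar a a'" "weak_dbar b b'" "bounded_dbars m a'" "bounded_dbars m b'"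
    and bd: "bounded_on_disk a" "bounded_on_disk b"
    by auto
  have "weak_dbar (\<lambda>z. a z * b z) (\<lambda>z. a' z * b z + a z * b' z)"
    by (rule weak_dbar_mult_bounded[OF ab(1) bd(1) bounded_dbars_bounded[OF ab(3)] ab(2)])
  moreover have "bounded_dbars m (\<lambda>z. a' z * b z + a z * b' z)"
    by (intro bounded_dbars_add Suc.IH ab bounded_dbars_Suc_imp[OF Suc.prems(1)] bounded_dbars_Suc_imp[OF Suc.prems(2)])
  ultimately show ?case using bounded_on_disk_mult[OF bd] by auto
qed (simp add: bounded_on_disk_mult)

lemma weak_dbar_sum:
  assumes "finite I" "\<And>i. i \<in> I \<Longrightarrow> weak_dbar (f i) (g i)"
  shows "weak_dbar (\<lambda>z. \<Sum>i\<in>I. f i z) (\<lambda>z. \<Sum>i\<in>I. g i z)"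
  using assms
proof (induction rule: finite_induct)
  case empty
  then show ?case using weak_dbar_const[of 0] by simp
next
  case (insert i I)
  then show ?case using weak_dbar_add[of "f i" "g i"] by simp
qed

section \<open>From \<open>W_infinity\<close> to chains of bounded
  \<open>dbar\<close>-derivatives\<close>

lemma ex_bounded_disk_rep:
  assumes "g \<in> L_infinity (ball 0 1)"
  shows "\<exists>h C. disk_rep g h \<and> (\<forall>z. norm (h z) \<le> C) \<and> (\<forall>z. z \<notin> ball 0 1 \<longrightarrow> h z = 0)"
proof -
  from assms obtain C where m: "g \<in> borel_measurable (lebesgue_on (ball 0 1))"
    and C: "AE z in lebesgue_on (ball 0 1). norm (g z) \<le> C" by (auto simp: L_infinity_def)
  have "(\<lambda>z. indicator (ball 0 1) z *\<^sub>R g z) \<in> borel_measurable lebesgue"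
    using m by (subst (asm) borel_measurable_restrict_space_iff) auto
  then obtain h where h: "disk_rep g h" using ex_disk_rep_measurable by blast
  have "AE z in lebesgue. z \<in> ball 0 1 \<longrightarrow> norm (g z) \<le> C"
    using C by (subst (asm) AE_restrict_space_iff) auto
  then have C': "AE z in lborel. z \<in> ball 0 1 \<longrightarrow> norm (g z) \<le> C" by (simp only: AE_completion_iff)
  \<comment> \<open>Resetting \<open>h\<close> to 0 where the bound fails, which inside the disk is
    a null set, and outside the disk makes the bound hold at every point.\<close>
  define k where "k z = (if norm (h z) \<le> C \<and> norm z < 1 then h z else 0)" for z
  have hm [measurable]: "h \<in> borel_measurable borel" using h by (simp add: disk_rep_def)
  have "k \<in> borel_measurable borel" unfolding k_def[abs_def] by measurable
  moreover have "AE z in lborel. z \<in> ball 0 1 \<longrightarrow> g z = k z"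
    using C' h[unfolded disk_rep_def, THEN conjunct2] by eventually_elim (auto simp: k_def)
  moreover have "norm (k z) \<le> max 0 C" "z \<notin> ball 0 1 \<Longrightarrow> k z = 0" for z by (auto simp: k_def)
  ultimately show ?thesis unfolding disk_rep_def by blast
qed

lemma funpow_dx_dy_support:
  assumes "\<And>z. norm z > r \<Longrightarrow> \<phi> z = 0" "norm z > r"
  shows "(dx ^^ a) ((dy ^^ b) \<phi>) z = 0"
proof -
  have o: "open (- cball 0 r :: complex set)" by auto
  have y: "(dy ^^ b) \<phi> z = 0" if "norm z > r" for z
    using that
  proof (induction b arbitrary: z)
    case (Suc b)
    show ?case using dbar_eq_0(2)[OF o, of z "(dy ^^ b) \<phi>" 0] Suc by auto
  qed (use assms(1) in simp)
  show ?thesis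
    using assms(2)
  proof (induction a arbitrary: z)
    case (Suc a)
    show ?case using dbar_eq_0(1)[OF o, of z "(dx ^^ a) ((dy ^^ b) \<phi>)" 0] Suc by auto
  qed (use y in simp)
qed

lemma smooth_continuous: "smooth f \<Longrightarrow> continuous_on UNIV f"
  unfolding smooth_def using times_differentiable_continuous by blast

text \<open>Expanding \<open>dbar ^^ k\<close> on test functions into mixed partials shows that a
  combination \<open>D k\<close> of the weak partials of order \<open>k\<close> represents the weak
  \<open>dbar\<close>-derivative of order \<open>k\<close>. Replacing the test function by its
  \<open>dbar\<close> links \<open>D k\<close> to \<open>D (Suc k)\<close>.\<close>

lemma bounded_dbars_W_infinity:
  assumes A: "A \<in> W_infinity m (ball 0 1)" and H: "disk_rep A H" "bounded_on_disk H"
  shows "bounded_dbars m H"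
proof -
  define P where "P a b = (SOME g. g \<in> L_infinity (ball 0 1) \<and> has_weak_partial (ball 0 1) a b A g)" for a b
  have P: "P a b \<in> L_infinity (ball 0 1)" "has_weak_partial (ball 0 1) a b A (P a b)" if "a + b \<le> m" for a b
  proof -
    have "\<exists>g. g \<in> L_infinity (ball 0 1) \<and> has_weak_partial (ball 0 1) a b A g"
      using A that unfolding W_infinity_def by blast
    from someI_ex[OF this]
    show "P a b \<in> L_infinity (ball 0 1)" "has_weak_partial (ball 0 1) a b A (P a b)" unfolding P_def by blast+
  qed
  define Q where "Q a b = (SOME h. disk_rep (P a b) h \<and> (\<exists>C. \<forall>z. norm (h z) \<le> C))" for a b
  have Q: "disk_rep (P a b) (Q a b)" "\<exists>C. \<forall>z. norm (Q a b z) \<le> C" if "a + b \<le> m" for a b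
  proof -
    have "\<exists>h. disk_rep (P a b) h \<and> (\<exists>C. \<forall>z. norm (h z) \<le> C)"
      using ex_bounded_disk_rep[OF P(1)[OF that]] by blast
    from someI_ex[OF this]
    show "disk_rep (P a b) (Q a b)" "\<exists>C. \<forall>z. norm (Q a b z) \<le> C" unfolding Q_def by blast+
  qed
  define c where "c k = (SOME c :: nat \<Rightarrow> complex. \<forall>\<phi>. smooth \<phi> \<longrightarrow>
      (dbar ^^ k) \<phi> = (\<lambda>z. \<Sum>a\<le>k. c a * (dx ^^ a) ((dy ^^ (k - a)) \<phi>) z))" for k
  have c: "(dbar ^^ k) \<phi> = (\<lambda>z. \<Sum>a\<le>k. c k a * (dx ^^ a) ((dy ^^ (k - a)) \<phi>) z)" if "smooth \<phi>" for k \<phi>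
    using someI_ex[OF dbar_funpow_eq_sum[of k]] that unfolding c_def by blast
  have locA: "locally_integrable (ball 0 1) A"
    using P(2)[of 0 0] by (simp add: has_weak_partial_def has_weak_derivative_def)
  have locP: "locally_integrable (ball 0 1) (P a b)" if "a + b \<le> m" for a b
    using P(2)[OF that] by (simp add: has_weak_partial_def has_weak_derivative_def)
  have locH: "loc_int H" by (rule disk_rep_loc_int[OF locA H(1)])
  have locQ: "loc_int (Q a b)" if "a + b \<le> m" for a b by (rule disk_rep_loc_int[OF locP[OF that] Q(1)[OF that]])
  have QH: "(\<integral>z. H z * (dx ^^ a) ((dy ^^ b) \<phi>) z \<partial>lborel) = (-1) ^ (a + b) * (\<integral>z. Q a b z * \<phi> z \<partial>lborel)"
    if ab: "a + b \<le> m" and r: "r < 1" and \<phi>: "smooth \<phi>" "\<And>z. norm z > r \<Longrightarrow> \<phi> z = 0" for a b r \<phi>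
  proof -
    have "(LINT z:ball 0 1|lebesgue. A z * (dx ^^ a) ((dy ^^ b) \<phi>) z) = (-1) ^ (a + b) * (LINT z:ball 0 1|lebesgue. P a b z * \<phi> z)"
      using P(2)[OF ab] test_functionsI[OF \<phi>(1) r \<phi>(2)] by (simp add: has_weak_partial_def has_weak_derivative_def)
    also have "(LINT z:ball 0 1|lebesgue. A z * (dx ^^ a) ((dy ^^ b) \<phi>) z) = (\<integral>z. H z * (dx ^^ a) ((dy ^^ b) \<phi>) z \<partial>lborel)"
      by (rule disk_rep_integral[OF locA H(1) r smooth_continuous funpow_dx_dy_support[OF \<phi>(2)]])
         (intro smooth_funpow_dx smooth_funpow_dy \<phi>(1))
    also have "(LINT z:ball 0 1|lebesgue. P a b z * \<phi> z) = (\<integral>z. Q a b z * \<phi> z \<partial>lborel)"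
      by (rule disk_rep_integral[OF locP[OF ab] Q(1)[OF ab] r smooth_continuous[OF \<phi>(1)] \<phi>(2)])
    finally show ?thesis .
  qed
  \<comment> \<open>For \<open>k = 0\<close> the sum would agree with \<open>H\<close> only almost
    everywhere; the case distinction makes \<open>D 0\<close> equal to \<open>H\<close>
    itself.\<close>
  define D where "D k = (if k = 0 then H else (\<lambda>z. \<Sum>a\<le>k. c k a * Q a (k - a) z))" for k
  have locsum: "loc_int (\<lambda>z. \<Sum>a\<in>I. c k a * Q a (k - a) z)" if "finite I" "I \<subseteq> {..k}" "k \<le> m" for I k
    using that
  proof (induction rule: finite_induct)
    case empty
    then show ?case using loc_int_continuous[OF continuous_on_const] by simp
  next
    case (insert i I)
    then have "loc_int (\<lambda>z. c k i * Q i (k - i) z)" by (intro loc_int_cmult locQ) auto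
    then show ?case using insert loc_int_add by simp
  qed
  have locD: "loc_int (D k)" if "k \<le> m" for k using locsum[of "{..k}" k] locH that by (simp add: D_def)
  have bdsum: "bounded_on_disk (\<lambda>z. \<Sum>a\<in>I. c k a * Q a (k - a) z)" if "finite I" "I \<subseteq> {..k}" "k \<le> m" for I k
    using that
  proof (induction rule: finite_induct)
    case empty
    then show ?case using bounded_on_disk_const by simp
  next
    case (insert i I)
    then have i: "i + (k - i) \<le> m" by auto
    have "bounded_on_disk (Q i (k - i))"
    proof -
      have "Q i (k - i) \<in> borel_measurable borel" using Q(1)[OF i] by (simp add: disk_rep_def)
      then show ?thesis using Q(2)[OF i] unfolding bounded_on_disk_def by blast
    qed
    then have "bounded_on_disk (\<lambda>z. c k i * Q i (k - i) z)" by (rule bounded_on_disk_mult[OF bounded_on_disk_const])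
    then show ?case using insert bounded_on_disk_add by simp
  qed
  have bdD: "bounded_on_disk (D k)" if "k \<le> m" for k using bdsum[of "{..k}" k] H(2) that by (simp add: D_def)
  have DH: "(\<integral>z. H z * (dbar ^^ k) \<phi> z \<partial>lborel) = (-1) ^ k * (\<integral>z. D k z * \<phi> z \<partial>lborel)"
    if k: "k \<le> m" and r: "r < 1" and \<phi>: "smooth \<phi>" "\<And>z. norm z > r \<Longrightarrow> \<phi> z = 0" for k r \<phi>
  proof (cases "k = 0")
    case False
    have i1: "integrable lborel (\<lambda>z. c k a * (H z * (dx ^^ a) ((dy ^^ (k - a)) \<phi>) z))" for a
      by (intro integrable_mult_right loc_int_test_integrable[OF locH r smooth_continuous funpow_dx_dy_support[OF \<phi>(2)]]
          smooth_funpow_dx smooth_funpow_dy \<phi>(1))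
    have i2: "integrable lborel (\<lambda>z. c k a * (Q a (k - a) z * \<phi> z))" if "a \<le> k" for a
      by (intro integrable_mult_right loc_int_test_integrable[OF locQ r smooth_continuous[OF \<phi>(1)] \<phi>(2)]) (use that k in auto)
    have "(\<integral>z. H z * (dbar ^^ k) \<phi> z \<partial>lborel) = (\<integral>z. (\<Sum>a\<le>k. c k a * (H z * (dx ^^ a) ((dy ^^ (k - a)) \<phi>) z)) \<partial>lborel)"
      by (simp add: c[OF \<phi>(1)] sum_distrib_left mult_ac)
    also have "\<dots> = (\<Sum>a\<le>k. (\<integral>z. c k a * (H z * (dx ^^ a) ((dy ^^ (k - a)) \<phi>) z) \<partial>lborel))"
      by (rule Bochner_Integration.integral_sum) (rule i1)
    also have "\<dots> = (\<Sum>a\<le>k. (-1) ^ k * (\<integral>z. c k a * (Q a (k - a) z * \<phi> z) \<partial>lborel))"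
    proof (rule sum.cong[OF refl])
      fix a assume "a \<in> {..k}"
      then have "a + (k - a) \<le> m" "a + (k - a) = k" using k by auto
      from QH[OF this(1) r \<phi>] this(2)
      show "(\<integral>z. c k a * (H z * (dx ^^ a) ((dy ^^ (k - a)) \<phi>) z) \<partial>lborel) = (-1) ^ k * (\<integral>z. c k a * (Q a (k - a) z * \<phi> z) \<partial>lborel)"
        unfolding integral_mult_right_zero by simp
    qed
    also have "\<dots> = (-1) ^ k * (\<integral>z. (\<Sum>a\<le>k. c k a * (Q a (k - a) z * \<phi> z)) \<partial>lborel)"
      by (subst Bochner_Integration.integral_sum) (use i2 in \<open>auto simp: sum_distrib_left\<close>)
    also have "(\<integral>z. (\<Sum>a\<le>k. c k a * (Q a (k - a) z * \<phi> z)) \<partial>lborel) = (\<integral>z. D k z * \<phi> z \<partial>lborel)"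
      using False by (simp add: D_def sum_distrib_right sum_distrib_left mult_ac)
    finally show ?thesis .
  qed (simp add: D_def)
  have step: "weak_dbar (D k) (D (Suc k))" if k: "Suc k \<le> m" for k
  proof (rule weak_dbar_smooth_tests)
    show "loc_int (D k)" "loc_int (D (Suc k))" using k by (auto intro: locD)
    fix r \<phi> assume r: "r < (1::real)" and \<phi>: "smooth \<phi>" "\<And>z. norm z > r \<Longrightarrow> \<phi> z = 0"
    have t: "test1 r \<phi>" using \<phi> by (simp add: test1_def smooth_def del: times_differentiable.simps)
    have "(-1) ^ k * (\<integral>z. D k z * dbar \<phi> z \<partial>lborel) = (\<integral>z. H z * (dbar ^^ k) (dbar \<phi>) z \<partial>lborel)"
      by (rule DH[symmetric, OF _ r smooth_dbar[OF \<phi>(1)] dbar_support[OF t]]) (use k in auto)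
    also have "\<dots> = (\<integral>z. H z * (dbar ^^ Suc k) \<phi> z \<partial>lborel)" by (simp add: funpow_swap1)
    also have "\<dots> = (-1) ^ k * (- (\<integral>z. D (Suc k) z * \<phi> z \<partial>lborel))" using DH[OF k r \<phi>] by simp
    finally show "(\<integral>z. D k z * dbar \<phi> z \<partial>lborel) = - (\<integral>z. D (Suc k) z * \<phi> z \<partial>lborel)"
      unfolding mult_cancel_left by simp
  qed
  \<comment> \<open>The induction runs downwards from \<open>D m\<close>: above
    \<open>D (m - j)\<close> there are \<open>j\<close> further functions in the chain.\<close>
  have "bounded_dbars j (D (m - j))" if "j \<le> m" for j
    using that
  proof (induction j)
    case 0
    then show ?case using bdD by simp
  next
    case (Suc j)
    then have "Suc (m - Suc j) = m - j" by simp
    then have "weak_dbar (D (m - Suc j)) (D (m - j))" using step[of "m - Suc j"] by simp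
    moreover have "bounded_dbars j (D (m - j))" using Suc by simp
    moreover have "bounded_on_disk (D (m - Suc j))" by (rule bdD) simp
    ultimately show ?case by (simp only: bounded_dbars.simps) blast
  qed
  from this[of m] show ?thesis by (simp add: D_def)
qed

section \<open>Means over circles\<close>

text \<open>The map from \<open>z\<close> to its modulus and angle is differentiable off a ray, so
  it sends null sets to null sets. By Fubini almost every section of the image, that is almost every
  circle, meets the exceptional set in a null set of angles.\<close>

lemma AE_polar:
  assumes "AE z in lborel. z \<in> ball 0 1 \<longrightarrow> P z"
  shows "AE r in lborel. 0 < r \<and> r < 1 \<longrightarrow> (AE \<theta> in lborel. \<theta> \<in> {0..2 * pi} \<longrightarrow> P (complex_of_real r * cis \<theta>))"
proof -
  from assms obtain N where N: "N \<in> null_sets lborel" "{z. \<not> (z \<in> ball 0 1 \<longrightarrow> P z)} \<subseteq> N"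
    unfolding eventually_ae_filter by auto
  define S where "S = N - {z. - z \<in> \<real>\<^sub>\<le>\<^sub>0}"
  \<comment> \<open>\<open>Ln (- z)\<close> moves the branch cut to the nonnegative real axis, which
    \<open>S\<close> leaves out. Off the cut the angle runs through the open interval from 0 to
    \<open>2 * pi\<close>.\<close>
  define g where "g z = (norm z, Im (Ln (- z)) + pi)" for z :: complex
  have "negligible N" using N(1) null_sets_completionI unfolding negligible_iff_null_sets by blast
  then have "negligible S" unfolding S_def by (rule negligible_diff)
  have "g differentiable_on S"
    unfolding differentiable_on_def
  proof
    fix z assume "z \<in> S"
    then have z: "- z \<notin> \<real>\<^sub>\<le>\<^sub>0" "z \<noteq> 0" by (auto simp: S_def)
    have "norm differentiable (at z)" using z(2) by (rule differentiable_norm_at)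
    then obtain n' where n': "(norm has_derivative n') (at z)" by (auto simp: differentiable_def)
    have "((\<lambda>z. Ln (- z)) has_field_derivative inverse (- z) * (- 1)) (at z)"
      by (rule DERIV_chain2[where f = Ln and g = uminus, OF has_field_derivative_Ln[OF z(1)]]) (auto intro!: derivative_eq_intros)
    then have "((\<lambda>z. Im (Ln (- z)) + pi) has_derivative (\<lambda>v. Im (inverse (- z) * (- 1) * v))) (at z)"
      unfolding has_field_derivative_def by (auto intro!: derivative_eq_intros)
    from has_derivative_Pair[OF n' this] have "g differentiable (at z)" unfolding g_def[abs_def] differentiable_def by blast
    then show "g differentiable (at z within S)" by (rule differentiable_at_withinI)
  qed
  then have "negligible (g ` S)"
    using negligible_differentiable_image_negligible[OF _ \<open>negligible S\<close>, of g] by simp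
  then have "AE p in lebesgue. p \<notin> g ` S" unfolding negligible_iff_null_sets by (rule AE_not_in)
  then have "AE p in lborel \<Otimes>\<^sub>M lborel. p \<notin> g ` S" unfolding AE_completion_iff lborel_prod .
  then have "AE r in lborel. AE \<theta> in lborel. (r, \<theta>) \<notin> g ` S" by (rule lborel_pair.AE_pair)
  then show ?thesis
  proof eventually_elim
    case (elim r)
    show ?case
    proof
      assume r: "0 < r \<and> r < 1"
      show "AE \<theta> in lborel. \<theta> \<in> {0..2 * pi} \<longrightarrow> P (complex_of_real r * cis \<theta>)"
        \<comment> \<open>The angles 0 and \<open>2 * pi\<close> lie on the cut and are discarded as
          null sets.\<close>
        using elim AE_lborel_singleton[of 0] AE_lborel_singleton[of "2 * pi"]
      proof eventually_elim
        case (elim \<theta>)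
        show ?case
        proof (rule impI, rule ccontr)
          assume \<theta>: "\<theta> \<in> {0..2 * pi}" and n: "\<not> P (complex_of_real r * cis \<theta>)"
          let ?z = "complex_of_real r * cis \<theta>"
          have nz: "norm ?z = r" using r by (simp add: norm_mult)
          have zN: "?z \<in> N" using N(2) n nz r by auto
          have e: "- ?z = exp (Complex (ln r) (\<theta> - pi))"
            using r by (simp add: exp_eq_polar complex_eq_iff cos_diff sin_diff)
          have L: "Ln (- ?z) = Complex (ln r) (\<theta> - pi)"
            unfolding e by (rule Ln_exp) (use \<theta> elim in auto)
          have "- ?z \<notin> \<real>\<^sub>\<le>\<^sub>0"
          proof
            assume "- ?z \<in> \<real>\<^sub>\<le>\<^sub>0"
            moreover have "Im (Ln w) = pi" if "w \<in> \<real>\<^sub>\<le>\<^sub>0" "w \<noteq> 0" for w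
              using that by (subst Im_Ln_eq_pi) (auto simp: complex_nonpos_Reals_iff complex_eq_iff less_le)
            moreover have "- ?z \<noteq> 0" using r by simp
            ultimately have "Im (Ln (- ?z)) = pi" by blast
            then show False using L \<theta> elim by simp
          qed
          then have "?z \<in> S" using zN by (simp add: S_def)
          moreover have "g ?z = (r, \<theta>)" unfolding g_def nz L by simp
          ultimately show False using elim(1) by (metis image_eqI)
        qed
      qed
    qed
  qed
qed

section \<open>Functions with bounded means on almost every circle\<close>

definition circle_mean :: "real \<Rightarrow> (complex \<Rightarrow> complex) \<Rightarrow> real \<Rightarrow> ennreal" where
  "circle_mean p f r = (\<integral>\<^sup>+\<theta>\<in>{0..2 * pi}. ennreal (norm (f (of_real r * cis \<theta>)) powr p) \<partial>lborel)"

definition AE_mean_bounded :: "real \<Rightarrow> (complex \<Rightarrow> complex) \<Rightarrow> bool" where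
  "AE_mean_bounded p f \<longleftrightarrow> (\<exists>C. AE r in lborel. 0 < r \<and> r < 1 \<longrightarrow> circle_mean p f r \<le> ennreal C)"

lemma circle_mean_cong_AE:
  assumes "AE z in lborel. z \<in> ball 0 1 \<longrightarrow> f z = g z"
  shows "AE r in lborel. 0 < r \<and> r < 1 \<longrightarrow> circle_mean p f r = circle_mean p g r"
  using AE_polar[OF assms]
proof eventually_elim
  case (elim r)
  show ?case
  proof
    assume "0 < r \<and> r < 1"
    with elim have "AE \<theta> in lborel. \<theta> \<in> {0..2 * pi} \<longrightarrow> f (complex_of_real r * cis \<theta>) = g (complex_of_real r * cis \<theta>)" by blast
    then show "circle_mean p f r = circle_mean p g r"
      unfolding circle_mean_def by (intro nn_integral_cong_AE) (auto elim!: eventually_mono simp: indicator_def)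
  qed
qed

lemma AE_mean_bounded_cong_AE:
  assumes "AE_mean_bounded p f" "AE z in lborel. z \<in> ball 0 1 \<longrightarrow> f z = g z"
  shows "AE_mean_bounded p g"
proof -
  obtain C where "AE r in lborel. 0 < r \<and> r < 1 \<longrightarrow> circle_mean p f r \<le> ennreal C"
    using assms(1) by (auto simp: AE_mean_bounded_def)
  then have "AE r in lborel. 0 < r \<and> r < 1 \<longrightarrow> circle_mean p g r \<le> ennreal C"
    using circle_mean_cong_AE[OF assms(2), of p] by eventually_elim auto
  then show ?thesis by (auto simp: AE_mean_bounded_def)
qed

lemma borel_measurable_circle:
  assumes "f \<in> borel_measurable borel"
  shows "(\<lambda>\<theta>. ennreal (norm (f (complex_of_real r * cis \<theta>)) powr p)) \<in> borel_measurable borel"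
proof -
  have "(\<lambda>\<theta>. complex_of_real r * cis \<theta>) \<in> borel_measurable borel"
    by (intro borel_measurable_continuous_UNIV continuous_intros)
  from measurable_compose[OF this assms] show ?thesis by measurable
qed

lemma AE_mean_bounded_mult:
  assumes f: "AE_mean_bounded p f" "f \<in> borel_measurable borel" and a: "bounded_on_disk a" and p: "p > 0"
  shows "AE_mean_bounded p (\<lambda>z. a z * f z)"
proof -
  obtain C where C: "AE r in lborel. 0 < r \<and> r < 1 \<longrightarrow> circle_mean p f r \<le> ennreal C"
    using f(1) by (auto simp: AE_mean_bounded_def)
  obtain M where M: "\<And>z. norm z < 1 \<Longrightarrow> norm (a z) \<le> M" using a by (auto simp: bounded_on_disk_def)
  have M0: "0 \<le> M" using order_trans[OF norm_ge_zero M[of 0]] by simp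
  have le: "circle_mean p (\<lambda>z. a z * f z) r \<le> ennreal (M powr p) * circle_mean p f r" if r: "0 < r" "r < 1" for r
  proof -
    have "circle_mean p (\<lambda>z. a z * f z) r \<le>
        (\<integral>\<^sup>+\<theta>. ennreal (M powr p) * (ennreal (norm (f (of_real r * cis \<theta>)) powr p) * indicator {0..2 * pi} \<theta>) \<partial>lborel)"
      unfolding circle_mean_def
    proof (intro nn_integral_mono)
      fix \<theta>
      let ?z = "complex_of_real r * cis \<theta>"
      have "norm ?z < 1" using r by (simp add: norm_mult)
      from M[OF this] have "norm (a ?z * f ?z) powr p \<le> (M * norm (f ?z)) powr p"
        using p by (intro powr_mono2) (auto simp: norm_mult intro: mult_right_mono)
      also have "\<dots> = M powr p * norm (f ?z) powr p" using M0 by (simp add: powr_mult)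
      finally show "ennreal (norm (a ?z * f ?z) powr p) * indicator {0..2 * pi} \<theta>
          \<le> ennreal (M powr p) * (ennreal (norm (f ?z) powr p) * indicator {0..2 * pi} \<theta>)"
        by (auto simp: indicator_def ennreal_mult'[symmetric] intro: ennreal_leI)
    qed
    also have "\<dots> = ennreal (M powr p) * circle_mean p f r"
      unfolding circle_mean_def using borel_measurable_circle[OF f(2), of r p]
      by (intro nn_integral_cmult) auto
    finally show ?thesis .
  qed
  have "AE r in lborel. 0 < r \<and> r < 1 \<longrightarrow> circle_mean p (\<lambda>z. a z * f z) r \<le> ennreal (M powr p * C)"
    using C
  proof eventually_elim
    case (elim r)
    show ?case
    proof
      assume r: "0 < r \<and> r < 1"
      have "circle_mean p (\<lambda>z. a z * f z) r \<le> ennreal (M powr p) * circle_mean p f r" using le r by blast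
      also have "\<dots> \<le> ennreal (M powr p) * ennreal C" using elim r by (intro mult_left_mono) auto
      also have "\<dots> = ennreal (M powr p * C)" by (simp add: ennreal_mult')
      finally show "circle_mean p (\<lambda>z. a z * f z) r \<le> ennreal (M powr p * C)" .
    qed
  qed
  then show ?thesis by (auto simp: AE_mean_bounded_def)
qed

text \<open>Estimating the sum by twice the larger term covers every positive exponent, including
  those below 1, where Minkowski's inequality fails.\<close>

lemma powr_add_le:
  fixes a b p :: real
  assumes "a \<ge> 0" "b \<ge> 0" "p > 0"
  shows "(a + b) powr p \<le> 2 powr p * (a powr p + b powr p)"
proof -
  have "(a + b) powr p \<le> (2 * max a b) powr p" using assms by (intro powr_mono2) auto
  also have "\<dots> = 2 powr p * max a b powr p" using assms by (simp add: powr_mult)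
  also have "max a b powr p \<le> a powr p + b powr p" by (auto simp: max_def)
  finally show ?thesis by simp
qed

lemma AE_mean_bounded_add:
  assumes f: "AE_mean_bounded p f" "f \<in> borel_measurable borel"
    and g: "AE_mean_bounded p g" "g \<in> borel_measurable borel" and p: "p > 0"
  shows "AE_mean_bounded p (\<lambda>z. f z + g z)"
proof -
  obtain C D where C: "AE r in lborel. 0 < r \<and> r < 1 \<longrightarrow> circle_mean p f r \<le> ennreal C"
    and D: "AE r in lborel. 0 < r \<and> r < 1 \<longrightarrow> circle_mean p g r \<le> ennreal D"
    using f(1) g(1) by (auto simp: AE_mean_bounded_def)
  have le: "circle_mean p (\<lambda>z. f z + g z) r \<le> ennreal (2 powr p) * (circle_mean p f r + circle_mean p g r)" for r
  proof -
    note m = borel_measurable_circle[OF f(2), of r p] borel_measurable_circle[OF g(2), of r p]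
    let ?f = "\<lambda>\<theta>. ennreal (norm (f (of_real r * cis \<theta>)) powr p) * indicator {0..2 * pi} \<theta>"
    let ?g = "\<lambda>\<theta>. ennreal (norm (g (of_real r * cis \<theta>)) powr p) * indicator {0..2 * pi} \<theta>"
    have m': "?f \<in> borel_measurable lborel" "?g \<in> borel_measurable lborel" using m by auto
    have "circle_mean p (\<lambda>z. f z + g z) r \<le> (\<integral>\<^sup>+\<theta>. ennreal (2 powr p) * (?f \<theta> + ?g \<theta>) \<partial>lborel)"
      unfolding circle_mean_def
    proof (intro nn_integral_mono)
      fix \<theta>
      let ?z = "complex_of_real r * cis \<theta>"
      have "norm (f ?z + g ?z) powr p \<le> (norm (f ?z) + norm (g ?z)) powr p"
        using p by (intro powr_mono2) (auto intro: norm_triangle_ineq)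
      also have "\<dots> \<le> 2 powr p * (norm (f ?z) powr p + norm (g ?z) powr p)"
        using p by (intro powr_add_le) auto
      finally show "ennreal (norm (f ?z + g ?z) powr p) * indicator {0..2 * pi} \<theta> \<le> ennreal (2 powr p) * (?f \<theta> + ?g \<theta>)"
        by (auto simp: indicator_def ennreal_mult'[symmetric] ennreal_plus[symmetric] simp del: ennreal_plus intro: ennreal_leI)
    qed
    also have "\<dots> = ennreal (2 powr p) * (\<integral>\<^sup>+\<theta>. ?f \<theta> + ?g \<theta> \<partial>lborel)"
      by (rule nn_integral_cmult) (intro borel_measurable_add m')
    also have "(\<integral>\<^sup>+\<theta>. ?f \<theta> + ?g \<theta> \<partial>lborel) = circle_mean p f r + circle_mean p g r"
      unfolding circle_mean_def by (rule nn_integral_add[OF m'])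
    finally show ?thesis .
  qed
  have "AE r in lborel. 0 < r \<and> r < 1 \<longrightarrow> circle_mean p (\<lambda>z. f z + g z) r \<le> ennreal (2 powr p * (max 0 C + max 0 D))"
    using C D
  proof eventually_elim
    case (elim r)
    show ?case
    proof
      assume r: "0 < r \<and> r < 1"
      have "circle_mean p f r \<le> ennreal (max 0 C)" "circle_mean p g r \<le> ennreal (max 0 D)"
        using elim r by (auto intro: order_trans ennreal_leI)
      then have "circle_mean p f r + circle_mean p g r \<le> ennreal (max 0 C + max 0 D)"
        by (subst ennreal_plus) (auto intro: add_mono)
      then have "ennreal (2 powr p) * (circle_mean p f r + circle_mean p g r) \<le> ennreal (2 powr p) * ennreal (max 0 C + max 0 D)"
        by (intro mult_left_mono) auto
      also have "\<dots> = ennreal (2 powr p * (max 0 C + max 0 D))" by (simp only: ennreal_mult'[symmetric] powr_ge_zero)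
      finally show "circle_mean p (\<lambda>z. f z + g z) r \<le> ennreal (2 powr p * (max 0 C + max 0 D))"
        using le[of r] by (rule order_trans[rotated])
    qed
  qed
  then show ?thesis by (auto simp: AE_mean_bounded_def)
qed

lemma AE_mean_bounded_0: "AE_mean_bounded p (\<lambda>_. 0)"
  by (auto simp: AE_mean_bounded_def circle_mean_def)

lemma AE_mean_bounded_sum:
  assumes "finite I" "p > 0"
    and "\<And>i. i \<in> I \<Longrightarrow> AE_mean_bounded p (f i)" "\<And>i. i \<in> I \<Longrightarrow> f i \<in> borel_measurable borel"
  shows "AE_mean_bounded p (\<lambda>z. \<Sum>i\<in>I. f i z)"
  using assms
proof (induction rule: finite_induct)
  case empty
  then show ?case using AE_mean_bounded_0 by simp
next
  case (insert i I)
  have "AE_mean_bounded p (\<lambda>z. f i z + (\<Sum>i\<in>I. f i z))"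
    using insert by (intro AE_mean_bounded_add borel_measurable_sum) auto
  then show ?case using insert by simp
qed

lemma hardy_sup_circle_mean: "hardy_sup p f = (SUP r\<in>{0<..<1}. circle_mean p f r)"
  by (simp add: hardy_sup_def circle_mean_def nn_integral_completion)

text \<open>The means of \<open>f\<close> itself are bounded on every circle; replacing
  \<open>f\<close> by its Borel representative keeps the bound for almost every radius.\<close>

lemma AE_mean_bounded_hardy_sup:
  assumes "hardy_sup p f < \<infinity>" "disk_rep f h"
  shows "AE_mean_bounded p h"
proof -
  obtain C where C: "hardy_sup p f = ennreal C" using assms(1) by (cases "hardy_sup p f") auto
  have "circle_mean p f r \<le> ennreal C" if "0 < r" "r < 1" for r
    unfolding C[symmetric] hardy_sup_circle_mean using that by (intro SUP_upper) auto
  then have "AE_mean_bounded p f" unfolding AE_mean_bounded_def by blast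
  then show ?thesis
    by (rule AE_mean_bounded_cong_AE) (use assms(2) in \<open>auto simp: disk_rep_def\<close>)
qed

lemma AE_lborel_ex_in_interval:
  assumes "AE x in lborel. Q x" "a < (b::real)"
  shows "\<exists>x. a < x \<and> x < b \<and> Q x"
proof (rule ccontr)
  assume n: "\<not> ?thesis"
  have "AE x in lborel. x \<notin> {a<..<b}" using assms(1) by eventually_elim (use n in auto)
  then have "{a<..<b} \<in> null_sets lborel" by (subst AE_iff_null_sets) auto
  then show False using assms(2) by (auto simp: null_sets_def)
qed

lemma Hardy_if_AE_mean_bounded:
  assumes h: "h holomorphic_on ball 0 1" and b: "AE_mean_bounded p h" and p: "p > 0"
  shows "h \<in> Hardy p"
proof -
  obtain C where C: "AE r in lborel. 0 < r \<and> r < 1 \<longrightarrow> circle_mean p h r \<le> ennreal C"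
    using b by (auto simp: AE_mean_bounded_def)
  have cont: "continuous_on (ball 0 1) h" by (rule holomorphic_on_imp_continuous_on[OF h])
  have "circle_mean p h r0 \<le> ennreal C" if r0: "0 < r0" "r0 < 1" for r0
  proof -
    \<comment> \<open>Radii that obey the bound have full measure, hence can be chosen to approach
      \<open>r0\<close> from above; the width \<open>1 - r0\<close> keeps them below 1.\<close>
    have "\<exists>r. r0 < r \<and> r < r0 + (1 - r0) / real (Suc n) \<and> (0 < r \<and> r < 1 \<longrightarrow> circle_mean p h r \<le> ennreal C)" for n
      by (rule AE_lborel_ex_in_interval[OF C]) (use r0 in simp)
    then obtain r where r: "\<And>n. r0 < r n" "\<And>n. r n < r0 + (1 - r0) / real (Suc n)"
      "\<And>n. 0 < r n \<and> r n < 1 \<longrightarrow> circle_mean p h (r n) \<le> ennreal C" by metis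
    have r01: "0 < r n" "r n < 1" for n
    proof -
      show "0 < r n" using r(1)[of n] r0 by simp
      have "(1 - r0) / real (Suc n) \<le> (1 - r0) / 1" using r0 by (intro divide_left_mono) auto
      then show "r n < 1" using r(2)[of n] by simp
    qed
    have rlim: "r \<longlonglongrightarrow> r0"
    proof (rule tendsto_sandwich)
      show "\<forall>\<^sub>F n in sequentially. r0 \<le> r n" "\<forall>\<^sub>F n in sequentially. r n \<le> r0 + (1 - r0) / real (Suc n)"
        using r(1,2) by (auto intro!: always_eventually less_imp_le)
      show "(\<lambda>n. r0 + (1 - r0) / real (Suc n)) \<longlonglongrightarrow> r0" by real_asymp
    qed simp
    let ?F = "\<lambda>r \<theta>. ennreal (norm (h (complex_of_real r * cis \<theta>)) powr p) * indicator {0..2 * pi} \<theta>"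
    have conv: "(\<lambda>n. ?F (r n) \<theta>) \<longlonglongrightarrow> ?F r0 \<theta>" for \<theta>
    proof -
      have "complex_of_real r0 * cis \<theta> \<in> ball 0 1" using r0 by (simp add: norm_mult)
      then have "isCont h (complex_of_real r0 * cis \<theta>)" using cont by (simp add: continuous_on_eq_continuous_at)
      moreover have "(\<lambda>n. complex_of_real (r n) * cis \<theta>) \<longlonglongrightarrow> complex_of_real r0 * cis \<theta>"
        by (intro tendsto_intros rlim)
      ultimately have "(\<lambda>n. norm (h (complex_of_real (r n) * cis \<theta>))) \<longlonglongrightarrow> norm (h (complex_of_real r0 * cis \<theta>))"
        by (intro tendsto_norm isCont_tendsto_compose[where g = h])
      then have "(\<lambda>n. norm (h (complex_of_real (r n) * cis \<theta>)) powr p) \<longlonglongrightarrow> norm (h (complex_of_real r0 * cis \<theta>)) powr p"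
        by (rule tendsto_powr'[OF _ tendsto_const]) (use p in auto)
      then have "(\<lambda>n. ennreal (norm (h (complex_of_real (r n) * cis \<theta>)) powr p)) \<longlonglongrightarrow> ennreal (norm (h (complex_of_real r0 * cis \<theta>)) powr p)"
        by (rule tendsto_ennrealI)
      then show ?thesis by (cases "\<theta> \<in> {0..2 * pi}") auto
    qed
    have meas: "?F (r n) \<in> borel_measurable lborel" for n
    proof -
      have "continuous_on UNIV (\<lambda>\<theta>. h (complex_of_real (r n) * cis \<theta>))"
        by (rule continuous_on_compose2[OF cont]) (use r01[of n] in \<open>auto intro!: continuous_intros simp: norm_mult\<close>)
      from borel_measurable_continuous_UNIV[OF this]
      have "(\<lambda>\<theta>. ennreal (norm (h (complex_of_real (r n) * cis \<theta>)) powr p)) \<in> borel_measurable borel" by measurable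
      then show ?thesis by auto
    qed
    have "circle_mean p h r0 = (\<integral>\<^sup>+\<theta>. liminf (\<lambda>n. ?F (r n) \<theta>) \<partial>lborel)"
      unfolding circle_mean_def using lim_imp_Liminf[OF _ conv] by (intro nn_integral_cong) auto
    also have "\<dots> \<le> liminf (\<lambda>n. \<integral>\<^sup>+\<theta>. ?F (r n) \<theta> \<partial>lborel)"
      by (rule nn_integral_liminf[OF meas])
    also have "\<dots> = liminf (\<lambda>n. circle_mean p h (r n))" by (simp add: circle_mean_def)
    also have "\<dots> \<le> liminf (\<lambda>n. ennreal C)"
      by (rule Liminf_mono) (use r(3) r01 in auto)
    also have "\<dots> = ennreal C" by (rule Liminf_const) simp
    finally show ?thesis .
  qed
  then have "hardy_sup p h \<le> ennreal C" unfolding hardy_sup_circle_mean by (intro SUP_least) auto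
  then have "hardy_sup p h < \<infinity>" using le_less_trans[OF _ ennreal_less_top] by simp
  then show ?thesis using h by (simp add: Hardy_def)
qed

section \<open>Polyanalytic decomposition\<close>

text \<open>Holomorphy on the disk says nothing about values outside it. Extension by 0 makes the
  function Borel on the whole plane, as \<open>weak_dbar\<close> demands.\<close>

lemma weak_dbar_0_representative:
  assumes "weak_dbar f (\<lambda>_. 0)"
  obtains h where "h holomorphic_on ball 0 1" "weak_dbar h (\<lambda>_. 0)" "AE z in lborel. z \<in> ball 0 1 \<longrightarrow> f z = h z"
proof -
  obtain k where k: "k holomorphic_on ball 0 1" "AE z in lborel. z \<in> ball 0 1 \<longrightarrow> f z = k z"
    using weak_dbar_0_holomorphic[OF assms] by blast
  define h where "h z = indicator (ball 0 1) z *\<^sub>R k z" for z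
  have eq: "h z = k z" if "z \<in> ball 0 1" for z using that by (simp add: h_def)
  have "h \<in> borel_measurable borel"
    unfolding h_def[abs_def]
    by (rule borel_measurable_continuous_on_indicator[OF _ holomorphic_on_imp_continuous_on[OF k(1)]]) simp
  moreover have ae: "AE z in lborel. z \<in> ball 0 1 \<longrightarrow> f z = h z"
    using k(2) by eventually_elim (simp add: eq)
  ultimately have "weak_dbar h (\<lambda>_. 0)"
    by (intro weak_dbar_cong_AE[OF assms ae]) auto
  moreover have "h holomorphic_on ball 0 1"
    using k(1) by (rule holomorphic_transform) (simp add: eq)
  ultimately show ?thesis using that ae by blast
qed

text \<open>With the factor \<open>1 / fact k\<close> each power of \<open>cnj z\<close> is a
  \<open>dbar\<close>-primitive of the preceding one, and a factor \<open>h\<close> with weak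
  derivative 0 passes through the product rule.\<close>

lemma weak_dbar_cnj_power:
  assumes "weak_dbar h (\<lambda>_. 0)"
  shows "weak_dbar (\<lambda>z. cnj z ^ Suc k / fact (Suc k) * h z) (\<lambda>z. cnj z ^ k / fact k * h z)"
proof -
  have "dbar cnj = (\<lambda>_. 1)" using dbar_cnj[of 0] by (auto simp: fun_eq_iff)
  then have "weak_dbar cnj (\<lambda>_. 1)"
    using weak_dbar_classical[OF times_differentiable_cnj[of 1 0]] by simp
  from weak_dbar_power[OF this, of 1 1 k]
  have "weak_dbar (\<lambda>z. cnj z ^ Suc k) (\<lambda>z. of_nat (Suc k) * cnj z ^ k)" by simp
  from weak_dbar_cmult[OF this, of "1 / fact (Suc k)"]
  have w: "weak_dbar (\<lambda>z. cnj z ^ Suc k / fact (Suc k)) (\<lambda>z. cnj z ^ k / fact k)"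
    by (simp add: fact_Suc del: of_nat_Suc power_Suc)
  have le: "norm (cnj z ^ j / fact j) \<le> 1" if "norm z < 1" for z j
  proof -
    have "norm (cnj z ^ j / fact j) = norm z ^ j / fact j" by (simp add: norm_divide norm_power)
    also have "\<dots> \<le> 1 / 1" using that by (intro frac_le power_le_one) (auto simp: fact_ge_1)
    finally show ?thesis by simp
  qed
  from weak_dbar_mult[OF w le le assms] show ?thesis by simp
qed

text \<open>A Taylor formula in \<open>cnj z\<close>. The induction decomposes the sequence from
  \<open>v 1\<close> on; the sum for \<open>v 1\<close> is integrated term by term, and what remains
  of \<open>v 0\<close> has weak derivative 0, hence is holomorphic. One family \<open>h\<close>
  serves all the \<open>v j\<close>.\<close>

lemma polyanalytic_decomposition:
  assumes "\<And>j. j < n \<Longrightarrow> weak_dbar (v j) (v (Suc j))"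
    and "AE z in lborel. z \<in> ball 0 1 \<longrightarrow> v n z = 0" "v n \<in> borel_measurable borel"
  shows "\<exists>h. (\<forall>j<n. h j holomorphic_on ball 0 1 \<and> weak_dbar (h j) (\<lambda>_. 0) \<and>
     (AE z in lborel. z \<in> ball 0 1 \<longrightarrow> v j z = (\<Sum>k<n - j. cnj z ^ k / fact k * h (j + k) z)))"
  using assms
proof (induction n arbitrary: v)
  case (Suc n)
  have "\<exists>h. (\<forall>j<n. h j holomorphic_on ball 0 1 \<and> weak_dbar (h j) (\<lambda>_. 0) \<and>
     (AE z in lborel. z \<in> ball 0 1 \<longrightarrow> v (Suc j) z = (\<Sum>k<n - j. cnj z ^ k / fact k * h (j + k) z)))"
    by (rule Suc.IH[of "\<lambda>j. v (Suc j)"]) (use Suc.prems in auto)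
  then obtain h where h: "\<And>j. j < n \<Longrightarrow> h j holomorphic_on ball 0 1" "\<And>j. j < n \<Longrightarrow> weak_dbar (h j) (\<lambda>_. 0)"
    "\<And>j. j < n \<Longrightarrow> AE z in lborel. z \<in> ball 0 1 \<longrightarrow> v (Suc j) z = (\<Sum>k<n - j. cnj z ^ k / fact k * h (j + k) z)"
    by blast
  define S where "S z = (\<Sum>k<n. cnj z ^ Suc k / fact (Suc k) * h k z)" for z
  define T where "T z = (\<Sum>k<n. cnj z ^ k / fact k * h k z)" for z
  have ST: "weak_dbar S T"
    unfolding S_def[abs_def] T_def[abs_def] 
  proof (rule weak_dbar_sum)
    fix k assume "k \<in> {..<n}"
    then show "weak_dbar (\<lambda>z. cnj z ^ Suc k / fact (Suc k) * h k z) (\<lambda>z. cnj z ^ k / fact k * h k z)"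
      by (intro weak_dbar_cnj_power h(2)) simp
  qed simp
  \<comment> \<open>For \<open>n = 0\<close> the sum \<open>T\<close> is empty, and
    \<open>v 1\<close> is the last function of the sequence, which vanishes by hypothesis.\<close>
  have vT: "AE z in lborel. z \<in> ball 0 1 \<longrightarrow> v 1 z = T z"
  proof (cases n)
    case 0
    then show ?thesis using Suc.prems(2) by (simp add: T_def)
  next
    case (Suc m)
    then show ?thesis using h(3)[of 0] by (simp add: T_def)
  qed
  have "weak_dbar (\<lambda>z. v 0 z - S z) (\<lambda>z. v 1 z - T z)"
    using weak_dbar_diff[OF Suc.prems(1)[of 0] ST] by simp
  then have "weak_dbar (\<lambda>z. v 0 z - S z) (\<lambda>_. 0)"
    by (rule weak_dbar_cong_AE)
       (use vT in \<open>auto elim: eventually_mono intro: loc_int_measurable[OF weak_dbarD(1)[OF \<open>weak_dbar (\<lambda>z. v 0 z - S z) (\<lambda>z. v 1 z - T z)\<close>]]\<close>)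
  then obtain h0 where h0: "h0 holomorphic_on ball 0 1" "weak_dbar h0 (\<lambda>_. 0)"
    "AE z in lborel. z \<in> ball 0 1 \<longrightarrow> v 0 z - S z = h0 z"
    by (rule weak_dbar_0_representative)
  define h' where "h' j = (case j of 0 \<Rightarrow> h0 | Suc i \<Rightarrow> h i)" for j
  show ?case
  proof (intro exI[of _ h'] allI impI)
    fix j assume j: "j < Suc n"
    show "h' j holomorphic_on ball 0 1 \<and> weak_dbar (h' j) (\<lambda>_. 0) \<and>
      (AE z in lborel. z \<in> ball 0 1 \<longrightarrow> v j z = (\<Sum>k<Suc n - j. cnj z ^ k / fact k * h' (j + k) z))"
    proof (cases j)
      case 0
      have "(\<Sum>k<Suc n. cnj z ^ k / fact k * h' k z) = h0 z + S z" for z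
        unfolding S_def sum.lessThan_Suc_shift by (simp add: h'_def)
      moreover have "AE z in lborel. z \<in> ball 0 1 \<longrightarrow> v 0 z = h0 z + S z"
        using h0(3) by eventually_elim (auto simp: algebra_simps)
      ultimately show ?thesis using h0 0 by (simp add: h'_def)
    next
      case (Suc i)
      then show ?thesis using h[of i] j by (simp add: h'_def)
    qed
  qed
qed simp

section \<open>The representation theorem\<close>

lemma cauchy_potential_eq:
  assumes H: "bounded_data (ball 0 1) H C" and rep: "disk_rep A H"
    and meas: "(\<lambda>\<zeta>. indicator (ball 0 1) \<zeta> *\<^sub>R A \<zeta>) \<in> borel_measurable lebesgue"
  shows "cauchy_potential A = cauchy_transform H"
proof
  fix z :: complex
  interpret bounded_data "ball 0 1" H C by fact
  have inv: "(\<lambda>\<zeta>. 1 / (\<zeta> - z)) \<in> borel_measurable borel"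
    by (rule measurable_compose[OF _ borel_measurable_complex_inverse, of "\<lambda>\<zeta> :: complex. \<zeta> - z"]) simp
  have m: "(\<lambda>\<zeta>. H \<zeta> * (1 / (\<zeta> - z))) \<in> borel_measurable lborel"
    using borel_measurable_times[OF H_meas inv] by simp
  have "(LINT \<zeta>:ball 0 1|lebesgue. A \<zeta> / (\<zeta> - z)) = integral\<^sup>L lebesgue (\<lambda>\<zeta>. H \<zeta> * (1 / (\<zeta> - z)))"
    unfolding set_lebesgue_integral_def
  proof (rule integral_cong_AE)
    have inv': "(\<lambda>\<zeta>. 1 / (\<zeta> - z)) \<in> borel_measurable lebesgue"
      using inv by (intro measurable_completion) simp
    have eq: "(\<lambda>\<zeta>. (indicator (ball 0 1) \<zeta> *\<^sub>R A \<zeta>) * (1 / (\<zeta> - z))) =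
        (\<lambda>\<zeta>. indicator (ball 0 1) \<zeta> *\<^sub>R (A \<zeta> / (\<zeta> - z)))"
      by (rule ext) (simp add: indicator_def)
    show "(\<lambda>\<zeta>. indicator (ball 0 1) \<zeta> *\<^sub>R (A \<zeta> / (\<zeta> - z))) \<in> borel_measurable lebesgue"
      using borel_measurable_times[OF meas inv'] unfolding eq .
    show "(\<lambda>\<zeta>. H \<zeta> * (1 / (\<zeta> - z))) \<in> borel_measurable lebesgue" using m by (rule measurable_completion)
    have "AE \<zeta> in lebesgue. \<zeta> \<in> ball 0 1 \<longrightarrow> A \<zeta> = H \<zeta>"
      using rep AE_completion unfolding disk_rep_def by blast
    then show "AE \<zeta> in lebesgue. indicator (ball 0 1) \<zeta> *\<^sub>R (A \<zeta> / (\<zeta> - z)) = H \<zeta> * (1 / (\<zeta> - z))"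
    proof eventually_elim
      case (elim \<zeta>)
      then show ?case using H(2)[of \<zeta>] by (cases "\<zeta> \<in> ball 0 1") auto
    qed
  qed
  also have "\<dots> = (\<integral>\<zeta>. H \<zeta> * (1 / (\<zeta> - z)) \<partial>lborel)" by (rule integral_completion[OF m])
  also have "\<dots> = (\<integral>\<zeta>. - (H \<zeta> * (1 / (z - \<zeta>))) \<partial>lborel)"
  proof (intro Bochner_Integration.integral_cong refl)
    fix \<zeta>
    have "1 / (\<zeta> - z) = - (1 / (z - \<zeta>))" by (metis minus_diff_eq minus_divide_right)
    then show "H \<zeta> * (1 / (\<zeta> - z)) = - (H \<zeta> * (1 / (z - \<zeta>)))" by simp
  qed
  also have "\<dots> = - (\<integral>\<zeta>. H \<zeta> * (1 / (z - \<zeta>)) \<partial>lborel)" by (rule Bochner_Integration.integral_minus)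
  finally have I: "(LINT \<zeta>:ball 0 1|lebesgue. A \<zeta> / (\<zeta> - z)) = - (\<integral>\<zeta>. H \<zeta> * (1 / (z - \<zeta>)) \<partial>lborel)" .
  show "cauchy_potential A z = cauchy_transform H z"
    unfolding cauchy_potential_def cauchy_transform_def I by (simp only: minus_mult_minus)
qed

text \<open>By induction on \<open>j\<close>, \<open>(dbar - A)^j w\<close> is a combination of \<open>w, dbar w, \<dots>, dbar^j w\<close> whose
  coefficients still have \<open>n - 1 - j\<close> bounded weak \<open>dbar\<close>-derivatives.\<close>

lemma meta_op_combination:
  assumes F: "\<And>j. j < n \<Longrightarrow> weak_dbar (F j) (\<lambda>z. F (Suc j) z + H z * F j z)"
    and G: "\<And>k. Suc k < n \<Longrightarrow> weak_dbar (G k) (G (Suc k))"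
    and FG: "AE z in lborel. z \<in> ball 0 1 \<longrightarrow> F 0 z = G 0 z"
    and H: "bounded_dbars (n - 1) H"
  shows "j < n \<Longrightarrow> \<exists>c. (\<forall>i\<le>j. bounded_dbars (n - 1 - j) (c i)) \<and>
      (AE z in lborel. z \<in> ball 0 1 \<longrightarrow> F j z = (\<Sum>i\<le>j. c i z * G i z))"
proof (induction j)
  case 0
  then show ?case using FG by (intro exI[of _ "\<lambda>_ _. 1"]) (simp add: bounded_dbars_const)
next
  case (Suc j)
  define m where "m = n - 1 - Suc j"
  have m: "n - 1 - j = Suc m" using Suc.prems by (simp add: m_def)
  from Suc obtain c where c: "\<And>i. i \<le> j \<Longrightarrow> bounded_dbars (Suc m) (c i)"
    "AE z in lborel. z \<in> ball 0 1 \<longrightarrow> F j z = (\<Sum>i\<le>j. c i z * G i z)"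
    using m by auto
  have "\<forall>i\<in>{..j}. \<exists>c'. weak_dbar (c i) c' \<and> bounded_dbars m c'" using c(1) by simp
  then obtain c' where c': "\<And>i. i \<le> j \<Longrightarrow> weak_dbar (c i) (c' i)" "\<And>i. i \<le> j \<Longrightarrow> bounded_dbars m (c' i)"
    by (metis atMost_iff)
  have Hm: "bounded_dbars m H" by (rule bounded_dbars_mono[OF H]) (simp add: m_def)
  \<comment> \<open>The coefficients after one more application of \<open>dbar - H\<close>: the
    product rule contributes \<open>c' i - H * c i\<close>, and differentiating
    \<open>G (i - 1)\<close> moves \<open>c (i - 1)\<close> up by one index. At
    \<open>i = Suc j\<close> only the shifted term remains.\<close>
  define d where "d i z = (if i \<le> j then c' i z + (- 1) * (H z * c i z) else 0) + (if i = 0 then 0 else c (i - 1) z)" for i z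
  have wS: "weak_dbar (\<lambda>z. \<Sum>i\<le>j. c i z * G i z) (\<lambda>z. \<Sum>i\<le>j. c' i z * G i z + c i z * G (Suc i) z)"
  proof (rule weak_dbar_sum)
    fix i assume "i \<in> {..j}"
    then have i: "i \<le> j" "Suc i < n" using Suc.prems by auto
    show "weak_dbar (\<lambda>z. c i z * G i z) (\<lambda>z. c' i z * G i z + c i z * G (Suc i) z)"
      by (rule weak_dbar_mult_bounded[OF c'(1)[OF i(1)] bounded_dbars_bounded[OF c(1)[OF i(1)]]
            bounded_dbars_bounded[OF c'(2)[OF i(1)]] G[OF i(2)]])
  qed simp
  have wF: "weak_dbar (F j) (\<lambda>z. F (Suc j) z + H z * F j z)" using F Suc.prems by simp
  have "weak_dbar (\<lambda>z. \<Sum>i\<le>j. c i z * G i z) (\<lambda>z. F (Suc j) z + H z * F j z)"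
    by (rule weak_dbar_cong_AE[OF wF c(2)])
       (use loc_int_measurable[OF weak_dbarD(1)[OF wS]] loc_int_measurable[OF weak_dbarD(2)[OF wF]] in auto)
  \<comment> \<open>Both functions are weak derivatives of the same sum; comparing them isolates
    \<open>F (Suc j)\<close>.\<close>
  from weak_dbar_unique[OF this wS]
  have "AE z in lborel. z \<in> ball 0 1 \<longrightarrow> F (Suc j) z = (\<Sum>i\<le>Suc j. d i z * G i z)"
    using c(2)
  proof eventually_elim
    case (elim z)
    have "(\<Sum>i\<le>Suc j. d i z * G i z) = (\<Sum>i\<le>Suc j. (if i \<le> j then c' i z + (- 1) * (H z * c i z) else 0) * G i z) +
        (\<Sum>i\<le>Suc j. (if i = 0 then 0 else c (i - 1) z) * G i z)"
      by (simp only: d_def distrib_right sum.distrib)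
    also have "(\<Sum>i\<le>Suc j. (if i \<le> j then c' i z + (- 1) * (H z * c i z) else 0) * G i z) = (\<Sum>i\<le>j. (c' i z + (- 1) * (H z * c i z)) * G i z)"
      by simp
    also have "(\<Sum>i\<le>Suc j. (if i = 0 then 0 else c (i - 1) z) * G i z) = (\<Sum>i\<le>j. c i z * G (Suc i) z)"
      by (subst sum.atMost_Suc_shift) simp
    also have "(\<Sum>i\<le>j. (c' i z + (- 1) * (H z * c i z)) * G i z) + (\<Sum>i\<le>j. c i z * G (Suc i) z)
        = (\<Sum>i\<le>j. c' i z * G i z + c i z * G (Suc i) z) - H z * (\<Sum>i\<le>j. c i z * G i z)"
      unfolding sum_distrib_left sum.distrib[symmetric] sum_subtractf[symmetric]
      by (intro sum.cong refl) (simp add: algebra_simps)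
    finally have eq: "(\<Sum>i\<le>Suc j. d i z * G i z) =
        (\<Sum>i\<le>j. c' i z * G i z + c i z * G (Suc i) z) - H z * (\<Sum>i\<le>j. c i z * G i z)" .
    show ?case unfolding eq eq_diff_eq using elim by auto
  qed
  moreover have "bounded_dbars m (d i)" if "i \<le> Suc j" for i
  proof -
    have 1: "bounded_dbars m (\<lambda>z. if i \<le> j then c' i z + (- 1) * (H z * c i z) else 0)"
    proof (cases "i \<le> j")
      case True
      have "bounded_dbars m (\<lambda>z. c' i z + (- 1) * (H z * c i z))"
        by (intro bounded_dbars_add[OF c'(2)[OF True]] bounded_dbars_mult[OF bounded_dbars_const]
            bounded_dbars_mult[OF Hm bounded_dbars_Suc_imp[OF c(1)[OF True]]])
      then show ?thesis using True by simp
    qed (simp add: bounded_dbars_const)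
    have 2: "bounded_dbars m (\<lambda>z. if i = 0 then 0 else c (i - 1) z)"
      using bounded_dbars_Suc_imp[OF c(1)[of "i - 1"]] that by (cases i) (auto intro: bounded_dbars_const)
    from bounded_dbars_add[OF 1 2] show ?thesis unfolding d_def[abs_def] .
  qed
  ultimately show ?case unfolding m_def by blast
qed

lemma ennreal_pow_finite:
  assumes "ennreal_pow x s < \<infinity>"
  shows "x < \<infinity>"
  using assms by (cases "x = \<infinity>") (auto simp: ennreal_pow_def less_top)

theorem theorem3p4:
  fixes n :: nat and p :: real and A w :: "complex \<Rightarrow> complex"
  assumes "n > 0" and "0 < p"
    and "A \<in> W_infinity (n - 1) unit_disk"
    and "w \<in> meta_Hardy n p A"
  shows "\<exists>u :: nat \<Rightarrow> complex \<Rightarrow> complex.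
           (\<forall>k<n. u k \<in> Hardy p) \<and>
           (AE z in lebesgue_on unit_disk.
              w z = exp (cauchy_potential A z) * (\<Sum>k<n. cnj z ^ k * u k z)) \<and>
           (continuous_on unit_disk w \<longrightarrow>
              (\<forall>z\<in>unit_disk.
                 w z = exp (cauchy_potential A z) * (\<Sum>k<n. cnj z ^ k * u k z)))"
proof -
  have AL: "A \<in> L_infinity (ball 0 1)" using assms(3) by (simp add: W_infinity_def)
  obtain H C where rep: "disk_rep A H" "\<And>z. norm (H z) \<le> C" "\<And>z. z \<notin> ball 0 1 \<Longrightarrow> H z = 0"
    using ex_bounded_disk_rep[OF AL] by blast
  have Hm: "H \<in> borel_measurable borel" using rep(1) by (simp add: disk_rep_def)
  have bdH: "bounded_on_disk H" using Hm rep(2) unfolding bounded_on_disk_def by blast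
  have Hn: "bounded_dbars (n - 1) H" by (rule bounded_dbars_W_infinity[OF assms(3) rep(1) bdH])
  interpret bounded_data "ball 0 1" H C by unfold_locales (use rep Hm in auto)
  have bdata: "bounded_data (ball 0 1) H C" by unfold_locales
  define \<psi> where "\<psi> = cauchy_transform H"
  have \<psi>: "cauchy_potential A = \<psi>"
    unfolding \<psi>_def
  proof (rule cauchy_potential_eq[OF bdata rep(1)])
    show "(\<lambda>\<zeta>. indicator (ball 0 1) \<zeta> *\<^sub>R A \<zeta>) \<in> borel_measurable lebesgue"
      using AL by (auto simp: L_infinity_def borel_measurable_restrict_space_iff)
  qed
  have \<psi>c: "continuous_on UNIV \<psi>" unfolding \<psi>_def by (rule continuous_cauchy_transform)
  have \<psi>w: "weak_dbar (\<lambda>z. - 1 * \<psi> z) (\<lambda>z. - 1 * H z)"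
    unfolding \<psi>_def by (rule weak_dbar_cmult[OF weak_dbar_cauchy_transform[OF bdata]])
  \<comment> \<open>The integrating factor, with weak derivative \<open>- H * E\<close>. It is
    bounded on the disk because \<open>\<psi>\<close> is, so multiplying by it preserves bounds on
    means.\<close>
  define E where "E z = exp (- 1 * \<psi> z)" for z
  have Ew: "weak_dbar E (\<lambda>z. (- 1 * H z) * E z)"
    unfolding E_def[abs_def]
    by (rule weak_dbar_exp[OF \<psi>w, of "C * cauchy_bound (ball 0 1) / pi" C])
       (use norm_cauchy_transform_le rep(2) in \<open>auto simp: \<psi>_def\<close>)
  have Ec: "continuous_on UNIV E" unfolding E_def[abs_def] by (intro continuous_intros \<psi>c)
  have bdE: "bounded_on_disk E"
  proof -
    obtain B where "\<And>z. norm z \<le> 1 \<Longrightarrow> norm (E z) \<le> B" using continuous_bounded_on_cball[OF Ec] by blast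
    then have "\<forall>z. norm z < 1 \<longrightarrow> norm (E z) \<le> B" by simp
    then show ?thesis using borel_measurable_continuous_UNIV[OF Ec] unfolding bounded_on_disk_def by blast
  qed
  have bdE': "bounded_on_disk (\<lambda>z. (- 1 * H z) * E z)"
    by (intro bounded_on_disk_mult bounded_on_disk_const bdH bdE)

  have "(meta_op A ^^ n) w (\<lambda>_. 0)" using assms(4) by (simp add: meta_Hardy_def)
  \<comment> \<open>\<open>Fs i\<close> is one version of \<open>(dbar - A)^i w\<close>, as the
    relational power leaves a choice on null sets at each step.\<close>
  then obtain Fs where Fs: "Fs 0 = w" "Fs n = (\<lambda>_. 0)" "\<And>i. i < n \<Longrightarrow> meta_op A (Fs i) (Fs (Suc i))"
    unfolding relpowp_fun_conv by blast
  have "\<exists>g. g 0 = w \<and> (\<forall>k<n. has_weak_dbar unit_disk k w (g k)) \<and>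
      (\<Sum>k<n. ennreal_pow (hardy_sup p (g k)) (1 / p)) < \<infinity>"
    using assms(4) by (simp add: meta_Hardy_def)
  then obtain g where g: "g 0 = w" "\<And>k. k < n \<Longrightarrow> has_weak_dbar unit_disk k w (g k)"
    "(\<Sum>k<n. ennreal_pow (hardy_sup p (g k)) (1 / p)) < \<infinity>"
    by blast
  have locF: "locally_integrable (ball 0 1) (Fs i)" if "i < n" for i
    using Fs(3)[OF that] by (auto simp: meta_op_def has_weak_dbar_def has_weak_derivative_def)
  have locg: "locally_integrable (ball 0 1) (g k)" if "k < n" for k
    using g(2)[OF that] by (auto simp: has_weak_dbar_def has_weak_derivative_def)
  \<comment> \<open>The default makes \<open>F n\<close> the zero function itself, so
    \<open>v n\<close> below vanishes at every point.\<close>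
  define F where "F i = (if i < n then SOME h. disk_rep (Fs i) h else (\<lambda>_. 0))" for i
  have F: "disk_rep (Fs i) (F i)" if "i \<le> n" for i
  proof (cases "i < n")
    case True
    then show ?thesis unfolding F_def using someI_ex[OF ex_disk_rep[OF locF[OF True]]] by simp
  next
    case False
    then have "i = n" using that by simp
    then show ?thesis using Fs(2) by (simp add: F_def disk_rep_def)
  qed
  define G where "G k = (SOME h. disk_rep (g k) h)" for k
  have G: "disk_rep (g k) (G k)" if "k < n" for k
    unfolding G_def by (rule someI_ex[OF ex_disk_rep[OF locg[OF that]]])
  have Fm: "F i \<in> borel_measurable borel" if "i \<le> n" for i using F[OF that] by (simp add: disk_rep_def)
  have Gm: "G k \<in> borel_measurable borel" if "k < n" for k using G[OF that] by (simp add: disk_rep_def)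
  have wF: "weak_dbar (F j) (\<lambda>z. F (Suc j) z + H z * F j z)" if j: "j < n" for j
  proof -
    from Fs(3)[OF j] obtain d where d: "has_weak_dbar unit_disk 1 (Fs j) d" "Fs (Suc j) = (\<lambda>z. d z - A z * Fs j z)"
      unfolding meta_op_def by blast
    show ?thesis
    proof (rule has_weak_dbar_imp_weak_dbar[OF d(1)])
      show "disk_rep (Fs j) (F j)" using F j by simp
      have r: "AE z in lborel. z \<in> ball 0 1 \<longrightarrow> Fs j z = F j z" "AE z in lborel. z \<in> ball 0 1 \<longrightarrow> Fs (Suc j) z = F (Suc j) z"
        "AE z in lborel. z \<in> ball 0 1 \<longrightarrow> A z = H z"
        using F[of j] F[of "Suc j"] rep(1) j by (auto simp: disk_rep_def)
      have "AE z in lborel. z \<in> ball 0 1 \<longrightarrow> d z = F (Suc j) z + H z * F j z"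
        using r by eventually_elim (auto simp: d(2) algebra_simps)
      moreover have "(\<lambda>z. F (Suc j) z + H z * F j z) \<in> borel_measurable borel"
        by (intro borel_measurable_add borel_measurable_times Fm Hm) (use j in auto)
      ultimately show "disk_rep d (\<lambda>z. F (Suc j) z + H z * F j z)" unfolding disk_rep_def by blast
    qed
  qed
  have wG: "weak_dbar (G k) (G (Suc k))" if "Suc k < n" for k
    using has_weak_dbar_imp_weak_dbar[OF has_weak_dbar_step[OF g(2)[of k] g(2)[of "Suc k"]] G[of k] G[of "Suc k"]] that
    by simp
  have FG: "AE z in lborel. z \<in> ball 0 1 \<longrightarrow> F 0 z = G 0 z"
  proof -
    have "AE z in lborel. z \<in> ball 0 1 \<longrightarrow> w z = F 0 z" "AE z in lborel. z \<in> ball 0 1 \<longrightarrow> w z = G 0 z"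
      using F[of 0] G[of 0] Fs(1) g(1) assms(1) by (auto simp: disk_rep_def)
    then show ?thesis by eventually_elim auto
  qed
  have boundG: "AE_mean_bounded p (G k)" if k: "k < n" for k
  proof (rule AE_mean_bounded_hardy_sup[OF _ G[OF k]])
    have "ennreal_pow (hardy_sup p (g k)) (1 / p) \<le> (\<Sum>k<n. ennreal_pow (hardy_sup p (g k)) (1 / p))"
      by (rule member_le_sum) (use k in auto)
    from ennreal_pow_finite[OF le_less_trans[OF this g(3)]] show "hardy_sup p (g k) < \<infinity>" .
  qed
  define v where "v j z = E z * F j z" for j z
  have vm: "v j \<in> borel_measurable borel" if "j \<le> n" for j
    unfolding v_def[abs_def] by (intro borel_measurable_times Fm that borel_measurable_continuous_UNIV[OF Ec])
  have boundv: "AE_mean_bounded p (v j)" if j: "j < n" for j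
  proof -
    obtain c where c: "\<And>i. i \<le> j \<Longrightarrow> bounded_dbars (n - 1 - j) (c i)"
      "AE z in lborel. z \<in> ball 0 1 \<longrightarrow> F j z = (\<Sum>i\<le>j. c i z * G i z)"
      using meta_op_combination[OF wF wG FG Hn j] by blast
    have cb: "bounded_on_disk (c i)" if "i \<le> j" for i using bounded_dbars_bounded[OF c(1)[OF that]] .
    have "AE_mean_bounded p (\<lambda>z. \<Sum>i\<le>j. c i z * G i z)"
    proof (rule AE_mean_bounded_sum)
      fix i assume "i \<in> {..j}"
      then have i: "i \<le> j" "i < n" using j by auto
      show "AE_mean_bounded p (\<lambda>z. c i z * G i z)"
        by (rule AE_mean_bounded_mult[OF boundG[OF i(2)] Gm[OF i(2)] cb[OF i(1)] assms(2)])
      show "(\<lambda>z. c i z * G i z) \<in> borel_measurable borel"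
        using cb[OF i(1)] by (intro borel_measurable_times Gm[OF i(2)]) (simp add: bounded_on_disk_def)
    qed (use assms(2) in auto)
    then have "AE_mean_bounded p (F j)"
      by (rule AE_mean_bounded_cong_AE) (use c(2) in \<open>auto elim: eventually_mono\<close>)
    then show ?thesis unfolding v_def[abs_def] using j by (intro AE_mean_bounded_mult Fm bdE assms(2)) auto
  qed
  \<comment> \<open>The term \<open>- H * E * F j\<close> from the integrating factor cancels
    \<open>E * H * F j\<close>.\<close>
  have wv: "weak_dbar (v j) (v (Suc j))" if j: "j < n" for j
  proof -
    have "weak_dbar (\<lambda>z. E z * F j z) (\<lambda>z. ((- 1 * H z) * E z) * F j z + E z * (F (Suc j) z + H z * F j z))"
      by (rule weak_dbar_mult_bounded[OF Ew bdE bdE' wF[OF j]])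
    then show ?thesis unfolding v_def[abs_def] by (simp add: algebra_simps)
  qed
  have vn: "v n z = 0" for z by (simp add: v_def F_def)
  have "\<exists>h. (\<forall>j<n. h j holomorphic_on ball 0 1 \<and> weak_dbar (h j) (\<lambda>_. 0) \<and>
     (AE z in lborel. z \<in> ball 0 1 \<longrightarrow> v j z = (\<Sum>k<n - j. cnj z ^ k / fact k * h (j + k) z)))"
    by (rule polyanalytic_decomposition) (use wv vn vm[of n] in auto)
  then obtain h where h: "\<And>j. j < n \<Longrightarrow> h j holomorphic_on ball 0 1" "\<And>j. j < n \<Longrightarrow> weak_dbar (h j) (\<lambda>_. 0)"
    "\<And>j. j < n \<Longrightarrow> AE z in lborel. z \<in> ball 0 1 \<longrightarrow> v j z = (\<Sum>k<n - j. cnj z ^ k / fact k * h (j + k) z)"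
    by blast
  have hm: "h j \<in> borel_measurable borel" if "j < n" for j by (rule loc_int_measurable[OF weak_dbarD(1)[OF h(2)[OF that]]])
  have cm: "(\<lambda>z. cnj z ^ k / fact k) \<in> borel_measurable borel" for k
    by (intro borel_measurable_continuous_UNIV continuous_intros) simp
  have cb: "bounded_on_disk (\<lambda>z. - (cnj z ^ k / fact k))" for k
  proof -
    have c: "continuous_on UNIV (\<lambda>z. - (cnj z ^ k / fact k) :: complex)" by (intro continuous_intros) simp
    obtain B where "\<And>z. norm z \<le> 1 \<Longrightarrow> norm (- (cnj z ^ k / fact k)) \<le> B"
      using continuous_bounded_on_cball[OF c] by blast
    then have "\<forall>z. norm z < 1 \<longrightarrow> norm (- (cnj z ^ k / fact k)) \<le> B" by simp
    then show ?thesis using borel_measurable_continuous_UNIV[OF c] unfolding bounded_on_disk_def by blast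
  qed
  \<comment> \<open>\<open>m\<close> counts down from the top coefficient:
    \<open>h (n - Suc m)\<close> is \<open>v (n - Suc m)\<close> minus terms whose coefficients have
    larger index and are bounded by induction. For \<open>m = 0\<close> no such terms occur.\<close>
  have boundh: "AE_mean_bounded p (h (n - Suc m))" if "m < n" for m
    using that
  proof (induction m rule: less_induct)
    case (less m)
    define j where "j = n - Suc m"
    have j: "j < n" "n - j = Suc m" using less.prems by (auto simp: j_def)
    have b: "AE_mean_bounded p (h (j + Suc k))" "j + Suc k < n" if "k < m" for k
    proof -
      have "j + Suc k = n - Suc (m - Suc k)" "m - Suc k < m" "m - Suc k < n" using that less.prems by (auto simp: j_def)
      with less.IH[of "m - Suc k"] show "AE_mean_bounded p (h (j + Suc k))" by simp
      show "j + Suc k < n" using that less.prems by (auto simp: j_def)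
    qed
    have "AE_mean_bounded p (\<lambda>z. v j z + (\<Sum>k<m. - (cnj z ^ Suc k / fact (Suc k)) * h (j + Suc k) z))"
    proof (intro AE_mean_bounded_add boundv[OF j(1)] AE_mean_bounded_sum AE_mean_bounded_mult assms(2) cb vm borel_measurable_sum borel_measurable_times)
      show "j \<le> n" using j by simp
      fix k assume k: "k \<in> {..<m}"
      then show "AE_mean_bounded p (h (j + Suc k))" "h (j + Suc k) \<in> borel_measurable borel"
        "h (j + Suc k) \<in> borel_measurable borel" "h (j + Suc k) \<in> borel_measurable borel"
        using b[of k] hm[of "j + Suc k"] by auto
      show "(\<lambda>z. - (cnj z ^ Suc k / fact (Suc k))) \<in> borel_measurable borel" "(\<lambda>z. - (cnj z ^ Suc k / fact (Suc k))) \<in> borel_measurable borel"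
        using cb[of "Suc k"] unfolding bounded_on_disk_def by blast+
    qed auto
    then have "AE_mean_bounded p (h j)"
    proof (rule AE_mean_bounded_cong_AE)
      show "AE z in lborel. z \<in> ball 0 1 \<longrightarrow> v j z + (\<Sum>k<m. - (cnj z ^ Suc k / fact (Suc k)) * h (j + Suc k) z) = h j z"
        using h(3)[OF j(1)]
      proof eventually_elim
        case (elim z)
        have "(\<Sum>k<n - j. cnj z ^ k / fact k * h (j + k) z) = h j z + (\<Sum>k<m. cnj z ^ Suc k / fact (Suc k) * h (j + Suc k) z)"
          unfolding j(2) sum.lessThan_Suc_shift by simp
        then show ?case using elim by (simp add: sum_negf)
      qed
    qed
    then show ?case by (simp add: j_def)
  qed
  \<comment> \<open>The factorials of the Taylor sum are absorbed into the coefficients.\<close>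
  define u where "u k z = (1 / fact k) * h k z" for k z
  have "u k \<in> Hardy p" if k: "k < n" for k
  proof (rule Hardy_if_AE_mean_bounded)
    show "u k holomorphic_on ball 0 1" unfolding u_def[abs_def] by (intro holomorphic_intros h(1)[OF k])
    have "AE_mean_bounded p (h k)" using boundh[of "n - Suc k"] k by simp
    then show "AE_mean_bounded p (u k)"
      unfolding u_def[abs_def] by (intro AE_mean_bounded_mult hm[OF k] bounded_on_disk_const assms(2))
  qed (rule assms(2))
  moreover have ae: "AE z in lborel. z \<in> ball 0 1 \<longrightarrow> w z = exp (cauchy_potential A z) * (\<Sum>k<n. cnj z ^ k * u k z)"
  proof -
    have "AE z in lborel. z \<in> ball 0 1 \<longrightarrow> w z = F 0 z" using F[of 0] Fs(1) by (auto simp: disk_rep_def)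
    with h(3)[OF assms(1)] show ?thesis
    proof eventually_elim
      case (elim z)
      show ?case
      proof
        assume z: "z \<in> ball 0 1"
        have "exp (\<psi> z) * E z = 1" unfolding E_def by (simp add: exp_minus_inverse)
        then have "exp (\<psi> z) * v 0 z = F 0 z" unfolding v_def mult.assoc[symmetric] by simp
        then have "w z = exp (\<psi> z) * v 0 z" using elim z by simp
        also have "v 0 z = (\<Sum>k<n. cnj z ^ k * u k z)" using elim z by (simp add: u_def)
        finally show "w z = exp (cauchy_potential A z) * (\<Sum>k<n. cnj z ^ k * u k z)" unfolding \<psi> .
      qed
    qed
  qed
  moreover have "AE z in lebesgue_on unit_disk. w z = exp (cauchy_potential A z) * (\<Sum>k<n. cnj z ^ k * u k z)"
    using ae[unfolded AE_completion_iff[of _ lborel, symmetric]]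
    by (subst AE_restrict_space_iff) (auto elim: eventually_mono)
  \<comment> \<open>Under this assumption both sides are continuous: \<open>\<psi>\<close> as the
    transform of bounded data, each \<open>u k\<close> as a holomorphic function. So the identity
    almost everywhere holds at every point.\<close>
  moreover have "w z = exp (cauchy_potential A z) * (\<Sum>k<n. cnj z ^ k * u k z)"
    if "continuous_on unit_disk w" "z \<in> unit_disk" for z
  proof (rule AE_eq_continuous[OF ae open_ball that(1) _ that(2)])
    have "continuous_on (ball 0 1) (u k)" if "k < n" for k
      unfolding u_def[abs_def] by (intro continuous_intros holomorphic_on_imp_continuous_on h(1)[OF that])
    then show "continuous_on (ball 0 1) (\<lambda>z. exp (cauchy_potential A z) * (\<Sum>k<n. cnj z ^ k * u k z))"
      unfolding \<psi> by (intro continuous_intros continuous_on_subset[OF \<psi>c]) auto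
  qed
  ultimately show ?thesis by blast
qed

end
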